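(* Consider the following eleven rows of lattices (each row indexed by $\rho-d$, with $\rho$ the rank and $d$ the rank of the 2-primary discriminant, lattices in a row ordered by increasing $t$): $\rho-d=0$: $-A_1+\langle6\rangle+tA_1$, $d=t+2$, $0\le t\le9$; $\rho-d=2$: $-A_1+A_2+tA_1$, $d=t+1$, $0\le t\le9$; $\rho-d=4$: $U+A_2+tA_1$, $d=t$, $1\le t\le9$; $\rho-d=6$: $U+A_2+D_4+tA_1$, $d=t+2$, $1\le t\le6$; $\rho-d=8$: $-A_1+\langle6\rangle+E_8+tA_1$, $d=t+2$, $0\le t\le5$; $\rho-d=10$: $-A_1+A_2+E_8+tA_1$, $d=t+1$, $0\le t\le5$; $\rho-d=12$: $U+A_2+E_8+tA_1$, $d=t$, $1\le t\le5$; $\rho-d=14$: $U+A_2+D_4+E_8+tA_1$, $d=t+2$, $1\le t\le2$; $\rho-d=16$: $-A_1+\langle6\rangle+2E_8+tA_1$, $d=t+2$, $0\le t\le1$; $\rho-d=18$: $-A_1+A_2+2E_8+tA_1$, $d=t+2$, $0\le t\le1$; $\rho-d=20$: $U+A_2+2E_8+tA_1$, $d=t$, $t=1$. In this table the first achiral lattice in the first row $\rho=d$ is defined by $t=2$, in the rows $\rho=d+2k$, $k=1,\dots,6$, it is defined by $\rho+d=14$, and in the last four rows all lattices are achiral.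
   Context: These are the lattices $\mathbb M_+^0$ (invariant part of $H^4$ of a real non-singular cubic fourfold, orthogonal to the polarization) for the coarse deformation classes with odd 2-primary discriminant form. $U$ hyperbolic plane, $A_n,D_n,E_n$ positive definite root lattices, $-A_1=\langle-2\rangle$, $\langle6\rangle$ rank one lattice with generator of square 6, $+$ orthogonal sum. Within each row, achirality of a lattice implies achirality of all lattices with larger $t$ (adding $A_1$ preserves achirality), so "first achiral lattice" means all earlier ones are chiral and all later ones achiral. For an even hyperbolic lattice $\mathbb L$ with $\operatorname{discr}_3\mathbb L=\mathbb Z/3$ and $\operatorname{discr}_2$ of period 2: $W$ is generated by reflections in 2-roots ($v^2=2$) and 6-roots ($v^2=6$, $v\cdot\mathbb L\subset3\mathbb Z$); cells $P$ are fundamental chambers of $W$ in the hyperbolic space, lifting to $\pm P^\#$ in the double cover. An automorphism is $P$-direct if it preserves $P^\#$, $\mathbb Z/3$-reversing if it acts as $-\operatorname{id}$ on $\operatorname{discr}_3\mathbb L$. $\mathbb L$ is achiral if it admits an automorphism that is $\mathbb Z/3$-reversing and $P$-direct for some cell $P$, chiral otherwise. *)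

theory Defs
  imports "HOL-Analysis.Analysis"
begin

text \<open>A lattice is given by its rank n and its integral Gram matrix (entries outside
  {0..<n} x {0..<n} are irrelevant).  Vectors of the ambient real space are functions
  nat => real vanishing from index n on; the topology is the product topology on
  nat => real, which restricted to such vectors is the Euclidean topology of R^n.\<close>

type_synonym lat = "nat \<times> (nat \<Rightarrow> nat \<Rightarrow> int)"

definition lat_of :: "int list list \<Rightarrow> lat" where
  "lat_of M = (length M, \<lambda>i j. if i < length M \<and> j < length M then M ! i ! j else 0)"

definition osum :: "lat \<Rightarrow> lat \<Rightarrow> lat" where
  "osum L1 L2 = (case L1 of (n, G) \<Rightarrow> case L2 of (m, H) \<Rightarrow>
     (n + m, \<lambda>i j. if i < n \<and> j < n then G i j
                   else if n \<le> i \<and> n \<le> j \<and> i < n + m \<and> j < n + m then H (i - n) (j - n)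
                   else 0))"

primrec rep :: "nat \<Rightarrow> lat \<Rightarrow> lat" where
  "rep 0 L = (0, \<lambda>_ _. 0)"
| "rep (Suc k) L = osum L (rep k L)"

definition latA1 :: lat where "latA1 = lat_of [[2]]"
definition latmA1 :: lat where "latmA1 = lat_of [[-2]]"
definition lat6 :: lat where "lat6 = lat_of [[6]]"
definition latU :: lat where "latU = lat_of [[0,1],[1,0]]"
definition latA2 :: lat where "latA2 = lat_of [[2,-1],[-1,2]]"
definition latD4 :: lat where
  "latD4 = lat_of [[2,-1,0,0],[-1,2,-1,-1],[0,-1,2,0],[0,-1,0,2]]"
text \<open>E8 Cartan matrix, Bourbaki numbering 1..8 (node 2 attached to node 4, chain 1-3-4-5-6-7-8).\<close>
definition latE8 :: lat where
  "latE8 = lat_of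
    [[ 2, 0,-1, 0, 0, 0, 0, 0],
     [ 0, 2, 0,-1, 0, 0, 0, 0],
     [-1, 0, 2,-1, 0, 0, 0, 0],
     [ 0,-1,-1, 2,-1, 0, 0, 0],
     [ 0, 0, 0,-1, 2,-1, 0, 0],
     [ 0, 0, 0, 0,-1, 2,-1, 0],
     [ 0, 0, 0, 0, 0,-1, 2,-1],
     [ 0, 0, 0, 0, 0, 0,-1, 2]]"

definition rk :: "lat \<Rightarrow> nat" where "rk L = fst L"

definition bil :: "lat \<Rightarrow> (nat \<Rightarrow> real) \<Rightarrow> (nat \<Rightarrow> real) \<Rightarrow> real" where
  "bil L x y = (\<Sum>i<fst L. \<Sum>j<fst L. of_int (snd L i j) * x i * y j)"

definition rvec :: "nat \<Rightarrow> (nat \<Rightarrow> real) set" where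
  "rvec n = {x. \<forall>i\<ge>n. x i = 0}"

definition lat_pts :: "lat \<Rightarrow> (nat \<Rightarrow> real) set" where
  "lat_pts L = {x \<in> rvec (fst L). \<forall>i. x i \<in> \<int>}"

definition act :: "nat \<Rightarrow> (nat \<Rightarrow> nat \<Rightarrow> int) \<Rightarrow> (nat \<Rightarrow> real) \<Rightarrow> (nat \<Rightarrow> real)" where
  "act n A x = (\<lambda>i. if i < n then (\<Sum>j<n. of_int (A i j) * x j) else 0)"

definition is_aut :: "lat \<Rightarrow> (nat \<Rightarrow> nat \<Rightarrow> int) \<Rightarrow> bool" where
  "is_aut L A \<longleftrightarrow> bij_betw (act (fst L) A) (lat_pts L) (lat_pts L) \<and>
     (\<forall>x\<in>lat_pts L. \<forall>y\<in>lat_pts L. bil L (act (fst L) A x) (act (fst L) A y) = bil L x y)"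

text \<open>Dual lattice and the preimage of the 3-primary part of the discriminant group.\<close>
definition dual_pts :: "lat \<Rightarrow> (nat \<Rightarrow> real) set" where
  "dual_pts L = {x \<in> rvec (fst L). \<forall>v\<in>lat_pts L. bil L x v \<in> \<int>}"

definition three_primary :: "lat \<Rightarrow> (nat \<Rightarrow> real) set" where
  "three_primary L = {x \<in> dual_pts L. \<exists>k::nat. (\<lambda>i. 3 ^ k * x i) \<in> lat_pts L}"

text \<open>Z/3-reversing: the automorphism acts as -id on discr_3 L.\<close>
definition z3_reversing :: "lat \<Rightarrow> (nat \<Rightarrow> nat \<Rightarrow> int) \<Rightarrow> bool" where
  "z3_reversing L A \<longleftrightarrow>
     (\<forall>x\<in>three_primary L. (\<lambda>i. act (fst L) A x i + x i) \<in> lat_pts L)"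

definition refl_vecs :: "lat \<Rightarrow> (nat \<Rightarrow> real) set" where
  "refl_vecs L = {v \<in> lat_pts L. bil L v v = 2 \<or>
      (bil L v v = 6 \<and> (\<forall>w\<in>lat_pts L. \<exists>k::int. bil L v w = 3 * of_int k))}"

definition refl :: "lat \<Rightarrow> (nat \<Rightarrow> real) \<Rightarrow> (nat \<Rightarrow> real) \<Rightarrow> (nat \<Rightarrow> real)" where
  "refl L a x = (\<lambda>i. x i - 2 * bil L x a / bil L a a * a i)"

inductive_set weyl :: "lat \<Rightarrow> ((nat \<Rightarrow> real) \<Rightarrow> (nat \<Rightarrow> real)) set" for L where
  weyl_id: "id \<in> weyl L"
| weyl_step: "w \<in> weyl L \<Longrightarrow> v \<in> refl_vecs L \<Longrightarrow> refl L v \<circ> w \<in> weyl L"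

definition mirrors :: "lat \<Rightarrow> (nat \<Rightarrow> real) set" where
  "mirrors L = \<Union> {{x \<in> rvec (fst L). bil L x a = 0} | a.
      a \<in> rvec (fst L) \<and> bil L a a \<noteq> 0 \<and>
      (\<exists>w\<in>weyl L. \<forall>x\<in>rvec (fst L). w x = refl L a x)}"

text \<open>The cone of negative vectors (a double cover of the hyperbolic space,
  the lattice having signature (rank-1,1)).\<close>
definition neg_cone :: "lat \<Rightarrow> (nat \<Rightarrow> real) set" where
  "neg_cone L = {x \<in> rvec (fst L). bil L x x < 0}"

text \<open>Lifts P# of cells P to the double cover: the (open) chambers of W in the
  negative cone, i.e. connected components of the cone minus all mirrors.\<close>
definition cell_lifts :: "lat \<Rightarrow> (nat \<Rightarrow> real) set set" where
  "cell_lifts L = {connected_component_set (neg_cone L - mirrors L) x | x.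
      x \<in> neg_cone L - mirrors L}"

definition achiral :: "lat \<Rightarrow> bool" where
  "achiral L \<longleftrightarrow> (\<exists>A. is_aut L A \<and> z3_reversing L A \<and>
      (\<exists>K\<in>cell_lifts L. act (fst L) A ` K = K))"

definition row0 :: "nat \<Rightarrow> lat" where "row0 t = osum latmA1 (osum lat6 (rep t latA1))"
definition row2 :: "nat \<Rightarrow> lat" where "row2 t = osum latmA1 (osum latA2 (rep t latA1))"
definition row4 :: "nat \<Rightarrow> lat" where "row4 t = osum latU (osum latA2 (rep t latA1))"
definition row6 :: "nat \<Rightarrow> lat" where
  "row6 t = osum latU (osum latA2 (osum latD4 (rep t latA1)))"
definition row8 :: "nat \<Rightarrow> lat" where
  "row8 t = osum latmA1 (osum lat6 (osum latE8 (rep t latA1)))"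
definition row10 :: "nat \<Rightarrow> lat" where
  "row10 t = osum latmA1 (osum latA2 (osum latE8 (rep t latA1)))"
definition row12 :: "nat \<Rightarrow> lat" where
  "row12 t = osum latU (osum latA2 (osum latE8 (rep t latA1)))"
definition row14 :: "nat \<Rightarrow> lat" where
  "row14 t = osum latU (osum latA2 (osum latD4 (osum latE8 (rep t latA1))))"
definition row16 :: "nat \<Rightarrow> lat" where
  "row16 t = osum latmA1 (osum lat6 (osum latE8 (osum latE8 (rep t latA1))))"
definition row18 :: "nat \<Rightarrow> lat" where
  "row18 t = osum latmA1 (osum latA2 (osum latE8 (osum latE8 (rep t latA1))))"
definition row20 :: "nat \<Rightarrow> lat" where
  "row20 t = osum latU (osum latA2 (osum latE8 (osum latE8 (rep t latA1))))"

end

(*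
  Chirality.  Count the mirrors of 6-roots separating two points of the cone.  Modulo 2 this count is
  additive, a 2- or 4-reflection changes it by an even and a 6-reflection by an odd number, and a
  6-reflection acts as -1 on discr_3.  If A preserves a cell, the count between p and Ap is even for
  every negative p with p/3 generating discr_3.  In U + A2 + E8 the walls found by Vinberg's algorithm
  reduce every pair (z,p) with z isotropic, p^2 = -12, z.p = -3 to a single one, so that the count
  between two such p is even exactly when they have the same class in discr_3.  The chiral lattices
  with rho > d are orthogonal complements of pairwise orthogonal 2-roots in U + A2 + E8, and
  restricting the 6-mirrors to such a complement does not change parities.  For rho = d the same
  argument runs in -A1 + <6> + A1, where no z is needed.

  Achirality.  Let e, h, a_1, ..., a_5 be orthogonal of squares -2, 6, 2, ..., 2, with h a 6-root, and
  put e' = 3e + h + a_1 + ... + a_5.  The involution that is -1 on the complement of e' in their span,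
  a copy of E6(2), and 1 on the orthogonal complement reverses discr_3.  Norms in E6(2) are divisible
  by 4, so no root is anti-invariant and generic fixed vectors lie in the interior of a cell.
  -A1 + <6> + 2A1 has no such frame but an involution with anti-invariant lattice A2(4).
*)
theory Submission
  imports Defs
begin

text \<open>The norm -12 makes the count well defined at p. Lattice vectors q with q/3 in the dual
  have norm 0 or 6 modulo 9; were a 6-root u orthogonal to p, then p + u would be such a vector of
  norm -6. So p avoids all 6-mirrors, though it may lie on mirrors of 2-roots, which are therefore
  not counted.

  In U + A2 + E8 the companion z is essential: besides (3,-3; -1,-2; 0) the closed chamber contains
  (6,-6; -2,-4; -3w), with w the fundamental weight of norm 4, again of norm -12 but of the opposite
  class in discr_3. The condition z.p = -3 excludes it and is carried along by automorphisms.

  Parity and reversal collide in 2p/3: an even count makes (Ap - p)/3 integral, reversal makes (Ap +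
  p)/3 integral, so 2p/3 would be a lattice vector of norm -16/3.

  The two halves meet because a suitable 4A1 in E8 has complement 4A1 again. Below the threshold a
  lattice with rho > d is what U + A2 + E8 leaves after orthogonal 2-roots are removed; from the
  threshold on there are five orthogonal 2-roots with primitive span next to e and h.\<close>

definition lc :: "real \<Rightarrow> (nat \<Rightarrow> real) \<Rightarrow> real \<Rightarrow> (nat \<Rightarrow> real) \<Rightarrow> nat \<Rightarrow> real" where
  "lc a x b y = (\<lambda>i. a * x i + b * y i)"

definition cat :: "nat \<Rightarrow> (nat \<Rightarrow> real) \<Rightarrow> (nat \<Rightarrow> real) \<Rightarrow> nat \<Rightarrow> real" where
  "cat n x y = (\<lambda>i. if i < n then x i else y (i - n))"

definition shift :: "nat \<Rightarrow> (nat \<Rightarrow> real) \<Rightarrow> nat \<Rightarrow> real" where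
  "shift n x = (\<lambda>i. x (i + n))"

definition trunc :: "nat \<Rightarrow> (nat \<Rightarrow> real) \<Rightarrow> nat \<Rightarrow> real" where
  "trunc n x = (\<lambda>i. if i < n then x i else 0)"

definition unit :: "nat \<Rightarrow> nat \<Rightarrow> real" where
  "unit j = (\<lambda>i. if i = j then 1 else 0)"

section \<open>Bilinear forms, lattice points and orthogonal sums\<close>

lemma bil_cong:
  assumes "\<And>i. i < fst L \<Longrightarrow> x i = x' i" "\<And>i. i < fst L \<Longrightarrow> y i = y' i"
  shows "bil L x y = bil L x' y'"
  unfolding bil_def using assms by (intro sum.cong) auto

lemma bil_lc_left: "bil L (lc a x b y) z = a * bil L x z + b * bil L y z"
  unfolding bil_def lc_def by (simp add: algebra_simps sum.distrib sum_distrib_left)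

lemma bil_lc_right: "bil L z (lc a x b y) = a * bil L z x + b * bil L z y"
  unfolding bil_def lc_def by (simp add: algebra_simps sum.distrib sum_distrib_left)

lemma bil_sum_left: "bil L (\<lambda>i. \<Sum>k\<in>K. c k * f k i) z = (\<Sum>k\<in>K. c k * bil L (f k) z)"
proof (cases "finite K")
  case True
  then show ?thesis
  proof (induction K rule: finite_induct)
    case empty
    then show ?case by (simp add: bil_def)
  next
    case (insert k K)
    have "(\<lambda>i. \<Sum>k\<in>insert k K. c k * f k i) = lc (c k) (f k) 1 (\<lambda>i. \<Sum>k\<in>K. c k * f k i)"
      using insert by (auto simp: lc_def)
    then show ?case using insert by (simp add: bil_lc_left)
  qed
next
  case False
  then show ?thesis by (simp add: bil_def)
qed

lemma bil_minus_left: "bil L (\<lambda>i. - x i) z = - bil L x z"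
  and bil_minus_right: "bil L z (\<lambda>i. - x i) = - bil L z x"
  unfolding bil_def by (simp_all add: sum_negf)

lemma bil_scale_left: "bil L (\<lambda>i. c * x i) z = c * bil L x z"
  and bil_scale_right: "bil L z (\<lambda>i. c * x i) = c * bil L z x"
  unfolding bil_def by (simp_all add: sum_distrib_left algebra_simps)

lemma refl_lc: "refl L v x = lc 1 x (- (2 * bil L x v / bil L v v)) v"
  by (auto simp: refl_def lc_def)

lemma bil_osum:
  "bil (osum L M) x y = bil L x y + bil M (shift (fst L) x) (shift (fst L) y)"
proof -
  obtain n G m H where L: "L = (n, G)" and M: "M = (m, H)"
    by (cases L, cases M) auto
  let ?K = "\<lambda>i j. if i < n \<and> j < n then G i j
              else if n \<le> i \<and> n \<le> j \<and> i < n + m \<and> j < n + m then H (i - n) (j - n) else 0"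
  have split: "(\<Sum>i<n + m. f i) = (\<Sum>i<n. f i) + (\<Sum>i<m. f (i + n))" for f :: "nat \<Rightarrow> real"
    using sum.atLeastLessThan_concat[of 0 n "n + m" f] sum.shift_bounds_nat_ivl[of f 0 n m]
    by (simp add: atLeast0LessThan add.commute)
  have "bil (osum L M) x y = (\<Sum>i<n + m. \<Sum>j<n + m. of_int (?K i j) * x i * y j)"
    by (simp add: L M osum_def bil_def)
  also have "\<dots> = bil L x y + bil M (shift (fst L) x) (shift (fst L) y)"
    by (simp add: split L M bil_def shift_def)
  finally show ?thesis .
qed

lemma fst_osum [simp]: "fst (osum L M) = fst L + fst M"
  by (cases L; cases M) (simp add: osum_def)

lemma lc_rvec: "x \<in> rvec n \<Longrightarrow> y \<in> rvec n \<Longrightarrow> lc a x b y \<in> rvec n"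
  by (simp add: rvec_def lc_def)

lemma lc_lat_pts:
  "x \<in> lat_pts L \<Longrightarrow> y \<in> lat_pts L \<Longrightarrow> a \<in> \<int> \<Longrightarrow> b \<in> \<int> \<Longrightarrow> lc a x b y \<in> lat_pts L"
  by (auto simp: lat_pts_def rvec_def lc_def)

lemma lat_ptsD: "x \<in> lat_pts L \<Longrightarrow> x i \<in> \<int>" "x \<in> lat_pts L \<Longrightarrow> x \<in> rvec (fst L)"
  by (auto simp: lat_pts_def)

lemma bil_Ints: "x \<in> lat_pts L \<Longrightarrow> y \<in> lat_pts L \<Longrightarrow> bil L x y \<in> \<int>"
  unfolding bil_def by (intro Ints_sum Ints_mult) (auto simp: lat_pts_def)

lemma unit_lat_pts: "j < fst L \<Longrightarrow> unit j \<in> lat_pts L"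
  by (auto simp: lat_pts_def rvec_def unit_def)

lemma rvec_eqI: "x \<in> rvec n \<Longrightarrow> y \<in> rvec n \<Longrightarrow> (\<And>i. i < n \<Longrightarrow> x i = y i) \<Longrightarrow> x = y"
  by (rule ext) (metis (mono_tags, lifting) mem_Collect_eq not_le_imp_less rvec_def)

section \<open>Symmetry, signature and dual vectors\<close>

definition sym_form :: "lat \<Rightarrow> bool" where
  "sym_form L \<longleftrightarrow> (\<forall>x y. bil L x y = bil L y x)"

text \<open>Vectors are arbitrary functions and \<open>bil\<close> reads only the coordinates below
  the rank, so vanishing is asserted only there.\<close>

definition pos_def :: "lat \<Rightarrow> bool" where
  "pos_def L \<longleftrightarrow> (\<forall>x. bil L x x \<ge> 0 \<and> (bil L x x = 0 \<longrightarrow> (\<forall>i<fst L. x i = 0)))"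

text \<open>Signature (n,1) without a choice of basis: the complement of any negative vector is
  positive definite. Vacuous for forms without negative vectors.\<close>

definition lorentzian :: "lat \<Rightarrow> bool" where
  "lorentzian L \<longleftrightarrow> (\<forall>x y. bil L x x < 0 \<longrightarrow> bil L x y = 0 \<longrightarrow>
     bil L y y \<ge> 0 \<and> (bil L y y = 0 \<longrightarrow> (\<forall>i<fst L. y i = 0)))"

text \<open>For \<open>m = 1\<close> the discriminant group has period 2, for \<open>m = 3\<close> period 6.\<close>
definition dual_period :: "nat \<Rightarrow> lat \<Rightarrow> bool" where
  "dual_period m L \<longleftrightarrow> (\<forall>i<fst L. \<exists>d\<in>rvec (fst L). (\<forall>j. 2 * d j \<in> \<int>) \<and> (\<forall>u. bil L u d = real m * u i))"

lemma sym_formD: "sym_form L \<Longrightarrow> bil L x y = bil L y x"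
  unfolding sym_form_def by blast

lemma sym_form_osum: "sym_form L \<Longrightarrow> sym_form M \<Longrightarrow> sym_form (osum L M)"
  unfolding sym_form_def by (simp add: bil_osum)

lemma all_less_add_iff: "(\<forall>i<(n::nat) + m. P i) \<longleftrightarrow> (\<forall>i<n. P i) \<and> (\<forall>i<m. P (i + n))"
  by (metis add.commute add_less_cancel_right less_diff_conv2 linorder_not_less
        ordered_cancel_comm_monoid_diff_class.diff_add trans_less_add1)

lemma pos_def_osum:
  assumes "pos_def L" "pos_def M"
  shows "pos_def (osum L M)"
  unfolding pos_def_def
proof (intro allI conjI impI)
  fix x
  have *: "bil L x x \<ge> 0" "bil M (shift (fst L) x) (shift (fst L) x) \<ge> 0"
    using assms by (auto simp: pos_def_def)
  then show "bil (osum L M) x x \<ge> 0" by (simp add: bil_osum)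
  fix i assume z: "bil (osum L M) x x = 0" and i: "i < fst (osum L M)"
  have "bil L x x = 0" "bil M (shift (fst L) x) (shift (fst L) x) = 0"
    using z * by (simp_all add: bil_osum)
  then have "\<forall>i<fst L. x i = 0" "\<forall>i<fst M. x (i + fst L) = 0"
    using assms unfolding pos_def_def shift_def by blast+
  then have "\<forall>i<fst L + fst M. x i = 0" by (simp add: all_less_add_iff)
  then show "x i = 0" using i by simp
qed

lemma pos_def_cauchy:
  assumes "pos_def L" "sym_form L"
  shows "(bil L x y)\<^sup>2 \<le> bil L x x * bil L y y"
proof -
  let ?v = "lc (bil L y y) x (- bil L x y) y"
  have "0 \<le> bil L ?v ?v" using assms(1) by (auto simp: pos_def_def)
  also have "bil L ?v ?v = bil L y y * (bil L x x * bil L y y - (bil L x y)\<^sup>2)"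
    using sym_formD[OF assms(2), of y x]
    by (simp add: bil_lc_left bil_lc_right algebra_simps power2_eq_square)
  finally have *: "0 \<le> bil L y y * (bil L x x * bil L y y - (bil L x y)\<^sup>2)" .
  show ?thesis
  proof (cases "bil L y y = 0")
    case True
    then have "\<forall>i<fst L. y i = 0" using assms(1) by (auto simp: pos_def_def)
    then have "bil L x y = bil L x (\<lambda>i. 0)" by (intro bil_cong) auto
    then show ?thesis using True by (simp add: bil_def)
  next
    case False
    then have "bil L y y > 0" using assms(1) by (auto simp: pos_def_def less_le)
    then show ?thesis using * by (simp add: zero_le_mult_iff)
  qed
qed

text \<open>A negative vector of the sum is negative already in \<open>L\<close>. Removing from
  \<open>y\<close> its component along \<open>x\<close> in \<open>L\<close> leaves \<open>z\<close>
  of nonnegative norm at a loss of c^2 X; orthogonality identifies c X with the pairing of the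
  \<open>M\<close>-components, and Cauchy-Schwarz in \<open>M\<close> pays for the loss.\<close>

lemma lorentzian_osum:
  assumes "lorentzian L" "pos_def M" "sym_form L" "sym_form M"
  shows "lorentzian (osum L M)"
  unfolding lorentzian_def
proof (intro allI impI)
  fix x y
  let ?n = "fst L"
  let ?x = "shift ?n x" and ?y = "shift ?n y"
  assume neg: "bil (osum L M) x x < 0" and orth: "bil (osum L M) x y = 0"
  have x2: "bil M ?x ?x \<ge> 0" and y2: "bil M ?y ?y \<ge> 0"
    using assms(2) by (auto simp: pos_def_def)
  define X where "X = - bil L x x"
  have X: "X > bil M ?x ?x" "X > 0" using neg x2 by (simp_all add: bil_osum X_def)
  define c where "c = - bil L x y / X"
  define z where "z = lc 1 y (- c) x"
  have xz: "bil L x z = 0"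
    using X by (simp add: z_def bil_lc_right c_def X_def field_simps)
  have z0: "bil L z z \<ge> 0" "bil L z z = 0 \<Longrightarrow> \<forall>i<?n. z i = 0"
    using assms(1) X xz unfolding lorentzian_def X_def by (auto simp: X_def)
  have zz: "bil L z z = bil L y y + c\<^sup>2 * X"
    using X sym_formD[OF assms(3), of y x]
    by (simp add: z_def bil_lc_left bil_lc_right c_def X_def field_simps power2_eq_square)
  have cX: "c * X = bil M ?x ?y"
    using X orth by (simp add: c_def bil_osum)
  have cs: "(c * X)\<^sup>2 \<le> bil M ?x ?x * bil M ?y ?y"
    unfolding cX by (rule pos_def_cauchy[OF assms(2,4)])
  have "(c * X)\<^sup>2 = (c\<^sup>2 * X) * X" by (simp add: power2_eq_square)
  with cs have cs': "(c\<^sup>2 * X) * X \<le> bil M ?x ?x * bil M ?y ?y" by simp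
  have yy: "bil (osum L M) y y = bil L z z + (bil M ?y ?y - c\<^sup>2 * X)"
    using zz by (simp add: bil_osum)
  have le: "bil M ?x ?x * bil M ?y ?y \<le> X * bil M ?y ?y"
    using X y2 by (intro mult_right_mono) auto
  have le2: "c\<^sup>2 * X \<le> bil M ?y ?y"
  proof -
    have "(c\<^sup>2 * X) * X \<le> bil M ?y ?y * X" using cs' le by (simp add: mult.commute)
    then show ?thesis using X by simp
  qed
  show "bil (osum L M) y y \<ge> 0 \<and> (bil (osum L M) y y = 0 \<longrightarrow> (\<forall>i<fst (osum L M). y i = 0))"
  proof (intro conjI impI)
    show "bil (osum L M) y y \<ge> 0" using yy z0 le2 by simp
    assume "bil (osum L M) y y = 0"
    then have e: "bil L z z = 0" "bil M ?y ?y = c\<^sup>2 * X" using yy z0(1) le2 by linarith+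
    have "bil M ?y ?y = 0"
    proof (rule ccontr)
      assume "bil M ?y ?y \<noteq> 0"
      then have p: "bil M ?y ?y > 0" using y2 by simp
      then have "bil M ?x ?x * bil M ?y ?y < X * bil M ?y ?y" using X by simp
      then show False using cs' e by (simp add: mult.commute)
    qed
    then have c0: "c = 0" and my: "\<forall>i<fst M. ?y i = 0"
      using e X assms(2) by (auto simp: pos_def_def)
    have "\<forall>i<?n. y i = 0" using z0(2)[OF e(1)] c0 by (simp add: z_def lc_def)
    then show "\<forall>i<fst (osum L M). y i = 0"
      using my by (simp add: all_less_add_iff shift_def)
  qed
qed

lemma dual_period_osum:
  assumes "dual_period m L" "dual_period m M"
  shows "dual_period m (osum L M)"
  unfolding dual_period_def fst_osum all_less_add_iff
proof (intro conjI allI impI)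
  fix i assume "i < fst L"
  then obtain d where d: "d \<in> rvec (fst L)" "\<forall>j. 2 * d j \<in> \<int>" "\<forall>u. bil L u d = real m * u i"
    using assms(1) by (auto simp: dual_period_def)
  have "shift (fst L) d = (\<lambda>i. 0)" using d by (auto simp: shift_def rvec_def)
  then have "\<forall>u. bil (osum L M) u d = real m * u i"
    using d by (simp add: bil_osum) (simp add: bil_def)
  then show "\<exists>d\<in>rvec (fst L + fst M). (\<forall>j. 2 * d j \<in> \<int>) \<and> (\<forall>u. bil (osum L M) u d = real m * u i)"
    using d by (intro bexI[of _ d]) (auto simp: rvec_def)
next
  fix i assume "i < fst M"
  then obtain d where d: "d \<in> rvec (fst M)" "\<forall>j. 2 * d j \<in> \<int>" "\<forall>u. bil M u d = real m * u i"
    using assms(2) by (auto simp: dual_period_def)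
  let ?d = "cat (fst L) (\<lambda>i. 0) d"
  have s: "shift (fst L) ?d = d" by (auto simp: shift_def cat_def)
  have "bil L u ?d = bil L u (\<lambda>i. 0)" for u by (intro bil_cong) (auto simp: cat_def)
  then have "bil L u ?d = 0" for u by (simp add: bil_def)
  then have "bil (osum L M) u ?d = real m * shift (fst L) u i" for u
    using d(3) by (simp add: bil_osum s)
  then have "\<forall>u. bil (osum L M) u ?d = real m * u (i + fst L)"
    by (simp add: shift_def)
  then show "\<exists>d\<in>rvec (fst L + fst M). (\<forall>j. 2 * d j \<in> \<int>) \<and> (\<forall>u. bil (osum L M) u d = real m * u (i + fst L))"
    using d by (intro bexI[of _ ?d]) (auto simp: rvec_def cat_def)
qed

lemma dual_period_1_imp_3:
  assumes "dual_period 1 L"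
  shows "dual_period 3 L"
  unfolding dual_period_def
proof (intro allI impI)
  fix i assume "i < fst L"
  then obtain d where d: "d \<in> rvec (fst L)" "\<forall>j. 2 * d j \<in> \<int>" "\<forall>u. bil L u d = u i"
    using assms by (auto simp: dual_period_def)
  have "2 * (3 * d j) \<in> \<int>" for j
  proof -
    have "3 * (2 * d j) \<in> \<int>" using d(2) by (metis Ints_mult Ints_numeral)
    then show ?thesis by (simp add: mult.left_commute)
  qed
  then show "\<exists>d\<in>rvec (fst L). (\<forall>j. 2 * d j \<in> \<int>) \<and> (\<forall>u. bil L u d = real 3 * u i)"
    using d by (intro bexI[of _ "\<lambda>j. 3 * d j"]) (auto simp: rvec_def bil_scale_right)
qed

lemma dual_period_nondeg:
  assumes "dual_period 3 L" "\<And>y. y \<in> lat_pts L \<Longrightarrow> bil L x y = 0" "i < fst L"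
  shows "x i = 0"
proof -
  obtain d where d: "d \<in> rvec (fst L)" "\<forall>j. 2 * d j \<in> \<int>" "\<forall>u. bil L u d = 3 * u i"
    using assms(1,3) by (auto simp: dual_period_def)
  have "(\<lambda>j. 2 * d j) \<in> lat_pts L" using d by (auto simp: lat_pts_def rvec_def)
  then have "bil L x (\<lambda>j. 2 * d j) = 0" by (rule assms(2))
  then show ?thesis using d by (simp add: bil_scale_right)
qed

subsection \<open>The summands\<close>

lemma bil_latA1: "bil latA1 x y = 2 * x 0 * y 0"
  and bil_latmA1: "bil latmA1 x y = - 2 * x 0 * y 0"
  and bil_lat6: "bil lat6 x y = 6 * x 0 * y 0"
  by (simp_all add: bil_def latA1_def latmA1_def lat6_def lat_of_def)

lemma bil_latU: "bil latU x y = x 0 * y 1 + x 1 * y 0"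
  by (simp add: bil_def latU_def lat_of_def lessThan_Suc numeral_2_eq_2)

lemma bil_latA2: "bil latA2 x y = 2 * x 0 * y 0 - x 0 * y 1 - x 1 * y 0 + 2 * x 1 * y 1"
  by (simp add: bil_def latA2_def lat_of_def lessThan_Suc numeral_2_eq_2)

lemma bil_latD4: "bil latD4 x y =
  x 0 * (2 * y 0 - y 1) + x 1 * (2 * y 1 - y 0 - y 2 - y 3) + x 2 * (2 * y 2 - y 1) + x 3 * (2 * y 3 - y 1)"
  by (simp add: bil_def latD4_def lat_of_def lessThan_nat_numeral numeral_eq_Suc algebra_simps)

lemma bil_latE8: "bil latE8 x y =
  x 0 * (2 * y 0 - y 2) + x 1 * (2 * y 1 - y 3) + x 2 * (2 * y 2 - y 0 - y 3)
  + x 3 * (2 * y 3 - y 1 - y 2 - y 4) + x 4 * (2 * y 4 - y 3 - y 5) + x 5 * (2 * y 5 - y 4 - y 6)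
  + x 6 * (2 * y 6 - y 5 - y 7) + x 7 * (2 * y 7 - y 6)"
  by (simp add: bil_def latE8_def lat_of_def lessThan_nat_numeral numeral_eq_Suc algebra_simps)

lemma fst_summands [simp]:
  "fst latA1 = 1" "fst latmA1 = 1" "fst lat6 = 1" "fst latU = 2" "fst latA2 = 2"
  "fst latD4 = 4" "fst latE8 = 8"
  by (simp_all add: latA1_def latmA1_def lat6_def latU_def latA2_def latD4_def latE8_def lat_of_def)

lemma sym_form_summands:
  "sym_form latA1" "sym_form latmA1" "sym_form lat6" "sym_form latU" "sym_form latA2" "sym_form latD4" "sym_form latE8"
  unfolding sym_form_def bil_latA1 bil_latmA1 bil_lat6 bil_latU bil_latA2 bil_latD4 bil_latE8
  by (simp_all add: algebra_simps)

lemma pos_def_latA1: "pos_def latA1" and pos_def_lat6: "pos_def lat6"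
  by (auto simp: pos_def_def bil_latA1 bil_lat6)

lemma lorentzian_latmA1: "lorentzian latmA1"
  by (auto simp: lorentzian_def bil_latmA1)

lemma less_8_iff:
  "(\<forall>i<1::nat. P i) \<longleftrightarrow> P 0"
  "(\<forall>i<2::nat. P i) \<longleftrightarrow> P 0 \<and> P 1"
  "(\<forall>i<4::nat. P i) \<longleftrightarrow> P 0 \<and> P 1 \<and> P 2 \<and> P 3"
  "(\<forall>i<8::nat. P i) \<longleftrightarrow> P 0 \<and> P 1 \<and> P 2 \<and> P 3 \<and> P 4 \<and> P 5 \<and> P 6 \<and> P 7"
  by (simp_all add: numeral_eq_Suc All_less_Suc conj_ac)

lemma lorentzian_latU: "lorentzian latU"
  unfolding lorentzian_def
proof (intro allI impI)
  fix x y :: "nat \<Rightarrow> real"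
  assume "bil latU x x < 0" and orth: "bil latU x y = 0"
  then have neg: "x 0 * x 1 < 0" by (simp add: bil_latU mult.commute)
  have "(x 0)\<^sup>2 * (y 0 * y 1) = - (x 0 * x 1) * (y 0)\<^sup>2"
  proof -
    have "x 0 * y 1 = - (x 1 * y 0)" using orth by (simp add: bil_latU)
    then have "x 0 * y 0 * (x 0 * y 1) = x 0 * y 0 * - (x 1 * y 0)" by simp
    then show ?thesis by (simp add: power2_eq_square algebra_simps)
  qed
  moreover have x0: "(x 0)\<^sup>2 > 0" using neg by auto
  moreover have nn: "- (x 0 * x 1) * (y 0)\<^sup>2 \<ge> 0" using neg by (intro mult_nonneg_nonneg) auto
  ultimately have pos: "y 0 * y 1 \<ge> 0" by (metis zero_le_mult_iff not_less)
  have zero: "y 0 = 0 \<and> y 1 = 0" if "y 0 * y 1 = 0"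
  proof -
    have "- (x 0 * x 1) * (y 0)\<^sup>2 = 0"
      using that \<open>(x 0)\<^sup>2 * (y 0 * y 1) = _\<close> by (metis mult_zero_right)
    then have "y 0 = 0" using neg by auto
    moreover have "x 0 * y 1 = 0" using orth \<open>y 0 = 0\<close> by (simp add: bil_latU)
    ultimately show ?thesis using neg by auto
  qed
  have b: "bil latU y y = 2 * (y 0 * y 1)" by (simp add: bil_latU)
  show "bil latU y y \<ge> 0 \<and> (bil latU y y = 0 \<longrightarrow> (\<forall>i<fst latU. y i = 0))"
  proof (intro conjI impI)
    show "bil latU y y \<ge> 0" using pos b by linarith
    assume "bil latU y y = 0"
    then have "y 0 * y 1 = 0" using b by linarith
    then show "\<forall>i<fst latU. y i = 0" unfolding fst_summands less_8_iff by (rule zero)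
  qed
qed

lemma pos_def_latA2: "pos_def latA2"
  unfolding pos_def_def
proof (intro allI)
  fix x :: "nat \<Rightarrow> real"
  have sq: "bil latA2 x x = (x 0 - x 1)\<^sup>2 + (x 0)\<^sup>2 + (x 1)\<^sup>2"
    by (simp add: bil_latA2 power2_eq_square algebra_simps)
  show "bil latA2 x x \<ge> 0 \<and> (bil latA2 x x = 0 \<longrightarrow> (\<forall>i<fst latA2. x i = 0))"
    unfolding sq by (auto simp: less_8_iff add_nonneg_eq_0_iff)
qed

lemma pos_def_latE8: "pos_def latE8"
  unfolding pos_def_def
proof (intro allI)
  fix x :: "nat \<Rightarrow> real"
  \<comment> \<open>Completing squares, eliminating the coordinates in the order 0, ..., 7; 840
    clears the denominators of the pivots.\<close>
  have sq: "840 * bil latE8 x x = 420 * (2 * x 0 - x 2)\<^sup>2 + 420 * (2 * x 1 - x 3)\<^sup>2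
     + 140 * (3 * x 2 - 2 * x 3)\<^sup>2 + 28 * (5 * x 3 - 6 * x 4)\<^sup>2 + 42 * (4 * x 4 - 5 * x 5)\<^sup>2
     + 70 * (3 * x 5 - 4 * x 6)\<^sup>2 + 140 * (2 * x 6 - 3 * x 7)\<^sup>2 + 420 * (x 7)\<^sup>2"
    by (simp add: bil_latE8 power2_eq_square algebra_simps)
  have "bil latE8 x x \<ge> 0" using sq by (smt (verit) zero_le_power2)
  moreover have "\<forall>i<fst latE8. x i = 0" if "bil latE8 x x = 0"
    using sq[unfolded that] by (auto simp: less_8_iff add_nonneg_eq_0_iff)
  ultimately show "bil latE8 x x \<ge> 0 \<and> (bil latE8 x x = 0 \<longrightarrow> (\<forall>i<fst latE8. x i = 0))"
    by blast
qed

definition lvec :: "real list \<Rightarrow> nat \<Rightarrow> real" where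
  "lvec xs = (\<lambda>i. if i < length xs then xs ! i else 0)"

lemma lvec_Nil [simp]: "lvec [] i = 0"
  and lvec_Cons_0 [simp]: "lvec (x # xs) 0 = x"
  and lvec_Cons_Suc [simp]: "lvec (x # xs) (Suc i) = lvec xs i"
  and lvec_Cons_numeral [simp]: "lvec (x # xs) (numeral k) = lvec xs (pred_numeral k)"
  by (simp_all add: lvec_def numeral_eq_Suc)

lemma lvec_Cons_1 [simp]: "lvec (x # xs) 1 = lvec xs 0"
  by (simp add: lvec_def)

lemma lvec_rvec: "length xs \<le> n \<Longrightarrow> lvec xs \<in> rvec n"
  by (simp add: lvec_def rvec_def)

lemma lvec_lat_pts: "length xs \<le> fst L \<Longrightarrow> set xs \<subseteq> \<int> \<Longrightarrow> lvec xs \<in> lat_pts L"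
  using lvec_rvec[of xs "fst L"] by (auto simp: lat_pts_def) (auto simp: lvec_def subset_iff)

lemma lvec_half: "set (map ((*) 2) xs) \<subseteq> \<int> \<Longrightarrow> 2 * lvec xs j \<in> \<int>"
  by (auto simp: lvec_def subset_iff)

text \<open>The lists supplied below are columns of the inverse Gram matrix, multiplied by 3 when m
  = 3; for \<open>latE8\<close> and \<open>latD4\<close> they are the fundamental weights.\<close>

lemma dual_period_witness:
  assumes "length xs \<le> n" "set (map ((*) 2) xs) \<subseteq> \<int>" "\<And>u. bil L u (lvec xs) = real m * u i"
  shows "\<exists>d\<in>rvec n. (\<forall>j. 2 * d j \<in> \<int>) \<and> (\<forall>u. bil L u d = real m * u i)"
  using assms lvec_rvec lvec_half by blast

lemma dual_period_latA1: "dual_period 1 latA1"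
  unfolding dual_period_def fst_summands less_8_iff by (rule dual_period_witness[of "[1/2]"]) (simp_all add: bil_latA1)

lemma dual_period_latmA1: "dual_period 1 latmA1"
  unfolding dual_period_def fst_summands less_8_iff by (rule dual_period_witness[of "[-1/2]"]) (simp_all add: bil_latmA1)

lemma dual_period_lat6: "dual_period 3 lat6"
  unfolding dual_period_def fst_summands less_8_iff by (rule dual_period_witness[of "[1/2]"]) (simp_all add: bil_lat6)

lemma dual_period_latU: "dual_period 1 latU"
proof -
  let ?P = "\<lambda>i. \<exists>d\<in>rvec 2. (\<forall>j. 2 * d j \<in> \<int>) \<and> (\<forall>u. bil latU u d = real 1 * u i)"
  have "?P 0"
    by (rule dual_period_witness[of "[0,1]"]) (simp_all add: bil_latU algebra_simps)
  moreover have "?P 1"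
    by (rule dual_period_witness[of "[1,0]"]) (simp_all add: bil_latU algebra_simps)
  ultimately show ?thesis
    unfolding dual_period_def fst_summands less_8_iff by blast
qed

lemma dual_period_latA2: "dual_period 3 latA2"
proof -
  let ?P = "\<lambda>i. \<exists>d\<in>rvec 2. (\<forall>j. 2 * d j \<in> \<int>) \<and> (\<forall>u. bil latA2 u d = real 3 * u i)"
  have "?P 0"
    by (rule dual_period_witness[of "[2,1]"]) (simp_all add: bil_latA2 algebra_simps)
  moreover have "?P 1"
    by (rule dual_period_witness[of "[1,2]"]) (simp_all add: bil_latA2 algebra_simps)
  ultimately show ?thesis
    unfolding dual_period_def fst_summands less_8_iff by blast
qed

lemma dual_period_latD4: "dual_period 1 latD4"
proof -
  let ?P = "\<lambda>i. \<exists>d\<in>rvec 4. (\<forall>j. 2 * d j \<in> \<int>) \<and> (\<forall>u. bil latD4 u d = real 1 * u i)"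
  have "?P 0"
    by (rule dual_period_witness[of "[1,1,1/2,1/2]"]) (simp_all add: bil_latD4 algebra_simps)
  moreover have "?P 1"
    by (rule dual_period_witness[of "[1,2,1,1]"]) (simp_all add: bil_latD4 algebra_simps)
  moreover have "?P 2"
    by (rule dual_period_witness[of "[1/2,1,1,1/2]"]) (simp_all add: bil_latD4 algebra_simps)
  moreover have "?P 3"
    by (rule dual_period_witness[of "[1/2,1,1/2,1]"]) (simp_all add: bil_latD4 algebra_simps)
  ultimately show ?thesis
    unfolding dual_period_def fst_summands less_8_iff by blast
qed

lemma dual_period_latE8: "dual_period 1 latE8"
proof -
  let ?P = "\<lambda>i. \<exists>d\<in>rvec 8. (\<forall>j. 2 * d j \<in> \<int>) \<and> (\<forall>u. bil latE8 u d = real 1 * u i)"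
  have "?P 0"
    by (rule dual_period_witness[of "[4,5,7,10,8,6,4,2]"]) (simp_all add: bil_latE8 algebra_simps)
  moreover have "?P 1"
    by (rule dual_period_witness[of "[5,8,10,15,12,9,6,3]"]) (simp_all add: bil_latE8 algebra_simps)
  moreover have "?P 2"
    by (rule dual_period_witness[of "[7,10,14,20,16,12,8,4]"]) (simp_all add: bil_latE8 algebra_simps)
  moreover have "?P 3"
    by (rule dual_period_witness[of "[10,15,20,30,24,18,12,6]"]) (simp_all add: bil_latE8 algebra_simps)
  moreover have "?P 4"
    by (rule dual_period_witness[of "[8,12,16,24,20,15,10,5]"]) (simp_all add: bil_latE8 algebra_simps)
  moreover have "?P 5"
    by (rule dual_period_witness[of "[6,9,12,18,15,12,8,4]"]) (simp_all add: bil_latE8 algebra_simps)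
  moreover have "?P 6"
    by (rule dual_period_witness[of "[4,6,8,12,10,8,6,3]"]) (simp_all add: bil_latE8 algebra_simps)
  moreover have "?P 7"
    by (rule dual_period_witness[of "[2,3,4,6,5,4,3,2]"]) (simp_all add: bil_latE8 algebra_simps)
  ultimately show ?thesis
    unfolding dual_period_def fst_summands less_8_iff by blast
qed

lemma fst_rep [simp]: "fst (rep t L) = t * fst L"
  by (induction t) auto

lemma bil_rank_0: "fst L = 0 \<Longrightarrow> bil L x y = 0"
  by (simp add: bil_def)

lemma sym_form_rep: "sym_form L \<Longrightarrow> sym_form (rep t L)"
  by (induction t) (simp_all add: sym_form_osum, simp add: sym_form_def bil_rank_0)

lemma pos_def_rep: "pos_def L \<Longrightarrow> pos_def (rep t L)"
  by (induction t) (simp_all add: pos_def_osum, simp add: pos_def_def bil_rank_0)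

lemma dual_period_rep: "dual_period m L \<Longrightarrow> dual_period m (rep t L)"
  by (induction t) (simp_all add: dual_period_osum, simp add: dual_period_def)

subsection \<open>Reflections in the Weyl group\<close>

lemma lat_pts_scale: "x \<in> lat_pts L \<Longrightarrow> a \<in> \<int> \<Longrightarrow> (\<lambda>i. a * x i) \<in> lat_pts L"
  by (auto simp: lat_pts_def rvec_def)

lemma refl_vecs_lat_pts: "v \<in> refl_vecs L \<Longrightarrow> v \<in> lat_pts L"
  by (simp add: refl_vecs_def)

text \<open>A 2-reflection moves a dual vector by an integral multiple of a root. For a 6-root the
  coefficient is (w x . v)/3; since twice w x is a lattice vector, 3 divides 2 (w x . v) and hence w
  x . v.\<close>

lemma weyl_trivial_on_discr2:
  assumes "w \<in> weyl L" "x \<in> rvec (fst L)" "(\<lambda>i. 2 * x i) \<in> lat_pts L"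
    and sym: "sym_form L"
    and "\<And>v. v \<in> lat_pts L \<Longrightarrow> bil L x v \<in> \<int>"
  shows "lc 1 (w x) (- 1) x \<in> lat_pts L"
  using assms(1)
proof induction
  case weyl_id
  then show ?case by (simp add: lat_pts_def rvec_def lc_def)
next
  case (weyl_step w v)
  define y where "y = lc 1 (w x) (- 1) x"
  have y: "y \<in> lat_pts L" using weyl_step.IH by (simp add: y_def)
  have wx: "w x = lc 1 x 1 y" by (auto simp: y_def lc_def)
  have v: "v \<in> lat_pts L" using weyl_step(2) by (rule refl_vecs_lat_pts)
  define c where "c = 2 * bil L (w x) v / bil L v v"
  have b: "bil L (w x) v = bil L x v + bil L y v" by (simp add: wx bil_lc_left)
  have bi: "bil L (w x) v \<in> \<int>" unfolding b using assms(5)[OF v] bil_Ints[OF y v] by (rule Ints_add)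
  have "c \<in> \<int>"
  proof (cases "bil L v v = 2")
    case True
    then show ?thesis using bi by (simp add: c_def)
  next
    case False
    then have v6: "bil L v v = 6" and v3: "\<forall>w\<in>lat_pts L. \<exists>k::int. bil L v w = 3 * of_int k"
      using weyl_step(2) by (auto simp: refl_vecs_def)
    have "(\<lambda>i. 2 * w x i) \<in> lat_pts L"
    proof -
      have "(\<lambda>i. 2 * w x i) = lc 1 (\<lambda>i. 2 * x i) 2 y" by (auto simp: wx lc_def algebra_simps)
      then show ?thesis using assms(3) y by (simp add: lc_lat_pts)
    qed
    then obtain k :: int where "bil L v (\<lambda>i. 2 * w x i) = 3 * of_int k" using v3 by blast
    then have "2 * bil L (w x) v = 3 * of_int k"
      using sym_formD[OF sym, of v "w x"] by (simp add: bil_scale_right)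
    moreover obtain m :: int where m: "bil L (w x) v = of_int m" using bi by (auto elim: Ints_cases)
    ultimately have "2 * m = 3 * k" by (metis of_int_eq_iff of_int_mult of_int_numeral)
    then have "3 dvd m" by presburger
    then obtain l where "m = 3 * l" by (elim dvdE)
    then show ?thesis by (simp add: c_def v6 m)
  qed
  then have "lc 1 y (- c) v \<in> lat_pts L" using y v by (intro lc_lat_pts) auto
  moreover have "lc 1 ((refl L v \<circ> w) x) (- 1) x = lc 1 y (- c) v"
    by (auto simp: refl_def c_def y_def lc_def)
  ultimately show ?case by simp
qed

text \<open>Reflections in 4- and 12-roots act nontrivially on the 2-primary discriminant, hence are not
  in \<open>W\<close>.\<close>
lemma mirror_vector:
  assumes "sym_form L" "dual_period 3 L" "a \<in> rvec (fst L)" "bil L a a \<noteq> 0" "w \<in> weyl L"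
    and w: "\<forall>x\<in>rvec (fst L). w x = refl L a x"
  obtains b c where "b \<in> lat_pts L" "c \<noteq> 0" "b = (\<lambda>i. c * a i)" "6 / bil L b b \<in> \<int>"
proof -
  define S where "S = {b \<in> lat_pts L. \<exists>c. c \<noteq> 0 \<and> b = (\<lambda>i. c * a i)}"
  have step: "(\<lambda>i. (2 * bil L x a / bil L a a) * a i) \<in> lat_pts L"
    if x: "x \<in> rvec (fst L)" "(\<lambda>i. 2 * x i) \<in> lat_pts L" "\<And>v. v \<in> lat_pts L \<Longrightarrow> bil L x v \<in> \<int>" for x
  proof -
    have "lc 1 (w x) (- 1) x \<in> lat_pts L"
      by (rule weyl_trivial_on_discr2[OF assms(5) x(1,2) assms(1) x(3)])
    then have "(\<lambda>i. (- 1) * lc 1 (w x) (- 1) x i) \<in> lat_pts L" by (rule lat_pts_scale) simp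
    moreover have "(\<lambda>i. (- 1) * lc 1 (w x) (- 1) x i) = (\<lambda>i. (2 * bil L x a / bil L a a) * a i)"
      using w x(1) by (auto simp: lc_def refl_def)
    ultimately show ?thesis by simp
  qed
  have "\<exists>b. b \<in> S"
  proof -
    have "\<exists>i<fst L. a i \<noteq> 0"
    proof (rule ccontr)
      assume "\<not> ?thesis"
      then have "bil L a a = bil L (\<lambda>i. 0) (\<lambda>i. 0)" by (intro bil_cong) auto
      then show False using assms(4) by (simp add: bil_def)
    qed
    then obtain y where y: "y \<in> lat_pts L" "bil L a y \<noteq> 0"
      using dual_period_nondeg[OF assms(2)] by blast
    have "(\<lambda>i. (2 * bil L y a / bil L a a) * a i) \<in> lat_pts L"
      using step[OF lat_ptsD(2)[OF y(1)] lat_pts_scale[OF y(1)] bil_Ints[OF y(1)]] by simp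
    then show ?thesis using y assms(4) sym_formD[OF assms(1), of y a]
      by (auto simp: S_def intro!: exI[of _ "2 * bil L y a / bil L a a"])
  qed
  \<comment> \<open>A lattice vector of least size on the line of \<open>a\<close> is primitive: if
    t b is integral with t not an integer, the fractional part of t gives a shorter one. All sizes
    are integers, so the floor loses nothing.\<close>
  define \<mu> where "\<mu> b = nat \<lfloor>\<Sum>i<fst L. \<bar>b i\<bar>\<rfloor>" for b :: "nat \<Rightarrow> real"
  obtain b where bS: "b \<in> S" and bmin: "\<And>b'. b' \<in> S \<Longrightarrow> \<mu> b \<le> \<mu> b'"
    using \<open>\<exists>b. b \<in> S\<close> ex_has_least_nat[of "\<lambda>b. b \<in> S" _ \<mu>] by blast
  obtain c where c: "c \<noteq> 0" "b = (\<lambda>i. c * a i)" and b: "b \<in> lat_pts L" using bS by (auto simp: S_def)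
  have prim: "t \<in> \<int>" if t: "(\<lambda>i. t * b i) \<in> lat_pts L" for t
  proof (rule ccontr)
    assume nt: "t \<notin> \<int>"
    define f where "f = frac t"
    have f: "0 < f" "f < 1" using nt by (simp_all add: f_def frac_gt_0_iff frac_lt_1)
    let ?b = "\<lambda>i. f * b i"
    have "?b = lc 1 (\<lambda>i. t * b i) (- of_int \<lfloor>t\<rfloor>) b" by (auto simp: lc_def f_def frac_def algebra_simps)
    then have bl: "?b \<in> lat_pts L" using t b by (simp add: lc_lat_pts)
    then have "?b \<in> S" using c f by (auto simp: S_def intro!: exI[of _ "f * c"])
    then have "\<mu> b \<le> \<mu> ?b" by (rule bmin)
    define s where "s = (\<Sum>i<fst L. \<bar>b i\<bar>)"
    have s': "(\<Sum>i<fst L. \<bar>?b i\<bar>) = f * s" using f by (simp add: s_def abs_mult sum_distrib_left)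
    have sI: "s \<in> \<int>" "f * s \<in> \<int>"
      unfolding s'[symmetric] unfolding s_def using b bl by (auto intro!: Ints_sum Ints_abs dest: lat_ptsD)
    have "s > 0"
    proof -
      have "\<exists>i<fst L. b i \<noteq> 0"
      proof (rule ccontr)
        assume "\<not> ?thesis"
        then have "bil L a a = bil L (\<lambda>i. 0) (\<lambda>i. 0)" using c by (intro bil_cong) auto
        then show False using assms(4) by (simp add: bil_def)
      qed
      then obtain i where "i < fst L" "b i \<noteq> 0" by blast
      then have "0 < \<bar>b i\<bar>" "\<bar>b i\<bar> \<le> s" unfolding s_def by (auto intro!: member_le_sum)
      then show ?thesis by linarith
    qed
    then have "f * s < s" "f * s \<ge> 0" using f by simp_all
    moreover have "s \<le> f * s"
    proof -
      have "nat \<lfloor>s\<rfloor> \<le> nat \<lfloor>f * s\<rfloor>"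
        using \<open>\<mu> b \<le> \<mu> ?b\<close> unfolding \<mu>_def s' s_def[symmetric] .
      then have "\<lfloor>s\<rfloor> \<le> \<lfloor>f * s\<rfloor>" using \<open>f * s \<ge> 0\<close> by (simp add: nat_le_eq_zle)
      then have "real_of_int \<lfloor>s\<rfloor> \<le> real_of_int \<lfloor>f * s\<rfloor>" by simp
      then show ?thesis using sI by (simp only: of_int_floor)
    qed
    ultimately show False by simp
  qed
  have bb: "bil L b b \<noteq> 0" using c assms(4) by (simp add: bil_scale_left bil_scale_right)
  have step': "2 * bil L x b / bil L b b \<in> \<int>"
    if x: "x \<in> rvec (fst L)" "(\<lambda>i. 2 * x i) \<in> lat_pts L" "\<And>v. v \<in> lat_pts L \<Longrightarrow> bil L x v \<in> \<int>" for x
  proof (rule prim)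
    have "2 * bil L x b / bil L b b * b i = (2 * bil L x a / bil L a a) * a i" for i
      using c bb assms(4) by (simp add: bil_scale_left bil_scale_right field_simps)
    then show "(\<lambda>i. 2 * bil L x b / bil L b b * b i) \<in> lat_pts L" using step[OF x] by simp
  qed
  \<comment> \<open>The functional 3 u_i is pairing with a dual vector d such that 2d is in the
    lattice; \<open>step'\<close> for d says that 6 b_i / b^2 is an integer. With all coordinates at
    once, primitivity of \<open>b\<close> shows that b^2 divides 6 in the sense needed to exclude
    norms 4 and 12.\<close>
  have "6 / bil L b b \<in> \<int>"
  proof (rule prim)
    have "6 / bil L b b * b i \<in> \<int>" for i
    proof (cases "i < fst L")
      case True
      then obtain d where d: "d \<in> rvec (fst L)" "\<forall>j. 2 * d j \<in> \<int>" "\<forall>u. bil L u d = 3 * u i"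
        using assms(2) by (auto simp: dual_period_def)
      have "2 * bil L d b / bil L b b \<in> \<int>"
      proof (rule step')
        show "(\<lambda>i. 2 * d i) \<in> lat_pts L" using d by (auto simp: lat_pts_def rvec_def)
        fix v assume "v \<in> lat_pts L"
        then have "v i \<in> \<int>" by (rule lat_ptsD)
        then show "bil L d v \<in> \<int>" using d(3) sym_formD[OF assms(1), of d v] by simp
      qed (use d in auto)
      then show ?thesis using d sym_formD[OF assms(1), of d b] by simp
    next
      case False
      then show ?thesis using b by (auto simp: lat_pts_def rvec_def)
    qed
    then show "(\<lambda>i. 6 / bil L b b * b i) \<in> lat_pts L"
      using b by (auto simp: lat_pts_def rvec_def)
  qed
  then show ?thesis using that b c by blast
qed


subsection \<open>A criterion for achirality\<close>

lemma rvec_expand: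
  assumes "x \<in> rvec n"
  shows "x = (\<lambda>i. \<Sum>j<n. x j * unit j i)"
proof
  fix i
  show "x i = (\<Sum>j<n. x j * unit j i)"
  proof (cases "i < n")
    case True
    then have "(\<Sum>j<n. x j * unit j i) = (\<Sum>j<n. if j = i then x j else 0)"
      by (intro sum.cong) (auto simp: unit_def)
    then show ?thesis using True by simp
  next
    case False
    then have "x i = 0" "(\<Sum>j<n. x j * unit j i) = 0"
      using assms by (auto simp: rvec_def unit_def)
    then show ?thesis by simp
  qed
qed

lemma linear_expand:
  assumes lin: "\<And>a x b y. \<phi> (lc a x b y) = lc a (\<phi> x) b (\<phi> y)"
  shows "\<phi> (\<lambda>i. \<Sum>j<(n::nat). c j * f j i) = (\<lambda>i. \<Sum>j<n. c j * \<phi> (f j) i)"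
proof (induction n)
  case 0
  have "\<phi> (lc 0 x 0 x) = (\<lambda>i. 0)" for x by (simp add: lin) (simp add: lc_def)
  then show ?case by (simp add: lc_def)
next
  case (Suc n)
  have "(\<lambda>i. \<Sum>j<Suc n. c j * f j i) = lc 1 (\<lambda>i. \<Sum>j<n. c j * f j i) (c n) (f n)"
    by (auto simp: lc_def)
  then have "\<phi> (\<lambda>i. \<Sum>j<Suc n. c j * f j i)
      = lc 1 (\<lambda>i. \<Sum>j<n. c j * \<phi> (f j) i) (c n) (\<phi> (f n))" by (simp add: lin Suc)
  then show ?case by (auto simp: lc_def)
qed

lemma countable_lat_pts: "countable (lat_pts L)"
proof -
  have "x \<in> range (\<lambda>(xs::int list) i. if i < length xs then real_of_int (xs ! i) else 0)"
    if "x \<in> lat_pts L" for x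
  proof (rule range_eqI)
    show "x = (\<lambda>i. if i < length (map (\<lambda>i. \<lfloor>x i\<rfloor>) [0..<fst L])
        then real_of_int (map (\<lambda>i. \<lfloor>x i\<rfloor>) [0..<fst L] ! i) else 0)"
      using that by (auto simp: lat_pts_def rvec_def)
  qed
  then have "lat_pts L \<subseteq> range (\<lambda>(xs::int list) i. if i < length xs then real_of_int (xs ! i) else 0)"
    by blast
  then show ?thesis by (rule countable_subset) simp
qed

lemma continuous_act: "continuous_on S (act n A)"
proof (rule continuous_on_subset[OF _ subset_UNIV])
  show "continuous_on UNIV (act n A)"
  proof (rule continuous_on_coordinatewise_then_product)
    fix i
    show "continuous_on UNIV (\<lambda>x. act n A x i)"
      by (cases "i < n")
        (auto simp: act_def intro!: continuous_intros continuous_on_product_coordinates)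
  qed
qed

text \<open>The fixed vectors of an involution avoid all mirrors generically, unless some mirror vector
  is anti-invariant; the latter is excluded when the anti-invariant lattice has norms in \<open>4\<int>\<close>.\<close>
lemma achiral_of_involution:
  fixes \<phi> :: "(nat \<Rightarrow> real) \<Rightarrow> nat \<Rightarrow> real"
  assumes sym: "sym_form L" and dual_period: "dual_period 3 L"
    and lin: "\<And>a x b y. \<phi> (lc a x b y) = lc a (\<phi> x) b (\<phi> y)"
    and rv: "\<And>x. x \<in> rvec (fst L) \<Longrightarrow> \<phi> x \<in> rvec (fst L)"
    and lp: "\<And>x. x \<in> lat_pts L \<Longrightarrow> \<phi> x \<in> lat_pts L"
    and iso: "\<And>x y. bil L (\<phi> x) (\<phi> y) = bil L x y"
    and inv: "\<And>x. x \<in> rvec (fst L) \<Longrightarrow> \<phi> (\<phi> x) = x"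
    and anti: "\<And>x. x \<in> lat_pts L \<Longrightarrow> \<phi> x = (\<lambda>i. - x i) \<Longrightarrow> \<exists>k::int. bil L x x = 4 * of_int k"
    and rev: "\<And>x. x \<in> three_primary L \<Longrightarrow> (\<lambda>i. \<phi> x i + x i) \<in> lat_pts L"
    and e: "e \<in> rvec (fst L)" "\<phi> e = e" "bil L e e < 0"
  shows "achiral L"
proof -
  define n where "n = fst L"
  \<comment> \<open>The entries are already integers because \<phi> preserves the lattice; the floor
    only changes their type.\<close>
  define A where "A i j = \<lfloor>\<phi> (unit j) i\<rfloor>" for i j
  have A: "act n A x = \<phi> x" if x: "x \<in> rvec n" for x
  proof -
    have "\<phi> x = (\<lambda>i. \<Sum>j<n. x j * \<phi> (unit j) i)"
      by (subst rvec_expand[OF x]) (rule linear_expand[OF lin])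
    moreover have "of_int (A i j) = \<phi> (unit j) i" if "j < n" for i j
      using lp[OF unit_lat_pts] that unfolding A_def n_def by (auto simp: lat_pts_def)
    moreover have "\<phi> x i = 0" if "i \<ge> n" for i using rv x that by (auto simp: rvec_def n_def)
    ultimately show ?thesis by (auto simp: act_def mult.commute not_less)
  qed
  have Al: "act n A x = \<phi> x" "act n A (\<phi> x) = x" if "x \<in> lat_pts L" for x
    using that lp[OF that] inv by (simp_all add: A n_def[symmetric] lat_ptsD(2)[of _ L, folded n_def])
  have aut: "is_aut L A"
    unfolding is_aut_def n_def[symmetric]
  proof (intro conjI ballI)
    show "bij_betw (act n A) (lat_pts L) (lat_pts L)"
      by (rule bij_betw_byWitness[where f' = "act n A"])
        (auto simp: Al intro: lp)
    fix x y assume "x \<in> lat_pts L" "y \<in> lat_pts L"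
    then show "bil L (act n A x) (act n A y) = bil L x y"
      by (simp add: Al iso)
  qed
  have z3: "z3_reversing L A"
    unfolding z3_reversing_def n_def[symmetric]
  proof
    fix x assume x: "x \<in> three_primary L"
    then have "x \<in> rvec n" by (auto simp: three_primary_def dual_pts_def n_def)
    then show "(\<lambda>i. act n A x i + x i) \<in> lat_pts L" using rev[OF x] by (simp add: A)
  qed

  have conj: "\<exists>w'\<in>weyl L. \<forall>x\<in>rvec n. w' x = \<phi> (w (\<phi> x))" if "w \<in> weyl L" for w
    using that
  proof induction
    case weyl_id
    then show ?case using inv by (intro bexI[of _ id]) (auto simp: n_def weyl.weyl_id)
  next
    case (weyl_step w v)
    then obtain w' where w': "w' \<in> weyl L" "\<forall>x\<in>rvec n. w' x = \<phi> (w (\<phi> x))" by blast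
    have v: "v \<in> lat_pts L" using weyl_step(2) by (rule refl_vecs_lat_pts)
    have bv: "bil L (\<phi> v) y = bil L v (\<phi> y)" if "y \<in> rvec n" for y
      using iso[of v "\<phi> y"] inv[of y] that by (simp add: n_def)
    have "\<phi> v \<in> refl_vecs L"
      using weyl_step(2) lp v bv iso by (auto simp: refl_vecs_def n_def lat_ptsD(2))
    moreover have "(refl L (\<phi> v) \<circ> w') x = \<phi> ((refl L v \<circ> w) (\<phi> x))" if x: "x \<in> rvec n" for x
      using w' x by (simp add: refl_lc lin iso)
    ultimately show ?case using weyl.weyl_step[OF w'(1)] by blast
  qed
  have mir: "\<phi> x \<in> mirrors L" if xm: "x \<in> mirrors L" for x
  proof -
    obtain a w where a: "x \<in> rvec n" "bil L x a = 0" "a \<in> rvec n" "bil L a a \<noteq> 0" "w \<in> weyl L"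
      "\<forall>x\<in>rvec n. w x = refl L a x" using xm unfolding mirrors_def n_def by auto
    obtain w' where w': "w' \<in> weyl L" "\<forall>x\<in>rvec n. w' x = \<phi> (w (\<phi> x))" using conj a by blast
    have "w' y = refl L (\<phi> a) y" if y: "y \<in> rvec n" for y
    proof -
      have "w' y = \<phi> (refl L a (\<phi> y))" using w' a y rv by (simp add: n_def)
      also have "\<dots> = refl L (\<phi> a) y"
        using inv y iso[of "\<phi> y" a] by (simp add: refl_lc lin iso n_def)
      finally show ?thesis .
    qed
    then have "{x \<in> rvec (fst L). bil L x (\<phi> a) = 0} \<in> {{x \<in> rvec (fst L). bil L x a = 0} | a.
        a \<in> rvec (fst L) \<and> bil L a a \<noteq> 0 \<and> (\<exists>w\<in>weyl L. \<forall>x\<in>rvec (fst L). w x = refl L a x)}"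
      using a(3,4) w'(1) rv[of a] iso[of a a] unfolding n_def
      by (intro CollectI exI[of _ "\<phi> a"] conjI HOL.refl bexI[of _ w'] ballI) auto
    moreover have "\<phi> x \<in> {x \<in> rvec (fst L). bil L x (\<phi> a) = 0}"
      using a(1,2) rv iso by (simp add: n_def)
    ultimately show ?thesis unfolding mirrors_def by (rule UnionI)
  qed

  define f where "f j = lc 1 (unit j) 1 (\<phi> (unit j))" for j
  \<comment> \<open>A curve through \<open>e\<close> in the fixed space, which the
    \<open>f j\<close> span. For a lattice vector b not orthogonal to all \<open>f j\<close>, the
    pairing with \<open>X s\<close> is a nonzero polynomial in s; countably many b exclude countably
    many s, and an uncountable interval around \<open>e\<close> remains.\<close>
  define X where "X s = (\<lambda>i. e i + (\<Sum>j<n. s ^ Suc j * f j i))" for s :: real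
  have Xlc: "X s = lc 1 e 1 (\<lambda>i. \<Sum>j<n. s ^ Suc j * f j i)" for s by (auto simp: X_def lc_def)
  have fr: "f j \<in> rvec n" "\<phi> (f j) = f j" if "j < n" for j
  proof -
    have u: "unit j \<in> rvec n" using unit_lat_pts[of j L] that by (simp add: n_def lat_ptsD(2))
    show "f j \<in> rvec n" unfolding f_def using u rv by (intro lc_rvec) (auto simp: n_def)
    show "\<phi> (f j) = f j" using inv u by (auto simp: f_def lin n_def) (auto simp: lc_def)
  qed
  have Xr: "X s \<in> rvec n" for s
    using e fr by (auto simp: X_def rvec_def n_def)
  have Xf: "\<phi> (X s) = X s" for s
  proof -
    have "(\<lambda>i. \<Sum>j<n. s ^ Suc j * \<phi> (f j) i) = (\<lambda>i. \<Sum>j<n. s ^ Suc j * f j i)"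
      using fr by (intro ext sum.cong) auto
    then show ?thesis by (simp only: Xlc lin e linear_expand[OF lin])
  qed
  have Xb: "bil L (X s) b = (\<Sum>j\<le>n. (if j = 0 then bil L e b else bil L (f (j - 1)) b) * s ^ j)" for s b
  proof -
    have "bil L (X s) b = bil L e b + (\<Sum>j<n. s ^ Suc j * bil L (f j) b)"
      by (simp add: Xlc bil_lc_left bil_sum_left)
    also have "\<dots> = (\<Sum>j<Suc n. (if j = 0 then bil L e b else bil L (f (j - 1)) b) * s ^ j)"
      by (subst sum.lessThan_Suc_shift) (simp add: mult.commute)
    finally show ?thesis by (simp add: lessThan_Suc_atMost)
  qed
  define bad where "bad = (\<Union>b\<in>{b \<in> lat_pts L. \<exists>j<n. bil L (f j) b \<noteq> 0}. {s. bil L (X s) b = 0})"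
  have "countable bad"
    unfolding bad_def
  proof (rule countable_UN)
    show "countable {b \<in> lat_pts L. \<exists>j<n. bil L (f j) b \<noteq> 0}"
      by (rule countable_subset[OF _ countable_lat_pts]) auto
    fix b assume "b \<in> {b \<in> lat_pts L. \<exists>j<n. bil L (f j) b \<noteq> 0}"
    then obtain j where "j < n" "bil L (f j) b \<noteq> 0" by auto
    then have "finite {s. bil L (X s) b = 0}"
      unfolding Xb polyfun_finite_roots by (intro exI[of _ "Suc j"]) auto
    then show "countable {s. bil L (X s) b = 0}" by (rule countable_finite)
  qed
  moreover obtain \<delta> where \<delta>: "\<delta> > 0" "\<And>s. \<bar>s\<bar> < \<delta> \<Longrightarrow> bil L (X s) (X s) < 0"
  proof -
    have "continuous_on UNIV (\<lambda>s. bil L (X s) (X s))"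
      unfolding bil_def X_def by (intro continuous_intros)
    then have "open {s. bil L (X s) (X s) < 0}"
      by (intro open_Collect_less) auto
    moreover have "X 0 = e" by (auto simp: X_def)
    ultimately obtain \<delta> where "\<delta> > 0" "\<forall>s. dist s 0 < \<delta> \<longrightarrow> s \<in> {s. bil L (X s) (X s) < 0}"
      using e(3) unfolding open_dist by auto
    then show ?thesis using that by auto
  qed
  moreover have "\<not> countable {0<..<\<delta>}" using \<delta> by (simp add: uncountable_open_interval)
  ultimately obtain s where s: "s \<in> {0<..<\<delta>}" "s \<notin> bad"
    by (meson countable_subset subsetI)
  define x where "x = X s"
  have xneg: "bil L x x < 0" using s \<delta>(2) by (simp add: x_def)
  have xm: "x \<notin> mirrors L"
  proof
    assume "x \<in> mirrors L"
    then obtain a w where a: "bil L x a = 0" "a \<in> rvec (fst L)" "bil L a a \<noteq> 0" "w \<in> weyl L"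
      "\<forall>x\<in>rvec (fst L). w x = refl L a x" unfolding mirrors_def by auto
    obtain b c where b: "b \<in> lat_pts L" "c \<noteq> 0" "b = (\<lambda>i. c * a i)" "6 / bil L b b \<in> \<int>"
      using mirror_vector[OF sym dual_period a(2-5)] by blast
    have "bil L x b = 0" using a b by (simp add: bil_scale_right)
    then have f0: "bil L (f j) b = 0" if "j < n" for j
      using s b that unfolding bad_def x_def by blast
    \<comment> \<open>Being orthogonal to the whole fixed space, b is anti-invariant by
      nondegeneracy. Its norm is then a multiple of 4, which cannot divide 6.\<close>
    have "bil L (lc 1 b 1 (\<phi> b)) y = 0" if y: "y \<in> lat_pts L" for y
    proof -
      have "bil L (lc 1 b 1 (\<phi> b)) (unit j) = 0" if j: "j < n" for j
      proof -
        have u: "unit j \<in> rvec n" using unit_lat_pts[of j L] j by (simp add: n_def lat_ptsD(2))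
        have "bil L (\<phi> b) (unit j) = bil L b (\<phi> (unit j))"
          using iso[of b "\<phi> (unit j)"] inv u by (simp add: n_def)
        then show ?thesis using f0[OF j]
          by (simp add: f_def bil_lc_left sym_formD[OF sym, of b])
      qed
      then have "bil L (\<lambda>i. \<Sum>j<n. y j * unit j i) (lc 1 b 1 (\<phi> b)) = 0"
        by (simp add: bil_sum_left sym_formD[OF sym, of "unit _"])
      then show ?thesis
        using rvec_expand[of y n] y by (simp add: n_def lat_ptsD(2) sym_formD[OF sym, of y])
    qed
    then have "lc 1 b 1 (\<phi> b) i = 0" if "i < n" for i
      using dual_period_nondeg[OF dual_period] that by (simp add: n_def)
    then have "\<phi> b i = - b i" if "i < n" for i using that by (simp add: lc_def eq_neg_iff_add_eq_0 add.commute)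
    moreover have "\<phi> b i = - b i" if "\<not> i < n" for i
      using that b(1) lp[OF b(1)] by (simp add: lat_pts_def rvec_def n_def)
    ultimately have "\<phi> b = (\<lambda>i. - b i)" by blast
    then obtain k :: int where k: "bil L b b = 4 * of_int k" using anti b(1) by blast
    obtain m :: int where m: "6 / bil L b b = of_int m" using b(4) by (auto elim: Ints_cases)
    have "bil L b b \<noteq> 0" using a(3) b by (simp add: bil_scale_left bil_scale_right)
    then have "(6::real) = of_int m * (4 * of_int k)" using m k by (simp add: field_simps)
    then have "real_of_int 6 = real_of_int (m * (4 * k))" by simp
    then have "6 = m * (4 * k)" by (simp only: of_int_eq_iff)
    then have "6 = 4 * (m * k)" by simp
    then show False by presburger
  qed
  define D where "D = neg_cone L - mirrors L"
  define K where "K = connected_component_set D x"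
  have xD: "x \<in> D" using xneg xm Xr by (simp add: D_def neg_cone_def x_def n_def)
  have Kr: "K \<subseteq> rvec n"
    using connected_component_subset[of D x] by (auto simp: K_def D_def neg_cone_def n_def)
  have sub: "act n A ` K \<subseteq> K"
    unfolding K_def
  proof (rule connected_component_maximal)
    have "x \<in> K" using xD by (simp add: K_def)
    moreover have "act n A x = x" using A Xr Xf by (simp add: x_def)
    ultimately show "x \<in> act n A ` connected_component_set D x"
      unfolding K_def by (intro image_eqI[of x "act n A" x]) simp_all
    show "connected (act n A ` connected_component_set D x)"
      by (intro connected_continuous_image continuous_act) simp
    show "act n A ` connected_component_set D x \<subseteq> D"
    proof
      fix z assume "z \<in> act n A ` connected_component_set D x"
      then obtain y where y: "y \<in> K" "z = act n A y" unfolding K_def by auto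
      have yD: "y \<in> D" using y connected_component_subset[of D x] by (auto simp: K_def)
      have yr: "y \<in> rvec n" using y Kr by auto
      have z: "z = \<phi> y" using y A yr by simp
      have "\<phi> y \<notin> mirrors L" using mir[of "\<phi> y"] inv yr yD by (auto simp: n_def D_def)
      then show "z \<in> D" using yD rv iso yr by (simp add: z D_def neg_cone_def n_def)
    qed
  qed
  have "act n A ` K = K"
  proof
    show "act n A ` K \<subseteq> K" by (rule sub)
    show "K \<subseteq> act n A ` K"
    proof
      fix y assume y: "y \<in> K"
      then have "y \<in> rvec n" using Kr by auto
      then have "act n A (act n A y) = y" using A rv inv by (simp add: n_def)
      then show "y \<in> act n A ` K" using sub y by (metis image_eqI image_subset_iff)
    qed
  qed
  moreover have "K \<in> cell_lifts L" using xD unfolding cell_lifts_def K_def D_def by blast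
  ultimately show ?thesis unfolding achiral_def using aut z3 by (auto simp: n_def)
qed

subsection \<open>Vectors of the 3-primary part\<close>

text \<open>Equivalently, q/3 lies in the dual lattice: the classes of q/3 are the 3-torsion of the
  discriminant group, written without denominators.\<close>

definition special :: "lat \<Rightarrow> (nat \<Rightarrow> real) \<Rightarrow> bool" where
  "special L q \<longleftrightarrow> q \<in> lat_pts L \<and> (\<forall>w\<in>lat_pts L. \<exists>k::int. bil L q w = 3 * of_int k)"

lemma specialD: "special L q \<Longrightarrow> q \<in> lat_pts L" "special L q \<Longrightarrow> w \<in> lat_pts L \<Longrightarrow> bil L q w / 3 \<in> \<int>"
  unfolding special_def by auto

lemma specialI:
  assumes "q \<in> lat_pts L" "\<And>w. w \<in> lat_pts L \<Longrightarrow> bil L q w / 3 \<in> \<int>"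
  shows "special L q"
  unfolding special_def
proof (intro conjI ballI)
  fix w assume "w \<in> lat_pts L"
  then obtain k :: int where "bil L q w / 3 = of_int k" using assms(2) Ints_cases by metis
  then show "\<exists>k::int. bil L q w = 3 * of_int k" by (intro exI[of _ k]) simp
qed (rule assms(1))

text \<open>With discriminant of period 2 there is no 3-torsion: 2 q_i is a pairing of q with a
  lattice vector, so 3 divides 2 q_i and hence q_i.\<close>

lemma special_dd_1:
  assumes "dual_period 1 L" "special L q"
  shows "q i / 3 \<in> \<int>"
proof (cases "i < fst L")
  case True
  then obtain d where d: "d \<in> rvec (fst L)" "\<forall>j. 2 * d j \<in> \<int>" "\<forall>u. bil L u d = u i"
    using assms(1) by (auto simp: dual_period_def)
  then have "(\<lambda>j. 2 * d j) \<in> lat_pts L" by (auto simp: lat_pts_def rvec_def)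
  then obtain k :: int where k: "bil L q (\<lambda>j. 2 * d j) = 3 * of_int k"
    using assms(2) by (auto simp: special_def)
  obtain m :: int where m: "q i = of_int m" using lat_ptsD(1)[OF specialD(1)[OF assms(2)]] Ints_cases by metis
  have "2 * m = 3 * k"
    using k d(3) m by (simp add: bil_scale_right)
  then have "3 dvd m" by presburger
  then show ?thesis using m by (auto elim!: dvdE)
next
  case False
  then show ?thesis using specialD(1)[OF assms(2)] by (auto simp: lat_pts_def rvec_def)
qed

text \<open>The discriminant has period 6, so 6x is integral; some 3^k x is integral as well. As 3^k
  = 2m + 1 is odd, 3x is an integral combination of the two, and the whole 3-primary part is killed
  by 3.\<close>

lemma three_primary_spec:
  assumes "dual_period 3 L" "x \<in> three_primary L"
  shows "special L (\<lambda>i. 3 * x i)"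
proof (rule specialI)
  have x: "x \<in> rvec (fst L)" "\<And>v. v \<in> lat_pts L \<Longrightarrow> bil L x v \<in> \<int>"
    using assms(2) by (auto simp: three_primary_def dual_pts_def)
  obtain k where k: "(\<lambda>i. 3 ^ k * x i) \<in> lat_pts L" using assms(2) by (auto simp: three_primary_def)
  have "3 * x i \<in> \<int>" for i
  proof (cases "i < fst L")
    case True
    then obtain d where d: "d \<in> rvec (fst L)" "\<forall>j. 2 * d j \<in> \<int>" "\<forall>u. bil L u d = 3 * u i"
      using assms(1) by (auto simp: dual_period_def)
    then have "(\<lambda>j. 2 * d j) \<in> lat_pts L" by (auto simp: lat_pts_def rvec_def)
    then have "bil L x (\<lambda>j. 2 * d j) \<in> \<int>" by (rule x)
    then have a: "6 * x i \<in> \<int>" using d(3) by (simp add: bil_scale_right)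
    have b: "3 ^ k * x i \<in> \<int>" using k by (auto dest: lat_ptsD)
    obtain m :: nat where m: "3 ^ k = 2 * m + 1" using oddE[of "3 ^ k :: nat"] by auto
    have "(3::real) ^ k = of_nat (3 ^ k)" by simp
    also have "\<dots> = 2 * of_nat m + 1" unfolding m by simp
    finally have "3 * x i = 3 * (3 ^ k * x i) - of_nat m * (6 * x i)" by (simp add: algebra_simps)
    also have "\<dots> \<in> \<int>" by (intro Ints_diff Ints_mult a b) auto
    finally show ?thesis .
  next
    case False
    then show ?thesis using x by (simp add: rvec_def)
  qed
  then show "(\<lambda>i. 3 * x i) \<in> lat_pts L" using x(1) by (auto simp: lat_pts_def rvec_def)
  fix w assume "w \<in> lat_pts L"
  then show "bil L (\<lambda>i. 3 * x i) w / 3 \<in> \<int>" using x(2) by (simp add: bil_scale_left)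
qed

text \<open>The reflection in \<open>h\<close> acts as \<open>- id\<close> on the 3-primary discriminant.\<close>
definition reverses3 :: "lat \<Rightarrow> (nat \<Rightarrow> real) \<Rightarrow> bool" where
  "reverses3 L h \<longleftrightarrow> (\<forall>q. special L q \<longrightarrow> (\<lambda>i. (2 * q i - bil L q h / 3 * h i) / 3) \<in> lat_pts L)"

lemma lat_pts_sum:
  assumes "\<And>k. k \<in> K \<Longrightarrow> g k \<in> lat_pts L" "\<And>k. k \<in> K \<Longrightarrow> a k \<in> \<int>"
  shows "(\<lambda>i. \<Sum>k\<in>K. a k * g k i) \<in> lat_pts L"
  using assms unfolding lat_pts_def rvec_def by (auto intro!: Ints_sum Ints_mult sum.neutral)

lemma sum_lessThan_7: "(\<Sum>k<(7::nat). g k) = g 0 + g 1 + g 2 + g 3 + g 4 + g 5 + (g 6 :: real)"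
  by (simp add: lessThan_nat_numeral numeral_eq_Suc)

subsection \<open>Achirality from a frame\<close>

text \<open>The involution is \<open>- id\<close> on the orthogonal complement of \<open>e' = 3 f\<^sub>0 + f\<^sub>1 + \<dots> + f\<^sub>6\<close> in the span
  of the frame and \<open>id\<close> on the complement; that anti-invariant lattice is a copy of \<open>E\<^sub>6(2)\<close>.\<close>
lemma achiral_of_frame:
  fixes f :: "nat \<Rightarrow> nat \<Rightarrow> real"
  defines "N \<equiv> \<lambda>k::nat. if k = 0 then - 2 else if k = 1 then 6 else (2::real)"
  assumes sym: "sym_form L" and dual_period: "dual_period 3 L"
    and f: "\<And>k. k < 7 \<Longrightarrow> f k \<in> lat_pts L"
    and orth: "\<And>j k. j < 7 \<Longrightarrow> k < 7 \<Longrightarrow> bil L (f j) (f k) = (if j = k then N k else 0)"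
    and h: "special L (f 1)" "reverses3 L (f 1)"
    and prim: "\<And>c. (\<lambda>i. \<Sum>k<7. c k * f k i) \<in> lat_pts L \<Longrightarrow> \<forall>k<7. c k \<in> \<int>"
  shows "achiral L"
proof -
  define c where "c k = (if k = 0 then 3 else (1::real))" for k :: nat
  define e where "e = (\<lambda>i. \<Sum>k<7. c k * f k i)"
  define P where "P x = (\<lambda>i. \<Sum>k<7. 2 * bil L x (f k) / N k * f k i)" for x
  \<comment> \<open>\<open>P\<close> is twice the orthogonal projection to the span. Thus x - P x is
    the product of the reflections in the seven frame vectors, and the last term composes it with
    the reflection in \<open>e\<close>, of norm -18 + 6 + 10 = -2. Every factor preserves the
    lattice.\<close>
  define \<phi> where "\<phi> x = lc 1 (lc 1 x (- 1) (P x)) (- bil L x e) e" for x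
  have N: "N k \<noteq> 0" for k by (simp add: N_def)
  have e: "e \<in> lat_pts L" unfolding e_def by (rule lat_pts_sum) (auto simp: f c_def)
  have span: "bil L (\<lambda>i. \<Sum>j<7. t j * f j i) (f k) = t k * N k" if "k < 7" for t k
  proof -
    have "bil L (\<lambda>i. \<Sum>j<7. t j * f j i) (f k) = (\<Sum>j<7. t j * (if j = k then N k else 0))"
      unfolding bil_sum_left by (intro sum.cong) (auto simp: orth that)
    also have "\<dots> = t k * N k" using that by (simp add: if_distrib cong: if_cong)
    finally show ?thesis .
  qed
  have be: "bil L x e = (\<Sum>k<7. c k * bil L x (f k))" for x
    unfolding e_def sym_formD[OF sym, of x] bil_sum_left by (simp add: sym_formD[OF sym, of "f _"])
  have ef: "bil L e (f k) = c k * N k" if "k < 7" for k unfolding e_def by (rule span[OF that])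
  have ee: "bil L e e = - 2"
  proof -
    have "bil L e e = (\<Sum>k<7. c k * (c k * N k))"
      unfolding be by (intro sum.cong) (auto simp: ef)
    then show ?thesis by (simp add: sum_lessThan_7 c_def N_def)
  qed
  have Pf: "bil L (P x) (f k) = 2 * bil L x (f k)" if "k < 7" for x k
    unfolding P_def span[OF that] using N by simp
  have Pe: "bil L (P x) e = 2 * bil L x e" for x
  proof -
    have "bil L (P x) e = (\<Sum>k<7. c k * (2 * bil L x (f k)))"
      unfolding be by (intro sum.cong) (auto simp: Pf)
    then show ?thesis by (simp add: be sum_distrib_left algebra_simps)
  qed
  have PP: "bil L (P x) (P y) = 2 * bil L (P x) y" for x y
  proof -
    have "bil L (P x) (P y) = (\<Sum>k<7. 2 * bil L x (f k) / N k * bil L (f k) (P y))"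
      unfolding P_def[of x] bil_sum_left ..
    also have "\<dots> = (\<Sum>k<7. 2 * bil L x (f k) / N k * (2 * bil L (f k) y))"
      by (intro sum.cong) (auto simp: sym_formD[OF sym, of "f _"] Pf)
    also have "\<dots> = 2 * bil L (P x) y"
      unfolding P_def[of x] bil_sum_left by (simp add: sum_distrib_left algebra_simps)
    finally show ?thesis .
  qed
  have Psym: "bil L x (P y) = bil L (P x) y" for x y
  proof -
    have "bil L x (P y) = (\<Sum>k<7. 2 * bil L y (f k) / N k * bil L (f k) x)"
      unfolding sym_formD[OF sym, of x] P_def bil_sum_left ..
    also have "\<dots> = (\<Sum>k<7. 2 * bil L x (f k) / N k * bil L (f k) y)"
      by (intro sum.cong) (auto simp: sym_formD[OF sym, of "f _"])
    finally show ?thesis unfolding P_def bil_sum_left .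
  qed
  have P_lc: "P (lc a x b y) = lc a (P x) b (P y)" for a b x y
  proof
    fix i
    have "P (lc a x b y) i
        = (\<Sum>k<7. a * (2 * bil L x (f k) / N k * f k i) + b * (2 * bil L y (f k) / N k * f k i))"
      unfolding P_def bil_lc_left by (intro sum.cong) (simp_all add: add_divide_distrib algebra_simps)
    then show "P (lc a x b y) i = lc a (P x) b (P y) i"
      by (simp add: sum.distrib sum_distrib_left P_def lc_def)
  qed
  have Pspan: "P (\<lambda>i. \<Sum>k<7. t k * f k i) = (\<lambda>i. 2 * (\<Sum>k<7. t k * f k i))" for t
    unfolding P_def using N by (auto simp: span sum_distrib_left mult.assoc intro!: ext sum.cong)
  have Pr: "P x \<in> rvec (fst L)" for x
    using f unfolding P_def rvec_def by (auto simp: lat_pts_def rvec_def intro!: sum.neutral)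
  have s\<phi>: "bil L (\<phi> x) e = bil L x e" for x
    by (simp add: \<phi>_def bil_lc_left Pe ee)
  have c2: "2 * bil L x (f k) / N k \<in> \<int>"
    if "k < 7" "bil L x (f k) \<in> \<int>" "k = 1 \<longrightarrow> bil L x (f k) / 3 \<in> \<int>" for x k
    using that by (auto simp: N_def)
  show ?thesis
  proof (rule achiral_of_involution[where \<phi> = \<phi> and e = e, OF sym dual_period])
    show "\<phi> (lc a x b y) = lc a (\<phi> x) b (\<phi> y)" for a x b y
      by (auto simp: \<phi>_def P_lc bil_lc_left) (auto simp: lc_def algebra_simps)
    show "\<phi> x \<in> rvec (fst L)" if "x \<in> rvec (fst L)" for x
      unfolding \<phi>_def using that Pr e by (intro lc_rvec) (auto dest: lat_ptsD)
    show "\<phi> x \<in> lat_pts L" if x: "x \<in> lat_pts L" for x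
    proof -
      have "P x \<in> lat_pts L"
        unfolding P_def
      proof (rule lat_pts_sum)
        fix k :: nat assume "k \<in> {..<7}"
        then have k: "k < 7" by simp
        show "f k \<in> lat_pts L" using f k .
        show "2 * bil L x (f k) / N k \<in> \<int>"
          using c2[OF k bil_Ints[OF x f[OF k]]] specialD(2)[OF h(1) x] sym_formD[OF sym, of x "f 1"] by auto
      qed
      then show ?thesis unfolding \<phi>_def using x e bil_Ints[OF x e] by (intro lc_lat_pts) auto
    qed
    show "bil L (\<phi> x) (\<phi> y) = bil L x y" for x y
    proof -
      have "bil L e (P y) = 2 * bil L y e" using Pe[of y] sym_formD[OF sym, of e "P y"] by simp
      moreover have "bil L e y = bil L y e" by (rule sym_formD[OF sym])
      ultimately show ?thesis
        using PP[of x y] Psym[of x y] by (simp add: \<phi>_def bil_lc_left bil_lc_right Pe ee algebra_simps)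
    qed
    show "\<phi> (\<phi> x) = x" if "x \<in> rvec (fst L)" for x
    proof -
      have Pe': "P e = (\<lambda>i. 2 * e i)" unfolding e_def by (rule Pspan)
      have PPx: "P (P x) = (\<lambda>i. 2 * P x i)" unfolding P_def[of x] by (rule Pspan)
      have "P (\<phi> x) = lc 1 (lc 1 (P x) (- 1) (P (P x))) (- bil L x e) (P e)"
        unfolding \<phi>_def P_lc ..
      then have "P (\<phi> x) i = - P x i - 2 * bil L x e * e i" for i
        by (simp add: Pe' PPx lc_def)
      then show ?thesis unfolding \<phi>_def[of "\<phi> x"] s\<phi> by (auto simp: lc_def \<phi>_def)
    qed
    show "\<phi> e = e"
    proof -
      have "P e = (\<lambda>i. 2 * e i)" unfolding e_def by (rule Pspan)
      then show ?thesis by (auto simp: \<phi>_def ee lc_def)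
    qed
    show "bil L e e < 0" by (simp add: ee)
    show "e \<in> rvec (fst L)" using e by (rule lat_ptsD)
    \<comment> \<open>Among these reflections only the one in the 6-root \<open>f 1\<close> moves
      classes in discr_3; the others change a dual vector by integral multiples of frame vectors or
      of \<open>e\<close>.\<close>
    show "(\<lambda>i. \<phi> x i + x i) \<in> lat_pts L" if x: "x \<in> three_primary L" for x
    proof -
      have xd: "bil L x v \<in> \<int>" if "v \<in> lat_pts L" for v
        using x that by (auto simp: three_primary_def dual_pts_def)
      have "(\<lambda>i. (2 * (3 * x i) - bil L (\<lambda>i. 3 * x i) (f 1) / 3 * f 1 i) / 3) \<in> lat_pts L"
        using h(2) three_primary_spec[OF dual_period x] by (auto simp: reverses3_def)
      then have a: "(\<lambda>i. 2 * x i - bil L x (f 1) / 3 * f 1 i) \<in> lat_pts L"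
        by (simp add: bil_scale_left diff_divide_distrib)
      have b: "(\<lambda>i. \<Sum>k\<in>{..<7} - {1}. 2 * bil L x (f k) / N k * f k i) \<in> lat_pts L"
        by (intro lat_pts_sum) (auto simp: f xd intro!: c2)
      have "P x i = bil L x (f 1) / 3 * f 1 i + (\<Sum>k\<in>{..<7} - {1}. 2 * bil L x (f k) / N k * f k i)" for i
        unfolding P_def by (subst sum.remove[of _ 1]) (auto simp: N_def)
      then have "(\<lambda>i. \<phi> x i + x i) = lc 1 (lc 1 (\<lambda>i. 2 * x i - bil L x (f 1) / 3 * f 1 i)
          (- 1) (\<lambda>i. \<Sum>k\<in>{..<7} - {1}. 2 * bil L x (f k) / N k * f k i)) (- bil L x e) e"
        by (auto simp: \<phi>_def lc_def)
      then show ?thesis using a b e xd[OF e] by (simp add: lc_lat_pts)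
    qed
    show "\<exists>k::int. bil L x x = 4 * of_int k" if x: "x \<in> lat_pts L" and anti: "\<phi> x = (\<lambda>i. - x i)" for x
    proof -
      have s0: "bil L x e = 0" using s\<phi>[of x] unfolding anti bil_minus_left by simp
      define t where "t k = bil L x (f k) / N k" for k
      have "x i = (\<Sum>k<7. t k * f k i)" for i
      proof -
        have "2 * x i = P x i" using fun_cong[OF anti, of i] s0 by (simp add: \<phi>_def lc_def)
        also have "\<dots> = 2 * (\<Sum>k<7. t k * f k i)"
          by (simp add: P_def t_def sum_distrib_left mult.assoc)
        finally show ?thesis by simp
      qed
      then have xt: "x = (\<lambda>i. \<Sum>k<7. t k * f k i)" by auto
      have "\<forall>k<7. t k \<in> \<int>" using prim x xt by metis
      then have "\<forall>k. \<exists>z::int. k < 7 \<longrightarrow> t k = of_int z" by (metis Ints_cases)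
      then obtain z :: "nat \<Rightarrow> int" where z: "\<And>k. k < 7 \<Longrightarrow> t k = of_int (z k)" by metis
      have bt: "bil L x (f k) = t k * N k" for k using N by (simp add: t_def)
      have "(\<Sum>k<7. c k * (t k * N k)) = 0" using s0 unfolding be bt .
      then have "of_int (- 6 * z 0 + 6 * z 1 + 2 * (z 2 + z 3 + z 4 + z 5 + z 6)) = (0::real)"
        by (simp add: sum_lessThan_7 c_def N_def z)
      then have s: "z 2 + z 3 + z 4 + z 5 + z 6 = 3 * (z 0 - z 1)"
        by (simp only: of_int_eq_0_iff) simp
      have "bil L x x = (\<Sum>k<7. t k * (t k * N k))"
        by (subst (1) xt) (simp add: bil_sum_left sym_formD[OF sym, of "f _"] bt)
      also have "\<dots> = of_int (2 * (- z 0 * z 0 + 3 * z 1 * z 1 + z 2 * z 2 + z 3 * z 3 + z 4 * z 4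
          + z 5 * z 5 + z 6 * z 6))"
        by (simp add: sum_lessThan_7 N_def z algebra_simps)
      finally have xx: "bil L x x = of_int (2 * (- z 0 * z 0 + 3 * z 1 * z 1 + z 2 * z 2 + z 3 * z 3
          + z 4 * z 4 + z 5 * z 5 + z 6 * z 6))" .
      \<comment> \<open>Squares agree with their bases modulo 2, so half the norm is congruent to z0
        + z1 + (z2 + ... + z6), which is even by orthogonality to \<open>e\<close>.\<close>
      have "even (z 2 + z 3 + z 4 + z 5 + z 6) \<longleftrightarrow> even (z 0 - z 1)" unfolding s by simp
      then have "even (- z 0 * z 0 + 3 * z 1 * z 1 + z 2 * z 2 + z 3 * z 3 + z 4 * z 4
          + z 5 * z 5 + z 6 * z 6)" by auto
      then obtain k where "- z 0 * z 0 + 3 * z 1 * z 1 + z 2 * z 2 + z 3 * z 3 + z 4 * z 4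
          + z 5 * z 5 + z 6 * z 6 = 2 * k" by (elim evenE)
      then show ?thesis unfolding xx by (intro exI[of _ k]) simp
    qed
  qed
qed


section \<open>Special vectors and frames of 2-roots in orthogonal sums\<close>

lemma cat_lat_pts:
  assumes "x \<in> lat_pts L" "y \<in> lat_pts M"
  shows "cat (fst L) x y \<in> lat_pts (osum L M)"
  using assms by (auto simp: lat_pts_def rvec_def cat_def)

lemma shift_cat [simp]: "shift n (cat n x y) = y"
  by (auto simp: shift_def cat_def)

lemma bil_cat_left: "bil (osum L M) (cat (fst L) x y) z = bil L x z + bil M y (shift (fst L) z)"
proof -
  have "bil L (cat (fst L) x y) z = bil L x z" by (rule bil_cong) (auto simp: cat_def)
  then show ?thesis by (simp add: bil_osum)
qed

lemma bil_cat_right: "bil (osum L M) z (cat (fst L) x y) = bil L z x + bil M (shift (fst L) z) y"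
proof -
  have "bil L z (cat (fst L) x y) = bil L z x" by (rule bil_cong) (auto simp: cat_def)
  then show ?thesis by (simp add: bil_osum)
qed

lemma bil_cat:
  "bil (osum L M) (cat (fst L) x y) (cat (fst L) x' y') = bil L x x' + bil M y y'"
proof -
  have "bil L x (cat (fst L) x' y') = bil L x x'" by (rule bil_cong) (auto simp: cat_def)
  then show ?thesis by (simp add: bil_cat_left)
qed

lemma bil_zero [simp]: "bil L (\<lambda>i. 0) y = 0" "bil L x (\<lambda>i. 0) = 0"
  by (simp_all add: bil_def)

lemma zero_lat_pts: "(\<lambda>i. 0) \<in> lat_pts L"
  by (simp add: lat_pts_def rvec_def)

lemma trunc_lat_pts: "x \<in> lat_pts (osum L M) \<Longrightarrow> trunc (fst L) x \<in> lat_pts L"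
  and shift_lat_pts: "x \<in> lat_pts (osum L M) \<Longrightarrow> shift (fst L) x \<in> lat_pts M"
  by (auto simp: lat_pts_def rvec_def trunc_def shift_def)

lemma bil_trunc: "bil L (trunc (fst L) x) y = bil L x y" "bil L x (trunc (fst L) y) = bil L x y"
  by (auto intro!: bil_cong simp: trunc_def)

lemma special_osum:
  assumes "special (osum L M) q"
  shows "special L (trunc (fst L) q)" "special M (shift (fst L) q)"
proof -
  have q: "q \<in> lat_pts (osum L M)" using assms by (rule specialD)
  show "special L (trunc (fst L) q)"
  proof (rule specialI)
    fix w assume "w \<in> lat_pts L"
    then have "cat (fst L) w (\<lambda>i. 0) \<in> lat_pts (osum L M)" by (intro cat_lat_pts zero_lat_pts)
    from specialD(2)[OF assms this] show "bil L (trunc (fst L) q) w / 3 \<in> \<int>"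
      by (simp add: bil_cat_right bil_trunc)
  qed (use q in \<open>rule trunc_lat_pts\<close>)
  show "special M (shift (fst L) q)"
  proof (rule specialI)
    fix w assume "w \<in> lat_pts M"
    then have "cat (fst L) (\<lambda>i. 0) w \<in> lat_pts (osum L M)" by (intro cat_lat_pts zero_lat_pts)
    from specialD(2)[OF assms this] show "bil M (shift (fst L) q) w / 3 \<in> \<int>"
      by (simp add: bil_cat_right)
  qed (use q in \<open>rule shift_lat_pts\<close>)
qed

lemma special_cat:
  assumes "special L x" "special M y"
  shows "special (osum L M) (cat (fst L) x y)"
proof (rule specialI)
  show "cat (fst L) x y \<in> lat_pts (osum L M)" using assms by (intro cat_lat_pts specialD)
  fix w assume w: "w \<in> lat_pts (osum L M)"
  have "bil L x (trunc (fst L) w) / 3 + bil M y (shift (fst L) w) / 3 \<in> \<int>"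
    using specialD(2)[OF assms(1) trunc_lat_pts[OF w]] specialD(2)[OF assms(2) shift_lat_pts[OF w]]
    by (rule Ints_add)
  then show "bil (osum L M) (cat (fst L) x y) w / 3 \<in> \<int>"
    by (simp add: bil_cat_left bil_trunc add_divide_distrib)
qed

lemma special_zero: "special L (\<lambda>i. 0)"
  by (rule specialI) (simp_all add: zero_lat_pts)

text \<open>The last clause, with real coefficients, says that the span is a primitive sublattice.
  This is what makes anti-invariant lattice vectors integral combinations of the frame.\<close>

definition orth_frame :: "nat \<Rightarrow> lat \<Rightarrow> bool" where
  "orth_frame k L \<longleftrightarrow> (\<exists>g. (\<forall>j<k. g j \<in> lat_pts L)
     \<and> (\<forall>i<k. \<forall>j<k. bil L (g i) (g j) = (if i = j then 2 else 0))
     \<and> (\<forall>c. (\<forall>i<fst L. (\<Sum>j<k. c j * g j i) \<in> \<int>) \<longrightarrow> (\<forall>j<k. c j \<in> \<int>)))"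

lemma orth_frame_mono:
  assumes "orth_frame k L" "j \<le> k"
  shows "orth_frame j L"
proof -
  obtain g where g: "\<forall>j<k. g j \<in> lat_pts L"
    "\<forall>i<k. \<forall>j<k. bil L (g i) (g j) = (if i = j then 2 else 0)"
    "\<And>c. (\<forall>i<fst L. (\<Sum>j<k. c j * g j i) \<in> \<int>) \<Longrightarrow> (\<forall>j<k. c j \<in> \<int>)"
    using assms(1) by (auto simp: orth_frame_def)
  have "\<forall>l<j. c l \<in> \<int>" if c: "\<forall>i<fst L. (\<Sum>l<j. c l * g l i) \<in> \<int>" for c
  proof -
    let ?c = "\<lambda>l. if l < j then c l else 0"
    have "(\<Sum>l<k. ?c l * g l i) = (\<Sum>l<j. c l * g l i)" for i
      using assms(2) by (intro sum.mono_neutral_cong_right) auto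
    then have "\<forall>l<k. ?c l \<in> \<int>" using c by (intro g) auto
    then show ?thesis using assms(2) by (metis order_less_le_trans)
  qed
  then show ?thesis unfolding orth_frame_def using g(1,2) assms(2) by (intro exI[of _ g]) auto
qed

lemma orth_frame_osum:
  assumes "orth_frame k L" "orth_frame l M"
  shows "orth_frame (k + l) (osum L M)"
proof -
  obtain g where g: "\<forall>j<k. g j \<in> lat_pts L"
    "\<forall>i<k. \<forall>j<k. bil L (g i) (g j) = (if i = j then 2 else 0)"
    "\<And>c. (\<forall>i<fst L. (\<Sum>j<k. c j * g j i) \<in> \<int>) \<Longrightarrow> (\<forall>j<k. c j \<in> \<int>)"
    using assms(1) by (auto simp: orth_frame_def)
  obtain g' where g': "\<forall>j<l. g' j \<in> lat_pts M"
    "\<forall>i<l. \<forall>j<l. bil M (g' i) (g' j) = (if i = j then 2 else 0)"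
    "\<And>c. (\<forall>i<fst M. (\<Sum>j<l. c j * g' j i) \<in> \<int>) \<Longrightarrow> (\<forall>j<l. c j \<in> \<int>)"
    using assms(2) by (auto simp: orth_frame_def)
  define G where "G j = (if j < k then cat (fst L) (g j) (\<lambda>i. 0)
      else cat (fst L) (\<lambda>i. 0) (g' (j - k)))" for j
  have split: "(\<Sum>j<k + l. h j) = (\<Sum>j<k. h j) + (\<Sum>j<l. h (j + k))" for h :: "nat \<Rightarrow> real"
    using sum.atLeastLessThan_concat[of 0 k "k + l" h] sum.shift_bounds_nat_ivl[of h 0 k l]
    by (simp add: atLeast0LessThan add.commute)
  have "\<forall>j<k + l. c j \<in> \<int>" if c: "\<forall>i<fst L + fst M. (\<Sum>j<k + l. c j * G j i) \<in> \<int>" for c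
  proof -
    have "(\<Sum>j<k. c j * g j i) \<in> \<int>" if "i < fst L" for i
      using c[rule_format, of i] that by (simp add: split G_def cat_def)
    then have 1: "\<forall>j<k. c j \<in> \<int>" by (intro g) auto
    have "(\<Sum>j<l. c (j + k) * g' j i) \<in> \<int>" if "i < fst M" for i
      using c[rule_format, of "i + fst L"] that by (simp add: split G_def cat_def)
    then have 2: "\<forall>j<l. c (j + k) \<in> \<int>" by (intro g'(3)[of "\<lambda>j. c (j + k)"]) auto
    show ?thesis using 1 2 by (simp add: all_less_add_iff)
  qed
  moreover have "\<forall>j<k + l. G j \<in> lat_pts (osum L M)"
    using g(1) g'(1) by (auto simp: G_def intro!: cat_lat_pts zero_lat_pts)
  moreover have "\<forall>i<k + l. \<forall>j<k + l. bil (osum L M) (G i) (G j) = (if i = j then 2 else 0)"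
    using g(2) g'(2) by (auto simp: G_def bil_cat)
  ultimately show ?thesis unfolding orth_frame_def fst_osum by blast
qed

lemma orth_frame_latA1: "orth_frame 1 latA1"
  unfolding orth_frame_def by (intro exI[of _ "\<lambda>j. lvec [1]"]) (auto simp: bil_latA1 intro!: lvec_lat_pts)

lemma orth_frame_rep: "orth_frame t (rep t latA1)"
proof (induction t)
  case 0
  show ?case by (simp add: orth_frame_def)
next
  case (Suc t)
  then show ?case using orth_frame_osum[OF orth_frame_latA1 Suc] by simp
qed

text \<open>Distinct unit vectors always span a primitive sublattice, so pairwise non-adjacent nodes
  of a Dynkin diagram form a frame: the three leaves of D4, and the nodes with indices 0, 1, 4, 6 of
  E8.\<close>

lemma orth_frame_units:
  assumes "\<And>j. j < k \<Longrightarrow> s j < fst L" "\<And>i j. i < k \<Longrightarrow> j < k \<Longrightarrow> s i = s j \<Longrightarrow> i = j"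
    and "\<And>i j. i < k \<Longrightarrow> j < k \<Longrightarrow> bil L (unit (s i)) (unit (s j)) = (if i = j then 2 else 0)"
  shows "orth_frame k L"
  unfolding orth_frame_def
proof (intro exI[of _ "\<lambda>j. unit (s j)"] conjI allI impI)
  fix c j assume c: "\<forall>i<fst L. (\<Sum>j<k. c j * unit (s j) i) \<in> \<int>" and j: "j < k"
  have "(\<Sum>l<k. c l * unit (s l) (s j)) = (\<Sum>l<k. if l = j then c l else 0)"
    using assms(2) j by (intro sum.cong) (auto simp: unit_def)
  also have "\<dots> = c j" using j by simp
  finally show "c j \<in> \<int>" using c assms(1) j by metis
qed (use assms in \<open>auto intro: unit_lat_pts\<close>)

lemma orth_frame_latD4: "orth_frame 3 latD4"
proof (rule orth_frame_units)
  show "bil latD4 (unit ([0,2,3] ! i)) (unit ([0,2,3] ! j)) = (if i = j then 2 else 0)"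
    if "i < 3" "j < 3" for i j :: nat
    using that by (auto simp: less_Suc_eq numeral_3_eq_3 bil_latD4 unit_def)
qed (auto simp: less_Suc_eq numeral_3_eq_3)

lemma orth_frame_latE8: "orth_frame 4 latE8"
proof (rule orth_frame_units)
  let ?s = "(!) [0,1,4,6] :: nat \<Rightarrow> nat"
  have "\<forall>i<4. \<forall>j<4. bil latE8 (unit (?s i)) (unit (?s j)) = (if i = j then 2 else 0)"
    unfolding less_8_iff by (simp add: bil_latE8 unit_def)
  then show "bil latE8 (unit (?s i)) (unit (?s j)) = (if i = j then 2 else 0)"
    if "i < 4" "j < 4" for i j :: nat using that by blast
qed (auto simp: less_Suc_eq numeral_eq_Suc)

text \<open>The outer summands have no 3-torsion, so there a special q is divisible by 3 and the
  condition is empty; only the component in \<open>T\<close> matters.\<close>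

lemma reverses3_osum:
  assumes "dual_period 1 X" "reverses3 T h" "dual_period 1 Y"
  shows "reverses3 (osum X (osum T Y)) (cat (fst X) (\<lambda>i. 0) (cat (fst T) h (\<lambda>i. 0)))"
    (is "reverses3 ?L ?H")
  unfolding reverses3_def
proof (intro allI impI)
  fix q assume q: "special ?L q"
  let ?qT = "trunc (fst T) (shift (fst X) q)" and ?qY = "shift (fst T) (shift (fst X) q)"
  have qX: "special X (trunc (fst X) q)" and qT: "special T ?qT" and qY: "special Y ?qY"
    using special_osum[OF q] special_osum by blast+
  have b: "bil ?L q ?H = bil T ?qT h" by (simp add: bil_cat_right bil_trunc)
  have rT: "(2 * ?qT i - bil T ?qT h / 3 * h i) / 3 \<in> \<int>" for i
    using assms(2) qT by (auto simp: reverses3_def dest: lat_ptsD)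
  have "(2 * q i - bil ?L q ?H / 3 * ?H i) / 3 \<in> \<int>" for i
  proof -
    consider "i < fst X" | "fst X \<le> i" "i < fst X + fst T" | "fst X + fst T \<le> i" by linarith
    then show ?thesis
    proof cases
      case 1
      have "2 * (q i / 3) \<in> \<int>"
        using special_dd_1[OF assms(1) qX, of i] 1 by (intro Ints_mult) (auto simp: trunc_def)
      then show ?thesis using 1 by (simp add: cat_def)
    next
      case 2
      then have i: "i - fst X < fst T" "i - fst X + fst X = i" by auto
      then have "?qT (i - fst X) = q i" by (simp add: trunc_def shift_def)
      moreover have "?H i = h (i - fst X)" using 2 i by (simp add: cat_def)
      ultimately show ?thesis using rT[of "i - fst X"] b by simp
    next
      case 3
      have "2 * (q i / 3) \<in> \<int>"
        using special_dd_1[OF assms(3) qY, of "i - fst X - fst T"] 3 by (intro Ints_mult) (auto simp: shift_def)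
      moreover have "?H i = 0" using 3 by (auto simp: cat_def)
      ultimately show ?thesis by simp
    qed
  qed
  moreover have "(2 * q i - bil ?L q ?H / 3 * ?H i) / 3 = 0" if "fst ?L \<le> i" for i
    using specialD(1)[OF q] that by (auto simp: lat_pts_def rvec_def cat_def)
  ultimately show "(\<lambda>i. (2 * q i - bil ?L q ?H / 3 * ?H i) / 3) \<in> lat_pts ?L"
    by (auto simp: lat_pts_def rvec_def)
qed

text \<open>With \<open>e\<close>, \<open>h\<close> and the five 2-roots in different summands,
  orthogonality is automatic and primitivity can be read off summand by summand; the conditions on
  real multiples of \<open>e\<close> and \<open>h\<close> express it for these two.\<close>

lemma achiral_osum:
  assumes X: "sym_form X" "dual_period 1 X" "e \<in> lat_pts X" "bil X e e = - 2"
      "\<And>c. \<forall>i<fst X. c * e i \<in> \<int> \<Longrightarrow> c \<in> \<int>"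
    and T: "sym_form T" "dual_period 3 T" "special T h" "reverses3 T h" "bil T h h = 6"
      "\<And>c. \<forall>i<fst T. c * h i \<in> \<int> \<Longrightarrow> c \<in> \<int>"
    and Y: "sym_form Y" "dual_period 1 Y" "orth_frame 5 Y"
  shows "achiral (osum X (osum T Y))"
proof -
  obtain g :: "nat \<Rightarrow> nat \<Rightarrow> real" where g: "\<forall>j<5. g j \<in> lat_pts Y"
    "\<forall>i<5. \<forall>j<5. bil Y (g i) (g j) = (if i = j then 2 else 0)"
    "\<And>c. (\<forall>i<fst Y. (\<Sum>j<5. c j * g j i) \<in> \<int>) \<Longrightarrow> (\<forall>j<5. c j \<in> \<int>)"
    using Y(3) by (auto simp: orth_frame_def)
  let ?L = "osum X (osum T Y)"
  let ?H = "cat (fst X) (\<lambda>i. 0) (cat (fst T) h (\<lambda>i. 0))"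
  define f where "f k = (if k = 0 then cat (fst X) e (\<lambda>i. 0) else if k = 1 then ?H
      else cat (fst X) (\<lambda>i. 0) (cat (fst T) (\<lambda>i. 0) (g (k - 2))))" for k :: nat
  have split: "(\<Sum>j<7. s j) = s 0 + s 1 + (\<Sum>j<5. s (j + 2))" for s :: "nat \<Rightarrow> real"
    by (simp add: lessThan_nat_numeral numeral_eq_Suc)
  show ?thesis
  proof (rule achiral_of_frame[where f = f])
    show "sym_form ?L" using X T Y by (intro sym_form_osum)
    show "dual_period 3 ?L" using dual_period_1_imp_3[OF X(2)] T(2) dual_period_1_imp_3[OF Y(2)] by (intro dual_period_osum)
    show "f k \<in> lat_pts ?L" if "k < 7" for k
      using that X(3) specialD(1)[OF T(3)] g(1) by (auto simp: f_def intro!: cat_lat_pts zero_lat_pts)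
    show "bil ?L (f j) (f k) = (if j = k then if k = 0 then - 2 else if k = 1 then 6 else 2 else 0)"
      if "j < 7" "k < 7" for j k
      using that X(4) T(5) g(2) by (auto simp: f_def bil_cat)
    show "special ?L (f 1)" using T(3) by (simp add: f_def special_cat special_zero)
    show "reverses3 ?L (f 1)" using reverses3_osum[OF X(2) T(4) Y(2)] by (simp add: f_def)
    show "\<forall>k<7. c k \<in> \<int>" if c: "(\<lambda>i. \<Sum>k<7. c k * f k i) \<in> lat_pts ?L" for c
    proof -
      have c': "(\<Sum>k<7. c k * f k i) \<in> \<int>" for i using lat_ptsD(1)[OF c] .
      have "c 0 * e i \<in> \<int>" if "i < fst X" for i
        using c'[of i] that by (simp add: split f_def cat_def)
      then have c0: "c 0 \<in> \<int>" using X(5) by blast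
      have "c 1 * h i \<in> \<int>" if "i < fst T" for i
        using c'[of "i + fst X"] that by (simp add: split f_def cat_def)
      then have c1: "c 1 \<in> \<int>" using T(6) by blast
      have "(\<Sum>j<5. c (j + 2) * g j i) \<in> \<int>" for i
        using c'[of "i + fst T + fst X"] by (simp add: split f_def cat_def)
      then have c2: "\<forall>j<5. c (j + 2) \<in> \<int>" by (intro g(3)[of "\<lambda>j. c (j + 2)"]) auto
      have "c k \<in> \<int>" if "k < 7" for k
      proof -
        consider "k = 0" | "k = 1" | "2 \<le> k" by linarith
        then show ?thesis
        proof cases
          case 3
          have "k - 2 < 5" using that by linarith
          then have "c (k - 2 + 2) \<in> \<int>" by (rule c2[rule_format])
          moreover have "k - 2 + 2 = k" using 3 by linarith
          ultimately show ?thesis by (simp only:)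
        next
          case 1
          show ?thesis unfolding 1 by (rule c0)
        next
          case 2
          show ?thesis unfolding 2 by (rule c1)
        qed
      qed
      then show ?thesis by blast
    qed
  qed
qed


section \<open>Frames in the lattices of the table\<close>

lemma reverses3_lat6: "reverses3 lat6 (lvec [1])"
  unfolding reverses3_def
proof (intro allI impI)
  fix q assume "special lat6 q"
  then have "q \<in> lat_pts lat6" by (rule specialD)
  then have "(2 * q i - bil lat6 q (lvec [1]) / 3 * lvec [1] i) / 3 = 0" for i
    by (cases i) (auto simp: bil_lat6 lat_pts_def rvec_def)
  then show "(\<lambda>i. (2 * q i - bil lat6 q (lvec [1]) / 3 * lvec [1] i) / 3) \<in> lat_pts lat6"
    by (simp only: zero_lat_pts)
qed

text \<open>The 6-root is the difference of the simple roots. For special q the sum of the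
  coordinates is divisible by 3, and both coordinates of the vector in question equal a third of
  that sum.\<close>

lemma reverses3_latA2: "reverses3 latA2 (lvec [- 1, 1])"
  unfolding reverses3_def
proof (intro allI impI)
  fix q assume q: "special latA2 q"
  have ql: "q \<in> lat_pts latA2" using q by (rule specialD)
  have "bil latA2 q (unit 0) / 3 \<in> \<int>" using q by (rule specialD) (simp add: unit_lat_pts)
  then have "q 0 - bil latA2 q (unit 0) / 3 \<in> \<int>" using lat_ptsD(1)[OF ql] by (intro Ints_diff)
  then have d: "(q 0 + q 1) / 3 \<in> \<int>" by (simp add: bil_latA2 unit_def field_simps)
  define r where "r = (\<lambda>i. (2 * q i - bil latA2 q (lvec [- 1, 1]) / 3 * lvec [- 1, 1] i) / 3)"
  have r: "r 0 = (q 0 + q 1) / 3" "r 1 = (q 0 + q 1) / 3" by (simp_all add: r_def bil_latA2 field_simps)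
  have r2: "r i = 0" if "i \<ge> 2" for i
    using ql that by (simp add: r_def lat_pts_def rvec_def lvec_def)
  have "r i \<in> \<int>" for i
  proof -
    consider "i = 0" | "i = 1" | "i \<ge> 2" by linarith
    then show ?thesis
    proof cases
      case 1
      then show ?thesis unfolding 1 r by (intro d)
    next
      case 2
      then show ?thesis unfolding 2 r by (intro d)
    qed (simp add: r2)
  qed
  with r2 show "(\<lambda>i. (2 * q i - bil latA2 q (lvec [- 1, 1]) / 3 * lvec [- 1, 1] i) / 3) \<in> lat_pts latA2"
    unfolding r_def[symmetric] by (auto simp: lat_pts_def rvec_def)
qed

lemma special_lat6: "special lat6 (lvec [1])"
  by (rule specialI) (auto simp: bil_lat6 intro!: lvec_lat_pts Ints_mult dest: lat_ptsD)

lemma special_latA2: "special latA2 (lvec [- 1, 1])"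
  by (rule specialI) (auto simp: bil_latA2 diff_divide_distrib intro!: lvec_lat_pts Ints_diff dest: lat_ptsD)

lemma achiral_mA1_6:
  assumes "sym_form Y" "dual_period 1 Y" "orth_frame 5 Y"
  shows "achiral (osum latmA1 (osum lat6 Y))"
  by (rule achiral_osum[where e = "lvec [1]" and h = "lvec [1]", OF sym_form_summands(2) dual_period_latmA1 _ _ _
        sym_form_summands(3) dual_period_lat6 special_lat6 reverses3_lat6 _ _ assms])
    (auto simp: bil_latmA1 bil_lat6 intro!: lvec_lat_pts)

lemma achiral_mA1_A2:
  assumes "sym_form Y" "dual_period 1 Y" "orth_frame 5 Y"
  shows "achiral (osum latmA1 (osum latA2 Y))"
  by (rule achiral_osum[where e = "lvec [1]" and h = "lvec [- 1, 1]", OF sym_form_summands(2) dual_period_latmA1 _ _ _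
        sym_form_summands(5) dual_period_latA2 special_latA2 reverses3_latA2 _ _ assms])
    (auto simp: bil_latmA1 bil_latA2 less_8_iff intro!: lvec_lat_pts)

lemma achiral_U_A2:
  assumes "sym_form Y" "dual_period 1 Y" "orth_frame 5 Y"
  shows "achiral (osum latU (osum latA2 Y))"
  by (rule achiral_osum[where e = "lvec [1, - 1]" and h = "lvec [- 1, 1]", OF sym_form_summands(4) dual_period_latU _ _ _
        sym_form_summands(5) dual_period_latA2 special_latA2 reverses3_latA2 _ _ assms])
    (auto simp: bil_latU bil_latA2 less_8_iff intro!: lvec_lat_pts)

lemma achiral_row0:
  assumes "2 \<le> t"
  shows "achiral (row0 t)"
proof -
  obtain s where t: "t = Suc (Suc s)" using assms by (metis add_2_eq_Suc le_Suc_ex)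
  define M where "M = rep s latA1"
  define L where "L = row0 t"
  have L: "L = osum latmA1 (osum lat6 (osum latA1 (osum latA1 M)))"
    by (simp add: L_def row0_def t M_def)
  have n: "fst L = 4 + s" by (simp add: L M_def)
  have M: "sym_form M" "dual_period 1 M" "fst M = s"
    unfolding M_def using sym_form_rep[OF sym_form_summands(1)] dual_period_rep[OF dual_period_latA1] by simp_all
  have sym: "sym_form L" unfolding L using M by (intro sym_form_osum sym_form_summands)
  have dual_period: "dual_period 3 L" unfolding L
    using M by (intro dual_period_osum dual_period_lat6 dual_period_1_imp_3[OF dual_period_latmA1] dual_period_1_imp_3[OF dual_period_latA1] dual_period_1_imp_3[OF M(2)])
  have bil: "bil L x y = - 2 * x 0 * y 0 + 6 * x 1 * y 1 + 2 * x 2 * y 2 + 2 * x 3 * y 3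
      + bil M (shift 4 x) (shift 4 y)" for x y
    by (simp add: L bil_osum bil_latmA1 bil_lat6 bil_latA1 shift_def numeral_eq_Suc)
  \<comment> \<open>Both \<open>f\<close> and \<open>g\<close> have norm 8 and their product is -4,
    so they span A2(4). \<phi> subtracts twice the orthogonal projection to this span; the
    projection has half-integral coefficients, hence \<phi> is integral. The vector (3,-1,-1,-1) is
    orthogonal to both and has norm -8.\<close>
  define f where "f = lvec [1, - 1, - 1, 1]"
  define g where "g = lvec [1, 0, - 1, - 2]"
  define \<phi> where "\<phi> x = lc 1 (lc 1 x (x 0 + 2 * x 1 + x 2) f) (x 0 + x 1 + x 2 + x 3) g"
    for x :: "nat \<Rightarrow> real"
  have shfg: "f (i + 4) = 0" "g (i + 4) = 0" for i by (simp_all add: f_def g_def lvec_def)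
  have \<phi>: "\<phi> x 0 = 3 * x 0 + 3 * x 1 + 2 * x 2 + x 3" "\<phi> x 1 = - x 0 - x 1 - x 2"
    "\<phi> x 2 = - 2 * x 0 - 3 * x 1 - x 2 - x 3" "\<phi> x 3 = - x 0 - x 2 - x 3" "\<phi> x (i + 4) = x (i + 4)"
    "\<phi> x (Suc 0) = - x 0 - x 1 - x 2" for x i
    by (simp_all add: \<phi>_def lc_def shfg) (simp_all add: f_def g_def)
  have sh: "shift 4 (\<phi> x) = shift 4 x" for x by (auto simp: shift_def \<phi>)
  have fg: "f \<in> lat_pts L" "g \<in> lat_pts L" by (auto simp: f_def g_def n intro!: lvec_lat_pts)
  have idx: "P i" if "P 0" "P 1" "P 2" "P 3" "\<And>j. P (j + 4)" for P and i :: nat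
  proof -
    consider "i = 0" | "i = 1" | "i = 2" | "i = 3" | "4 \<le> i" by linarith
    then show ?thesis
    proof cases
      case 5
      then show ?thesis using that(5)[of "i - 4"] by simp
    qed (use that in auto)
  qed
  have "achiral L"
  proof (rule achiral_of_involution[where \<phi> = \<phi> and e = "lvec [3, - 1, - 1, - 1]", OF sym dual_period])
    show "\<phi> (lc a x b y) = lc a (\<phi> x) b (\<phi> y)" for a x b y
      by (auto simp: \<phi>_def lc_def algebra_simps)
    show "\<phi> x \<in> rvec (fst L)" if "x \<in> rvec (fst L)" for x
      unfolding \<phi>_def using that fg by (intro lc_rvec) (auto dest: lat_ptsD)
    show "\<phi> x \<in> lat_pts L" if "x \<in> lat_pts L" for x
      unfolding \<phi>_def using that fg lat_ptsD(1)[OF that] by (intro lc_lat_pts Ints_add Ints_mult) auto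
    show "bil L (\<phi> x) (\<phi> y) = bil L x y" for x y
      by (simp add: bil sh \<phi> algebra_simps)
    show "\<phi> (\<phi> x) = x" for x
    proof
      fix i show "\<phi> (\<phi> x) i = x i" by (rule idx) (simp_all add: \<phi>)
    qed
    show "\<phi> (lvec [3, - 1, - 1, - 1]) = lvec [3, - 1, - 1, - 1]" by (simp add: \<phi>_def lc_def)
    show "lvec [3, - 1, - 1, - 1] \<in> rvec (fst L)" by (simp add: lvec_rvec n)
    have "shift 4 (lvec [3, - 1, - 1, - 1]) = (\<lambda>i. 0)" by (auto simp: shift_def lvec_def)
    then show "bil L (lvec [3, - 1, - 1, - 1]) (lvec [3, - 1, - 1, - 1]) < 0" by (simp add: bil)
    show "\<exists>k::int. bil L x x = 4 * of_int k" if x: "x \<in> lat_pts L" and anti: "\<phi> x = (\<lambda>i. - x i)" for x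
    proof -
      have a: "\<phi> x i = - x i" for i using anti by simp
      have "x (i + 4) = 0" for i using a[of "i + 4"] by (simp add: \<phi>)
      then have "shift 4 x = (\<lambda>i. 0)" by (auto simp: shift_def)
      then have "bil L x x = - 2 * x 0 * x 0 + 6 * x 1 * x 1 + 2 * x 2 * x 2 + 2 * x 3 * x 3"
        by (simp add: bil)
      moreover have x23: "x 2 = - x 0" "x 3 = - 2 * x 0 - 3 * x 1"
        using a[of 0] a[of 1] a[of 2] a[of 3] unfolding \<phi> by linarith+
      ultimately have "bil L x x = 8 * ((x 0)\<^sup>2 + 3 * x 0 * x 1 + 3 * (x 1)\<^sup>2)"
        unfolding x23 by (simp add: power2_eq_square algebra_simps)
      moreover obtain p q :: int where "x 0 = of_int p" "x 1 = of_int q"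
        using x by (metis Ints_cases lat_ptsD(1))
      ultimately show ?thesis by (intro exI[of _ "2 * (p\<^sup>2 + 3 * p * q + 3 * q\<^sup>2)"]) simp
    qed
    show "(\<lambda>i. \<phi> x i + x i) \<in> lat_pts L" if x: "x \<in> three_primary L" for x
    proof -
      have q: "special L (\<lambda>i. 3 * x i)" by (rule three_primary_spec[OF dual_period x])
      note q1 = special_osum[OF q[unfolded L]]
      note q2 = special_osum[OF q1(2)]
      have I: "x 0 \<in> \<int>" "3 * x 1 \<in> \<int>" "x (i + 2) \<in> \<int>" for i
      proof -
        show "x 0 \<in> \<int>" using special_dd_1[OF dual_period_latmA1 q1(1), of 0] by (simp add: trunc_def)
        show "3 * x 1 \<in> \<int>" using lat_ptsD(1)[OF specialD(1)[OF q]] .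
        have "dual_period 1 (osum latA1 (osum latA1 M))" using M by (intro dual_period_osum dual_period_latA1)
        from special_dd_1[OF this q2(2), of i] show "x (i + 2) \<in> \<int>" by (simp add: shift_def)
      qed
      have I': "x 2 \<in> \<int>" "x 3 \<in> \<int>" "x (i + 4) \<in> \<int>" for i
        using I(3)[of 0] I(3)[of 1] I(3)[of "i + 2"] by (simp_all add: numeral_eq_Suc)
      have "\<phi> x i + x i \<in> \<int>" for i
      proof (rule idx)
        \<comment> \<open>The coordinate x1 is the only one that can have denominator 3, and it
          enters these sums only with coefficients divisible by 3.\<close>
        have "\<phi> x 0 + x 0 = 4 * x 0 + 3 * x 1 + 2 * x 2 + x 3"
          "\<phi> x 1 + x 1 = - x 0 - x 2" "\<phi> x 2 + x 2 = - 2 * x 0 - 3 * x 1 - x 3"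
          "\<phi> x 3 + x 3 = - x 0 - x 2" "\<And>j. \<phi> x (j + 4) + x (j + 4) = 2 * x (j + 4)"
          by (simp_all add: \<phi>)
        then show "\<phi> x 0 + x 0 \<in> \<int>" "\<phi> x 1 + x 1 \<in> \<int>" "\<phi> x 2 + x 2 \<in> \<int>" "\<phi> x 3 + x 3 \<in> \<int>"
          "\<And>j. \<phi> x (j + 4) + x (j + 4) \<in> \<int>"
          using I I' by (auto intro!: Ints_add Ints_diff Ints_mult)
      qed
      moreover have "\<phi> x \<in> rvec (fst L)" "x \<in> rvec (fst L)"
        using x fg unfolding \<phi>_def
        by (auto simp: three_primary_def dual_pts_def intro!: lc_rvec dest: lat_ptsD)
      ultimately show ?thesis by (auto simp: lat_pts_def rvec_def)
    qed
  qed
  then show ?thesis by (simp add: L_def)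
qed

lemma orth_frame_E8_rep: "orth_frame (4 + t) (osum latE8 (rep t latA1))"
  by (rule orth_frame_osum[OF orth_frame_latE8 orth_frame_rep])

lemma orth_frame_E8_E8: "orth_frame 8 (osum latE8 (osum latE8 M))"
proof -
  have "orth_frame 0 M" by (simp add: orth_frame_def)
  from orth_frame_osum[OF orth_frame_latE8 orth_frame_osum[OF orth_frame_latE8 this]] show ?thesis by simp
qed

lemmas Y_rules = sym_form_osum sym_form_rep sym_form_summands dual_period_osum dual_period_rep dual_period_latA1 dual_period_latD4 dual_period_latE8

text \<open>Each bound on t is what is missing to five orthogonal 2-roots: D4 supplies three, E8
  four, every A1 one. D4 + E8 and 2E8 already suffice.\<close>

lemma achiral_rows:
  "5 \<le> t \<Longrightarrow> achiral (row2 t)"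
  "5 \<le> t \<Longrightarrow> achiral (row4 t)"
  "2 \<le> t \<Longrightarrow> achiral (row6 t)"
  "1 \<le> t \<Longrightarrow> achiral (row8 t)"
  "1 \<le> t \<Longrightarrow> achiral (row10 t)"
  "1 \<le> t \<Longrightarrow> achiral (row12 t)"
  "achiral (row14 t)"
  "achiral (row16 t)"
  "achiral (row18 t)"
  "achiral (row20 t)"
proof -
  show "achiral (row2 t)" "achiral (row4 t)" if "5 \<le> t"
    unfolding row2_def row4_def
    by (intro achiral_mA1_A2 achiral_U_A2 Y_rules orth_frame_mono[OF orth_frame_rep that])+
  show "achiral (row6 t)" if "2 \<le> t"
    unfolding row6_def
    by (intro achiral_U_A2 Y_rules orth_frame_mono[OF orth_frame_osum[OF orth_frame_latD4 orth_frame_rep]]) (use that in simp)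
  show "achiral (row8 t)" "achiral (row10 t)" "achiral (row12 t)" if "1 \<le> t"
    unfolding row8_def row10_def row12_def
    by (intro achiral_mA1_6 achiral_mA1_A2 achiral_U_A2 Y_rules orth_frame_mono[OF orth_frame_E8_rep], use that in simp)+
  show "achiral (row14 t)"
    unfolding row14_def
    by (intro achiral_U_A2 Y_rules orth_frame_mono[OF orth_frame_osum[OF orth_frame_latD4 orth_frame_E8_rep]]) simp
  show "achiral (row16 t)" "achiral (row18 t)" "achiral (row20 t)"
    unfolding row16_def row18_def row20_def
    by (intro achiral_mA1_6 achiral_mA1_A2 achiral_U_A2 Y_rules orth_frame_mono[OF orth_frame_E8_E8], simp)+
qed

subsection \<open>Lorentzian lattices\<close>

text \<open>A negative product means lying in the same half of the cone. Were the signs of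
  \<open>z\<close> against \<open>x\<close> and \<open>y\<close> different, a combination of
  \<open>x\<close> and \<open>y\<close> orthogonal to \<open>z\<close> would be negative, although
  \<open>z\<close> is not positive. Isotropic \<open>z\<close> is allowed, as the cusps
  require.\<close>

lemma lorentzian_half:
  assumes "lorentzian L" "sym_form L" "bil L x x < 0" "bil L y y < 0" "bil L x y < 0" "bil L z z \<le> 0" "bil L z x < 0"
  shows "bil L z y < 0"
proof (rule ccontr)
  assume "\<not> bil L z y < 0"
  define a b where "a = bil L z x" and "b = bil L z y"
  have ab: "a < 0" "b \<ge> 0" using assms \<open>\<not> bil L z y < 0\<close> by (auto simp: a_def b_def)
  define m where "m = lc b x (- a) y"
  have mz: "bil L m z = 0"
    using sym_formD[OF assms(2), of x z] sym_formD[OF assms(2), of y z] by (simp add: m_def bil_lc_left a_def b_def)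
  have "bil L m m = b\<^sup>2 * bil L x x + 2 * (- a * b) * bil L x y + a\<^sup>2 * bil L y y"
    using sym_formD[OF assms(2), of y x]
    by (simp add: m_def bil_lc_left bil_lc_right power2_eq_square algebra_simps)
  moreover have "b\<^sup>2 * bil L x x \<le> 0" using assms by (simp add: mult_le_0_iff)
  moreover have "2 * (- a * b) * bil L x y \<le> 0"
    using ab assms by (intro mult_nonneg_nonpos) (auto simp: mult_le_0_iff)
  moreover have "a\<^sup>2 * bil L y y < 0" using ab assms by (intro mult_pos_neg) auto
  ultimately have "bil L m m < 0" by linarith
  then have "bil L z z \<ge> 0 \<and> (bil L z z = 0 \<longrightarrow> (\<forall>i<fst L. z i = 0))"
    using assms(1) mz unfolding lorentzian_def by blast
  then have "\<forall>i<fst L. z i = 0" using assms(6) by simp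
  then have "bil L z x = bil L (\<lambda>i. 0) x" by (intro bil_cong) auto
  then show False using assms(7) by simp
qed

lemma lorentzian_cauchy:
  assumes "lorentzian L" "sym_form L" "bil L x x < 0" "bil L x a = 0" "bil L x b = 0"
  shows "(bil L a b)\<^sup>2 \<le> bil L a a * bil L b b"
proof -
  have pos: "bil L y y \<ge> 0 \<and> (bil L y y = 0 \<longrightarrow> (\<forall>i<fst L. y i = 0))" if "bil L x y = 0" for y
    using assms(1,3) that unfolding lorentzian_def by blast
  let ?v = "lc (bil L b b) a (- bil L a b) b"
  have "bil L x ?v = 0" using assms by (simp add: bil_lc_right)
  then have "0 \<le> bil L ?v ?v" using pos by blast
  also have "bil L ?v ?v = bil L b b * (bil L a a * bil L b b - (bil L a b)\<^sup>2)"
    using sym_formD[OF assms(2), of b a]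
    by (simp add: bil_lc_left bil_lc_right algebra_simps power2_eq_square)
  finally have *: "0 \<le> bil L b b * (bil L a a * bil L b b - (bil L a b)\<^sup>2)" .
  show ?thesis
  proof (cases "bil L b b = 0")
    case True
    then have "\<forall>i<fst L. b i = 0" using pos assms(5) by blast
    then have "bil L a b = bil L a (\<lambda>i. 0)" by (intro bil_cong) auto
    then show ?thesis using True by simp
  next
    case False
    then have "bil L b b > 0" using pos[OF assms(5)] by simp
    then show ?thesis using * by (simp add: zero_le_mult_iff)
  qed
qed

subsection \<open>Mirrors of 6-roots separating two points\<close>

definition roots6 :: "lat \<Rightarrow> (nat \<Rightarrow> real) set" where
  "roots6 L = {u. special L u \<and> bil L u u = 6}"

text \<open>Both u and -u are 6-roots of the same mirror; the prescribed signs select one of them,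
  so the cardinality counts mirrors.\<close>

definition separating :: "lat \<Rightarrow> (nat \<Rightarrow> real) \<Rightarrow> (nat \<Rightarrow> real) \<Rightarrow> (nat \<Rightarrow> real) set" where
  "separating L x y = {u \<in> roots6 L. bil L x u > 0 \<and> bil L y u < 0}"

text \<open>Only mirrors of 6-roots are to be avoided; the point may lie on a 2-mirror.\<close>

definition off_mirrors :: "lat \<Rightarrow> (nat \<Rightarrow> real) \<Rightarrow> bool" where
  "off_mirrors L x \<longleftrightarrow> bil L x x < 0 \<and> (\<forall>u\<in>roots6 L. bil L x u \<noteq> 0)"

text \<open>Cauchy-Schwarz for the projections of \<open>u\<close> and \<open>y\<close> to the
  complement of \<open>x\<close>. Since \<open>u\<close> has opposite signs at \<open>x\<close> and
  \<open>y\<close>, the two terms of the product of the projections add up, so one of them may be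
  dropped and a bound on x.u remains.\<close>

lemma separating_bound:
  assumes "lorentzian L" "sym_form L" "bil L x x < 0" "bil L y y < 0" "bil L x y < 0" "u \<in> separating L x y"
  shows "(bil L x u)\<^sup>2 \<le> 6 * (bil L x y)\<^sup>2 / - bil L y y"
proof -
  define X Y c s r where "X = - bil L x x" and "Y = - bil L y y" and "c = - bil L x y"
    and "s = bil L x u" and "r = - bil L y u"
  have p: "X > 0" "Y > 0" "c > 0" "s > 0" "r > 0" and u6: "bil L u u = 6"
    using assms by (auto simp: X_def Y_def c_def s_def r_def separating_def roots6_def)
  note sy = sym_formD[OF assms(2), of y x] sym_formD[OF assms(2), of u x] sym_formD[OF assms(2), of u y]
  let ?u = "lc 1 u (s / X) x" and ?y = "lc 1 y (- c / X) x"
  have "bil L x ?u = 0" "bil L x ?y = 0"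
    using p by (simp_all add: bil_lc_right s_def c_def X_def field_simps)
  then have "(bil L ?u ?y)\<^sup>2 \<le> bil L ?u ?u * bil L ?y ?y"
    by (rule lorentzian_cauchy[OF assms(1-3)])
  moreover have b: "bil L ?u ?y = - (r + s * c / X)"
    using p by (simp add: bil_lc_left bil_lc_right sy s_def r_def c_def X_def field_simps)
  moreover have "bil L ?u ?u = 6 + s\<^sup>2 / X"
    using p by (simp add: bil_lc_left bil_lc_right sy s_def u6 X_def field_simps power2_eq_square)
  moreover have "bil L ?y ?y = c\<^sup>2 / X - Y"
    using p by (simp add: bil_lc_left bil_lc_right sy c_def Y_def X_def field_simps power2_eq_square)
  ultimately have "(r + s * c / X)\<^sup>2 \<le> (6 + s\<^sup>2 / X) * (c\<^sup>2 / X - Y)"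
    by (simp only: b power2_minus)
  moreover have "(s * c / X)\<^sup>2 \<le> (r + s * c / X)\<^sup>2" using p by (intro power_mono) auto
  ultimately have "(s * c / X)\<^sup>2 \<le> (6 + s\<^sup>2 / X) * (c\<^sup>2 / X - Y)" by linarith
  then have "s\<^sup>2 * Y / X \<le> 6 * (c\<^sup>2 / X - Y)"
    by (simp add: power2_eq_square algebra_simps)
  also have "\<dots> \<le> 6 * c\<^sup>2 / X" using p by simp
  finally have "s\<^sup>2 * Y \<le> 6 * c\<^sup>2" using p by (simp add: divide_le_cancel)
  then have "s\<^sup>2 \<le> 6 * c\<^sup>2 / Y" using p by (simp add: pos_le_divide_eq)
  then show ?thesis unfolding s_def c_def Y_def power2_minus .
qed

text \<open>Once x.u is bounded, the projection of u to the positive complement of \<open>x\<close>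
  has bounded norm; pairing with the dual vectors then bounds every coordinate, and the coordinates
  are integers.\<close>

lemma finite_sep:
  assumes "lorentzian L" "sym_form L" "dual_period 3 L" "bil L x x < 0" "bil L y y < 0" "bil L x y < 0"
  shows "finite (separating L x y)"
proof -
  define X where "X = - bil L x x"
  define S where "S = 6 * (bil L x y)\<^sup>2 / - bil L y y"
  have X: "X > 0" using assms by (simp add: X_def)
  have "\<exists>C\<ge>0. \<forall>u\<in>separating L x y. \<bar>u i\<bar> \<le> C" if i: "i < fst L" for i
  proof -
    obtain d where d: "\<forall>u. bil L u d = 3 * u i" using assms(3) i unfolding dual_period_def by force
    let ?d = "lc 1 d (bil L x d / X) x"
    define C where "C = sqrt ((6 + S / X) * bil L ?d ?d) + sqrt S * \<bar>bil L x d\<bar> / X"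
    have xd: "bil L x ?d = 0" using X by (simp add: bil_lc_right X_def field_simps)
    have d0: "bil L ?d ?d \<ge> 0" using assms(1,4) xd unfolding lorentzian_def by blast
    have "\<bar>u i\<bar> \<le> \<bar>C\<bar>" if u: "u \<in> separating L x y" for u
    proof -
      define s where "s = bil L x u"
      have s: "s > 0" "bil L u u = 6" using u by (auto simp: s_def separating_def roots6_def)
      have s2: "s\<^sup>2 \<le> S" unfolding s_def S_def by (rule separating_bound[OF assms(1,2,4-6) u])
      let ?u = "lc 1 u (s / X) x"
      have ux: "bil L u x = s" unfolding s_def by (rule sym_formD[OF assms(2)])
      have "bil L x ?u = 0" using X by (simp add: bil_lc_right s_def X_def field_simps)
      then have "(bil L ?u ?d)\<^sup>2 \<le> bil L ?u ?u * bil L ?d ?d"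
        using xd by (intro lorentzian_cauchy[OF assms(1,2,4)])
      moreover have "bil L ?u ?d = 3 * u i + s * bil L x d / X"
        using X d by (simp add: bil_lc_left bil_lc_right ux X_def field_simps)
      moreover have "bil L ?u ?u = 6 + s\<^sup>2 / X"
        using X s by (simp add: bil_lc_left bil_lc_right ux s_def[symmetric] X_def field_simps power2_eq_square)
      moreover have "(6 + s\<^sup>2 / X) * bil L ?d ?d \<le> (6 + S / X) * bil L ?d ?d"
        using s2 X d0 by (intro mult_right_mono) (auto simp: divide_right_mono)
      ultimately have "(3 * u i + s * bil L x d / X)\<^sup>2 \<le> (6 + S / X) * bil L ?d ?d" by simp
      then have "\<bar>3 * u i + s * bil L x d / X\<bar> \<le> sqrt ((6 + S / X) * bil L ?d ?d)"
        by (metis real_sqrt_le_iff real_sqrt_abs)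
      moreover have "\<bar>s * bil L x d / X\<bar> \<le> sqrt S * \<bar>bil L x d\<bar> / X"
      proof -
        have "s \<le> sqrt S" using s2 s by (intro real_le_rsqrt)
        then show ?thesis using s X by (simp add: abs_mult divide_right_mono mult_right_mono)
      qed
      ultimately have "\<bar>3 * u i\<bar> \<le> C" unfolding C_def
        using abs_triangle_ineq4[of "3 * u i + s * bil L x d / X" "s * bil L x d / X"] by simp
      then show ?thesis by linarith
    qed
    then show ?thesis by (intro exI[of _ "\<bar>C\<bar>"]) auto
  qed
  then obtain C where C: "\<And>i. i < fst L \<Longrightarrow> C i \<ge> 0"
    "\<And>i u. i < fst L \<Longrightarrow> u \<in> separating L x y \<Longrightarrow> \<bar>u i\<bar> \<le> C i" by metis
  define B where "B = (\<Sum>i<fst L. C i)"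
  have CB: "C i \<le> B" if "i < fst L" for i
    unfolding B_def using that C(1) by (intro member_le_sum) auto
  have "separating L x y \<subseteq> {f. \<forall>i. (i \<in> {..<fst L} \<longrightarrow> f i \<in> {z \<in> \<int>. - B \<le> z \<and> z \<le> B}) \<and> (i \<notin> {..<fst L} \<longrightarrow> f i = 0)}"
  proof
    fix u assume u: "u \<in> separating L x y"
    then have ul: "u \<in> lat_pts L" by (auto simp: separating_def roots6_def dest: specialD)
    have "u i \<in> \<int>" for i using lat_ptsD(1)[OF ul] .
    moreover have "u i = 0" if "i \<ge> fst L" for i using ul that by (auto simp: lat_pts_def rvec_def)
    moreover have "\<bar>u i\<bar> \<le> B" if "i < fst L" for i using C(2)[OF that u] CB[OF that] by linarith
    ultimately show "u \<in> {f. \<forall>i. (i \<in> {..<fst L} \<longrightarrow> f i \<in> {z \<in> \<int>. - B \<le> z \<and> z \<le> B}) \<and> (i \<notin> {..<fst L} \<longrightarrow> f i = 0)}"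
      by (auto simp: abs_le_iff) (metis minus_le_iff)
  qed
  moreover have "finite \<dots>" by (intro finite_set_of_finite_funs finite_int_segment) simp
  ultimately show ?thesis by (rule finite_subset)
qed

lemma even_card_involution:
  assumes "finite A" "\<And>x. x \<in> A \<Longrightarrow> f x \<in> A" "\<And>x. x \<in> A \<Longrightarrow> f (f x) = x" "\<And>x. x \<in> A \<Longrightarrow> f x \<noteq> x"
  shows "even (card A)"
  using assms
proof (induction A rule: finite_psubset_induct)
  case (psubset A)
  show ?case
  proof (cases "A = {}")
    case False
    then obtain a where a: "a \<in> A" by blast
    let ?B = "A - {a, f a}"
    have fa: "f a \<in> A" "f a \<noteq> a" using psubset.prems a by auto
    have "even (card ?B)"
    proof (rule psubset.IH)
      show "?B \<subset> A" using a by auto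
      show "f x \<in> ?B" if x: "x \<in> ?B" for x
      proof -
        have "f x \<noteq> a" "f x \<noteq> f a" using x psubset.prems(2) a by (metis DiffE insertI1 insertI2)+
        then show ?thesis using x psubset.prems(1) by auto
      qed
    qed (use psubset.prems in auto)
    moreover have "card A = card ?B + 2"
    proof -
      have "card ?B = card A - card {a, f a}" using a fa by (intro card_Diff_subset) auto
      moreover have "card {a, f a} = 2" using fa by (auto simp: card_insert_if)
      moreover have "card {a, f a} \<le> card A" using a fa psubset.hyps by (intro card_mono) auto
      ultimately show ?thesis by linarith
    qed
    ultimately show ?thesis by simp
  qed simp
qed

lemma neg_R6: "u \<in> roots6 L \<Longrightarrow> (\<lambda>i. - u i) \<in> roots6 L"
proof -
  assume u: "u \<in> roots6 L"
  then have s: "special L u" by (simp add: roots6_def)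
  have "special L (\<lambda>i. - u i)"
  proof (rule specialI)
    show "(\<lambda>i. - u i) \<in> lat_pts L" using specialD(1)[OF s] by (auto simp: lat_pts_def rvec_def)
    fix w assume "w \<in> lat_pts L"
    then have "- (bil L u w / 3) \<in> \<int>" using specialD(2)[OF s] by (intro Ints_minus)
    then show "bil L (\<lambda>i. - u i) w / 3 \<in> \<int>" by (simp add: bil_minus_left)
  qed
  then show ?thesis using u by (simp add: roots6_def bil_minus_left bil_minus_right)
qed

lemma separating_sym_card: "card (separating L y x) = card (separating L x y)"
proof (rule bij_betw_same_card)
  show "bij_betw (\<lambda>u i. - u i) (separating L y x) (separating L x y)"
    by (rule bij_betw_byWitness[where f' = "\<lambda>u i. - u i"])
      (auto simp: separating_def bil_minus_right intro: neg_R6)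
qed

text \<open>Mirrors that cut \<open>y\<close> off from both \<open>x\<close> and \<open>z\<close>
  contribute to both counts on the right: they are the sets ?C and ?D, matched by u -> -u, and
  cancel modulo 2.\<close>

lemma separating_parity_add:
  assumes "off_mirrors L x" "off_mirrors L y" "off_mirrors L z" "finite (separating L x y)" "finite (separating L y z)" "finite (separating L x z)"
  shows "even (card (separating L x z)) \<longleftrightarrow> (even (card (separating L x y)) \<longleftrightarrow> even (card (separating L y z)))"
proof -
  let ?A = "{u \<in> roots6 L. bil L x u > 0 \<and> bil L y u > 0 \<and> bil L z u < 0}"
  let ?B = "{u \<in> roots6 L. bil L x u > 0 \<and> bil L y u < 0 \<and> bil L z u < 0}"
  let ?C = "{u \<in> roots6 L. bil L x u > 0 \<and> bil L y u < 0 \<and> bil L z u > 0}"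
  let ?D = "{u \<in> roots6 L. bil L x u < 0 \<and> bil L y u > 0 \<and> bil L z u < 0}"
  have nz: "bil L x u < 0 \<or> bil L x u > 0" "bil L y u < 0 \<or> bil L y u > 0" "bil L z u < 0 \<or> bil L z u > 0"
    if "u \<in> roots6 L" for u using assms(1-3) that by (auto simp: off_mirrors_def)
  have eq: "separating L x z = ?A \<union> ?B" "separating L x y = ?B \<union> ?C" "separating L y z = ?A \<union> ?D"
    using nz by (auto simp: separating_def)
  have fin: "finite ?A" "finite ?B" "finite ?C" "finite ?D"
    using assms(4-6) unfolding eq by auto
  have CD: "card ?C = card ?D"
    by (rule bij_betw_same_card[of "\<lambda>u i. - u i"],
        rule bij_betw_byWitness[where f' = "\<lambda>u i. - u i"])
      (auto simp: bil_minus_right intro: neg_R6)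
  have "card (separating L x z) = card ?A + card ?B" unfolding eq using fin by (intro card_Un_disjoint) auto
  moreover have "card (separating L x y) = card ?B + card ?C" unfolding eq using fin by (intro card_Un_disjoint) auto
  moreover have "card (separating L y z) = card ?A + card ?D" unfolding eq using fin by (intro card_Un_disjoint) auto
  ultimately show ?thesis using CD by auto
qed

subsection \<open>Reflections and parity\<close>

definition wall_root :: "lat \<Rightarrow> (nat \<Rightarrow> real) \<Rightarrow> bool" where
  "wall_root L v \<longleftrightarrow> v \<in> lat_pts L \<and> (bil L v v = 2 \<or>
     (bil L v v = 4 \<and> (\<forall>w\<in>lat_pts L. bil L w v / 2 \<in> \<int>)) \<or> (v \<in> roots6 L \<and> reverses3 L v))"

lemma wall_root_norm: "wall_root L v \<Longrightarrow> bil L v v = 2 \<or> bil L v v = 4 \<or> bil L v v = 6"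
  by (auto simp: wall_root_def roots6_def)

lemma bil_refl: "sym_form L \<Longrightarrow> bil L v v \<noteq> 0 \<Longrightarrow> bil L (refl L v x) (refl L v y) = bil L x y"
  using sym_formD[of L v y] by (simp add: refl_lc bil_lc_left bil_lc_right field_simps)

lemma bil_refl_self: "bil L v v \<noteq> 0 \<Longrightarrow> bil L (refl L v x) v = - bil L x v"
  by (simp add: refl_lc bil_lc_left)

lemma refl_refl: "bil L v v \<noteq> 0 \<Longrightarrow> refl L v (refl L v x) = x"
  unfolding refl_def[of L v "refl L v x"] by (auto simp: bil_refl_self) (auto simp: refl_def)

lemma bil_refl_left: "sym_form L \<Longrightarrow> bil L v v \<noteq> 0 \<Longrightarrow> bil L (refl L v x) y = bil L x (refl L v y)"
  using bil_refl[of L v x "refl L v y"] by (simp add: refl_refl)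

lemma refl_coeff:
  assumes "sym_form L" "wall_root L v" "x \<in> lat_pts L"
  shows "2 * bil L x v / bil L v v \<in> \<int>"
proof -
  have v: "v \<in> lat_pts L" using assms(2) by (simp add: wall_root_def)
  consider "bil L v v = 2" | "bil L v v = 4" "bil L x v / 2 \<in> \<int>" | "v \<in> roots6 L"
    using assms by (auto simp: wall_root_def)
  then show ?thesis
  proof cases
    case 3
    then have "bil L v x / 3 \<in> \<int>" using assms(3) by (auto simp: roots6_def dest: specialD)
    then show ?thesis using 3 sym_formD[OF assms(1), of x v] by (simp add: roots6_def)
  qed (use bil_Ints[OF assms(3) v] in simp_all)
qed

lemma refl_lat_pts:
  assumes "sym_form L" "wall_root L v" "x \<in> lat_pts L"
  shows "refl L v x \<in> lat_pts L"
  unfolding refl_lc using refl_coeff[OF assms] assms by (intro lc_lat_pts) (auto simp: wall_root_def)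

lemma refl_spec:
  assumes "sym_form L" "wall_root L v" "special L x"
  shows "special L (refl L v x)"
proof (rule specialI)
  show "refl L v x \<in> lat_pts L" using assms specialD by (intro refl_lat_pts) auto
  fix w assume "w \<in> lat_pts L"
  then have "bil L x (refl L v w) / 3 \<in> \<int>" by (intro specialD(2)[OF assms(3)] refl_lat_pts[OF assms(1,2)])
  then show "bil L (refl L v x) w / 3 \<in> \<int>"
    using wall_root_norm[OF assms(2)] assms(1) by (subst bil_refl_left) auto
qed

lemma refl_R6: "sym_form L \<Longrightarrow> wall_root L v \<Longrightarrow> u \<in> roots6 L \<Longrightarrow> refl L v u \<in> roots6 L"
  using wall_root_norm[of L v] by (auto simp: roots6_def refl_spec bil_refl)

text \<open>The map u -> -refl u is an involution on the mirrors between \<open>q\<close> and its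
  image. A fixed u is proportional to \<open>v\<close> with (u.v)^2 = 6 v^2, which would be 12 or
  24, not a square, for norms 2 and 4. For norm 6 there is exactly one fixed point, \<open>v\<close>
  or its negative.\<close>

lemma separating_refl_parity:
  assumes "sym_form L" "wall_root L v" "bil L q v \<noteq> 0" "finite (separating L q (refl L v q))"
  shows "even (card (separating L q (refl L v q))) \<longleftrightarrow> bil L v v \<noteq> 6"
proof -
  let ?T = "separating L q (refl L v q)"
  have v0: "bil L v v \<noteq> 0" and vp: "bil L v v > 0" using wall_root_norm[OF assms(2)] by auto
  have v: "v \<in> lat_pts L" using assms(2) by (simp add: wall_root_def)
  define f where "f u = (\<lambda>i. - refl L v u i)" for u
  have fT: "f u \<in> ?T" if "u \<in> ?T" for u
  proof -
    have u: "u \<in> roots6 L" "bil L q u > 0" "bil L (refl L v q) u < 0" using that by (auto simp: separating_def)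
    have "f u \<in> roots6 L" unfolding f_def using u assms by (intro neg_R6 refl_R6)
    moreover have "bil L q (f u) > 0"
      using u(3) bil_refl_left[OF assms(1) v0, of q u] by (simp add: f_def bil_minus_right)
    moreover have "bil L (refl L v q) (f u) < 0"
      using u(2) bil_refl[OF assms(1) v0, of q u] by (simp add: f_def bil_minus_right)
    ultimately show ?thesis by (simp add: separating_def)
  qed
  have f_lc: "f u = lc (- 1) u (2 * bil L u v / bil L v v) v" for u
    by (auto simp: f_def refl_def lc_def)
  have ff: "f (f u) = u" for u
    using v0 by (auto simp: f_lc bil_lc_left) (auto simp: lc_def)
  have fixd: "bil L u v * bil L u v = 6 * bil L v v \<and> u = (\<lambda>i. bil L u v / bil L v v * v i)"
    if "u \<in> ?T" "f u = u" for u
  proof -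
    have uu: "u i = bil L u v / bil L v v * v i" for i
      using fun_cong[OF that(2), of i] by (simp add: f_lc lc_def)
    then have eq: "u = (\<lambda>i. bil L u v / bil L v v * v i)" by blast
    have "6 = bil L u u" using that(1) by (simp add: separating_def roots6_def)
    also have "\<dots> = bil L u v / bil L v v * bil L u v"
      by (subst (2) eq) (rule bil_scale_right)
    finally show ?thesis using eq v0 by (simp add: field_simps)
  qed
  show ?thesis
  proof (cases "bil L v v = 6")
    case False
    have "f u \<noteq> u" if u: "u \<in> ?T" for u
    proof
      assume "f u = u"
      then have e: "bil L u v * bil L u v = 6 * bil L v v" using fixd u by blast
      have "u \<in> lat_pts L" using u by (auto simp: separating_def roots6_def dest: specialD)
      then obtain k :: int where k: "bil L u v = of_int k" using bil_Ints[OF _ v] Ints_cases by metis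
      have "k * k = 12 \<or> k * k = 24"
      proof -
        have "real_of_int (k * k) = real_of_int 12 \<or> real_of_int (k * k) = real_of_int 24"
          using e k wall_root_norm[OF assms(2)] False by auto
        then show ?thesis by (simp only: of_int_eq_iff)
      qed
      moreover have "k * k \<le> 9 \<or> k * k = 16 \<or> 25 \<le> k * k"
      proof -
        consider "\<bar>k\<bar> \<le> 3" | "\<bar>k\<bar> = 4" | "5 \<le> \<bar>k\<bar>" by linarith
        then show ?thesis
        proof cases
          case 1
          then have "\<bar>k\<bar> * \<bar>k\<bar> \<le> 3 * 3" by (intro mult_mono) auto
          then show ?thesis by simp
        next
          case 2
          then have "\<bar>k\<bar> * \<bar>k\<bar> = 4 * 4" by (simp only:)
          then show ?thesis by (simp only: abs_mult_self_eq) simp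
        next
          case 3
          then have "5 * 5 \<le> \<bar>k\<bar> * \<bar>k\<bar>" by (intro mult_mono) auto
          then show ?thesis by simp
        qed
      qed
      ultimately show False by linarith
    qed
    then have "even (card ?T)" using fT ff assms(4) by (intro even_card_involution[of _ f])
    then show ?thesis using False by simp
  next
    case True
    define a where "a = (if bil L q v > 0 then v else (\<lambda>i. - v i))"
    have vR: "v \<in> roots6 L" using assms(2) True by (auto simp: wall_root_def)
    have rqv: "bil L (refl L v q) v = - bil L q v" using v0 by (rule bil_refl_self)
    have aT: "a \<in> ?T"
      using vR neg_R6[OF vR] assms(3) rqv by (auto simp: a_def separating_def bil_minus_right)
    have only: "u = a" if "u \<in> ?T" "f u = u" for u
    proof -
      have e: "bil L u v * bil L u v = 36" "u = (\<lambda>i. bil L u v / 6 * v i)"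
        using fixd[OF that] True by auto
      have "bil L u v = 6 \<or> bil L u v = - 6"
      proof -
        have "(bil L u v - 6) * (bil L u v + 6) = 0" using e(1) by (simp add: algebra_simps)
        then show ?thesis by auto
      qed
      then have "u = v \<or> u = (\<lambda>i. - v i)" using e(2) by auto
      moreover have "bil L q u > 0" "bil L q a > 0" using that(1) aT by (auto simp: separating_def)
      moreover have "a = v \<or> a = (\<lambda>i. - v i)" by (simp add: a_def)
      ultimately show ?thesis using bil_minus_right[of L q v] by (metis neg_0_less_iff_less less_asym)
    qed
    have fa: "f a = a" using v0 by (auto simp: a_def f_lc bil_minus_left lc_def)
    have "even (card (?T - {a}))"
    proof (rule even_card_involution[of _ f])
      show "f u \<in> ?T - {a}" if "u \<in> ?T - {a}" for u
      proof -
        have "f u \<noteq> a" using that ff[of u] fa by auto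
        then show ?thesis using that fT by blast
      qed
      show "f u \<noteq> u" if "u \<in> ?T - {a}" for u using that only by blast
    qed (use ff assms(4) in auto)
    moreover have "card ?T = Suc (card (?T - {a}))" using aT assms(4) by (metis card_Suc_Diff1)
    ultimately show ?thesis using True by simp
  qed
qed

text \<open>The parity of the number of 6-mirrors between p and q tells whether p/3 and q/3 have
  equal or opposite classes in discr_3.\<close>

definition coherent :: "lat \<Rightarrow> (nat \<Rightarrow> real) \<Rightarrow> (nat \<Rightarrow> real) \<Rightarrow> bool" where
  "coherent L p q \<longleftrightarrow> (even (card (separating L p q)) \<and> (\<lambda>i. (q i - p i) / 3) \<in> lat_pts L)
     \<or> (odd (card (separating L p q)) \<and> (\<lambda>i. (q i + p i) / 3) \<in> lat_pts L)"

text \<open>A 6-reflection changes both the parity and the sign of the class, a 2- or 4-reflection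
  neither, so coherence can be checked after the reflection.\<close>

lemma coherent_refl_step:
  assumes L: "lorentzian L" "sym_form L" "dual_period 3 L"
    and p: "off_mirrors L p" and q: "off_mirrors L q" "off_mirrors L (refl L v q)" "special L q" and pq: "bil L p q < 0"
    and v: "wall_root L v" and g: "coherent L p (refl L v q)"
  shows "coherent L p q"
proof (cases "bil L q v = 0")
  case True
  then have "refl L v q = q" by (auto simp: refl_def)
  then show ?thesis using g by simp
next
  case False
  let ?r = "refl L v q"
  have vp: "bil L v v > 0" using wall_root_norm[OF v] by auto
  have neg: "bil L q q < 0" "bil L ?r ?r < 0" "bil L p p < 0" using p q by (auto simp: off_mirrors_def)
  have "bil L q ?r = bil L q q - 2 * (bil L q v)\<^sup>2 / bil L v v"
    by (simp add: refl_lc bil_lc_right power2_eq_square)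
  moreover have "2 * (bil L q v)\<^sup>2 / bil L v v > 0" using False vp by simp
  ultimately have qr: "bil L q ?r < 0" using neg by linarith
  have qp: "bil L q p < 0" using pq sym_formD[OF L(2), of q p] by simp
  have rq: "bil L ?r q < 0" using qr sym_formD[OF L(2), of ?r q] by simp
  have "bil L ?r p < 0" by (rule lorentzian_half[OF L(1,2) neg(1,3) qp less_imp_le[OF neg(2)] rq])
  then have pr: "bil L p ?r < 0" using sym_formD[OF L(2), of ?r p] by simp
  have fin: "finite (separating L p ?r)" "finite (separating L ?r q)" "finite (separating L p q)" "finite (separating L q ?r)"
    using L neg qr rq pr pq by (auto intro!: finite_sep)
  have par: "even (card (separating L p q)) \<longleftrightarrow> (even (card (separating L p ?r)) \<longleftrightarrow> bil L v v \<noteq> 6)"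
    using separating_parity_add[OF p q(2,1) fin(1-3)] separating_refl_parity[OF L(2) v False fin(4)]
      separating_sym_card[of L ?r q] by simp
  show ?thesis
  proof (cases "bil L v v = 6")
    case True
    then have "(\<lambda>i. (2 * q i - bil L q v / 3 * v i) / 3) \<in> lat_pts L"
      using v q(3) by (auto simp: wall_root_def reverses3_def)
    moreover have "(\<lambda>i. (2 * q i - bil L q v / 3 * v i) / 3) = (\<lambda>i. (q i + ?r i) / 3)"
      using True by (auto simp: refl_def)
    ultimately have s: "(\<lambda>i. (q i + ?r i) / 3) \<in> lat_pts L" by simp
    have "(\<lambda>i. (q i + p i) / 3) = lc 1 (\<lambda>i. (q i + ?r i) / 3) (- 1) (\<lambda>i. (?r i - p i) / 3)"
      "(\<lambda>i. (q i - p i) / 3) = lc 1 (\<lambda>i. (q i + ?r i) / 3) (- 1) (\<lambda>i. (?r i + p i) / 3)"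
      by (auto simp: lc_def field_simps)
    then show ?thesis using g par True s unfolding coherent_def by (auto simp: lc_lat_pts)
  next
    case False
    have "bil L q v / 3 \<in> \<int>" using q(3) v by (auto simp: wall_root_def dest: specialD)
    moreover have "bil L v v = 4 \<longrightarrow> bil L q v / 2 \<in> \<int>"
      using v specialD(1)[OF q(3)] by (auto simp: wall_root_def roots6_def)
    ultimately have c: "2 * bil L q v / bil L v v / 3 \<in> \<int>"
    proof -
      assume a: "bil L q v / 3 \<in> \<int>" "bil L v v = 4 \<longrightarrow> bil L q v / 2 \<in> \<int>"
      show ?thesis
      proof (cases "bil L v v = 4")
        case True
        \<comment> \<open>The coefficient to be shown integral is (q.v)/6, and 1/6 = 1/2 -
          1/3.\<close>
        then have "bil L q v / 2 - bil L q v / 3 \<in> \<int>" using a by (intro Ints_diff) auto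
        then show ?thesis using True by (simp add: field_simps)
      next
        case False
        then have "bil L v v = 2" using wall_root_norm[OF v] \<open>bil L v v \<noteq> 6\<close> by auto
        then show ?thesis using a by simp
      qed
    qed
    have "(\<lambda>i. (q i - ?r i) / 3) = (\<lambda>i. (2 * bil L q v / bil L v v / 3) * v i)"
      by (auto simp: refl_def)
    then have s: "(\<lambda>i. (q i - ?r i) / 3) \<in> lat_pts L"
      using lat_pts_scale[OF _ c] v by (auto simp: wall_root_def)
    have "(\<lambda>i. (q i - p i) / 3) = lc 1 (\<lambda>i. (q i - ?r i) / 3) 1 (\<lambda>i. (?r i - p i) / 3)"
      "(\<lambda>i. (q i + p i) / 3) = lc 1 (\<lambda>i. (q i - ?r i) / 3) 1 (\<lambda>i. (?r i + p i) / 3)"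
      by (auto simp: lc_def field_simps)
    then show ?thesis using g par False s unfolding coherent_def by (auto simp: lc_lat_pts)
  qed
qed

subsection \<open>Norms of special vectors\<close>

text \<open>The components of a special vector in \<open>X\<close> and \<open>Y\<close> are
  divisible by 3, so modulo 9 only its component in \<open>T\<close> contributes to the
  norm.\<close>

lemma special_norm_osum:
  assumes "dual_period 1 X" "dual_period 1 Y" "special (osum X (osum T Y)) w"
  obtains k :: int and w' where "special T w'" "bil (osum X (osum T Y)) w w = 9 * of_int k + bil T w' w'"
proof -
  let ?X = "trunc (fst X) w" and ?T = "trunc (fst T) (shift (fst X) w)" and ?Y = "shift (fst T) (shift (fst X) w)"
  have s: "special X ?X" "special T ?T" "special Y ?Y" using special_osum[OF assms(3)] special_osum by blast+
  have nine: "\<exists>k::int. bil L q q = 9 * of_int k" if "dual_period 1 L" "special L q" for L q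
  proof -
    define r where "r = (\<lambda>i. q i / 3)"
    have "r \<in> lat_pts L"
      using special_dd_1[OF that] specialD(1)[OF that(2)] by (auto simp: r_def lat_pts_def rvec_def)
    then obtain k :: int where k: "bil L r r = of_int k" using bil_Ints Ints_cases by metis
    have "q = (\<lambda>i. 3 * r i)" by (auto simp: r_def)
    then have "bil L q q = 9 * bil L r r" by (simp add: bil_scale_left bil_scale_right)
    then show ?thesis using k by auto
  qed
  obtain k l :: int where "bil X ?X ?X = 9 * of_int k" "bil Y ?Y ?Y = 9 * of_int l"
    using nine assms(1,2) s(1,3) by metis
  then have "bil (osum X (osum T Y)) w w = 9 * of_int (k + l) + bil T ?T ?T"
    by (simp add: bil_osum bil_trunc)
  then show ?thesis using that s(2) by blast
qed

lemma square_mod_3: "(k::int) * k mod 3 = 0 \<or> k * k mod 3 = 1"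
proof -
  have "k mod 3 = 0 \<or> k mod 3 = 1 \<or> k mod 3 = 2" by presburger
  then show ?thesis by (auto simp: mod_mult_eq[of k 3 k, symmetric])
qed

text \<open>The multiple of 9 stands for the other summands. For <6> and A2 the norms of special
  vectors are 6 x^2 modulo 9, that is 0 or 6, whereas -6 is 3 modulo 9.\<close>

definition no_norm_minus6 :: "lat \<Rightarrow> bool" where
  "no_norm_minus6 T \<longleftrightarrow> (\<forall>w. special T w \<longrightarrow> (\<forall>k::int. 9 * of_int k + bil T w w \<noteq> - 6))"

lemma no_norm_minus6_lat6: "no_norm_minus6 lat6"
  unfolding no_norm_minus6_def
proof (intro allI impI notI)
  fix w and k :: int assume "special lat6 w" "9 * of_int k + bil lat6 w w = - 6"
  moreover then obtain y :: int where y: "w 0 = of_int y"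
    using lat_ptsD(1)[OF specialD(1)] Ints_cases by metis
  ultimately have "of_int (9 * k + 6 * (y * y)) = (of_int (- 6) :: real)" by (simp add: bil_lat6)
  then have "9 * k + 6 * (y * y) = - 6" by (simp only: of_int_eq_iff)
  then show False using square_mod_3[of y] by presburger
qed

lemma no_norm_minus6_latA2: "no_norm_minus6 latA2"
  unfolding no_norm_minus6_def
proof (intro allI impI notI)
  fix w and k :: int assume w: "special latA2 w" and e: "9 * of_int k + bil latA2 w w = - 6"
  obtain x y :: int where xy: "w 0 = of_int x" "w 1 = of_int y"
    using lat_ptsD(1)[OF specialD(1)[OF w]] Ints_cases by metis
  have "bil latA2 w (unit 0) / 3 \<in> \<int>" using w by (rule specialD) (simp add: unit_lat_pts)
  then obtain c :: int where c: "(2 * w 0 - w 1) / 3 = of_int c"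
    by (auto simp: bil_latA2 unit_def elim: Ints_cases)
  have "real_of_int y = of_int (2 * x - 3 * c)" using c xy by simp
  then have y: "y = 2 * x - 3 * c" by (simp only: of_int_eq_iff)
  have "of_int (9 * k + 2 * x * x - x * y - y * x + 2 * y * y) = (of_int (- 6) :: real)"
    using e xy by (simp add: bil_latA2)
  then have "9 * k + 2 * x * x - x * y - y * x + 2 * y * y = - 6" by (simp only: of_int_eq_iff)
  then have "9 * (k - 2 * (c * x) + 2 * (c * c)) + 6 * (x * x) = - 6"
    unfolding y by (simp add: algebra_simps)
  then show False using square_mod_3[of x] by presburger
qed

text \<open>A 6-root orthogonal to \<open>q\<close> would give the special vector q + u of norm -12
  + 6 = -6.\<close>

lemma off_mirrors_spec:
  assumes "no_norm_minus6 T" "dual_period 1 X" "dual_period 1 Y" "special (osum X (osum T Y)) q" "bil (osum X (osum T Y)) q q = - 12"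
    and "sym_form (osum X (osum T Y))"
  shows "off_mirrors (osum X (osum T Y)) q"
  unfolding off_mirrors_def
proof (intro conjI ballI notI)
  let ?L = "osum X (osum T Y)"
  show "bil ?L q q < 0" using assms(5) by simp
  fix u assume u: "u \<in> roots6 ?L" and 0: "bil ?L q u = 0"
  let ?w = "lc 1 q 1 u"
  have us: "special ?L u" "bil ?L u u = 6" using u by (auto simp: roots6_def)
  have "special ?L ?w"
  proof (rule specialI)
    show "?w \<in> lat_pts ?L" using assms(4) us by (intro lc_lat_pts specialD) auto
    fix v assume v: "v \<in> lat_pts ?L"
    have "bil ?L q v / 3 + bil ?L u v / 3 \<in> \<int>"
      using specialD(2)[OF assms(4) v] specialD(2)[OF us(1) v] by (rule Ints_add)
    then show "bil ?L ?w v / 3 \<in> \<int>" by (simp add: bil_lc_left add_divide_distrib)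
  qed
  then obtain k :: int and w' where "special T w'" "bil ?L ?w ?w = 9 * of_int k + bil T w' w'"
    using special_norm_osum[OF assms(2,3)] by blast
  moreover have "bil ?L ?w ?w = - 6"
    using assms(5) us 0 sym_formD[OF assms(6), of u q] by (simp add: bil_lc_left bil_lc_right)
  ultimately show False using assms(1) by (auto simp: no_norm_minus6_def)
qed

text \<open>Minus the pairing with a lattice point \<open>a\<close> inside the chamber is an
  integral height on the half-cone. Reflecting in a wall with \<open>q\<close> on the wrong side
  lowers it, so the descent of Vinberg's algorithm terminates.\<close>

lemma refl_descent:
  assumes "sym_form L" "wall_root L v" "a \<in> lat_pts L" "q \<in> lat_pts L" "bil L a v < 0" "bil L q v > 0"
    and "bil L a (refl L v q) < 0"
  shows "nat \<lfloor>- bil L a (refl L v q)\<rfloor> < nat \<lfloor>- bil L a q\<rfloor>"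
proof -
  have vp: "bil L v v > 0" using wall_root_norm[OF assms(2)] by auto
  have "bil L a (refl L v q) = bil L a q - 2 * bil L q v / bil L v v * bil L a v"
    by (simp add: refl_lc bil_lc_right)
  moreover have "2 * bil L q v / bil L v v * bil L a v < 0"
    using assms vp by (intro mult_pos_neg) auto
  ultimately have lt: "- bil L a (refl L v q) < - bil L a q" by linarith
  obtain m n :: int where "- bil L a (refl L v q) = of_int m" "- bil L a q = of_int n"
    using bil_Ints[OF assms(3) refl_lat_pts[OF assms(1,2,4)]] bil_Ints[OF assms(3,4)] Ints_minus Ints_cases
    by metis
  then show ?thesis using lt assms(7) by simp
qed

lemma coherent_self: "coherent L p p"
proof -
  have "separating L p p = {}" by (auto simp: separating_def)
  then show ?thesis by (simp add: coherent_def zero_lat_pts)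
qed

lemma refl_half:
  assumes "lorentzian L" "sym_form L" "wall_root L v" "bil L q q < 0" "bil L a a < 0" "bil L q a < 0"
  shows "bil L (refl L v q) a < 0"
proof -
  have vp: "bil L v v > 0" using wall_root_norm[OF assms(3)] by auto
  have "bil L (refl L v q) q = bil L q q - 2 * (bil L q v)\<^sup>2 / bil L v v"
    using sym_formD[OF assms(2), of v q] by (simp add: refl_lc bil_lc_left power2_eq_square)
  moreover have "2 * (bil L q v)\<^sup>2 / bil L v v \<ge> 0" using vp by simp
  ultimately have "bil L (refl L v q) q < 0" using assms(4) by linarith
  moreover have "bil L (refl L v q) (refl L v q) \<le> 0" using bil_refl[OF assms(2)] vp assms(4) by simp
  ultimately show ?thesis using lorentzian_half[OF assms(1,2,4,5,6)] by blast
qed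

subsection \<open>The lattice \<open>U + A\<^sub>2 + E\<^sub>8\<close>\<close>

definition \<Gamma> :: lat where "\<Gamma> = row12 0"

lemma \<Gamma>_osum: "\<Gamma> = osum latU (osum latA2 (osum latE8 (rep 0 latA1)))"
  by (simp add: \<Gamma>_def row12_def)

lemma \<Gamma>_props: "sym_form \<Gamma>" "lorentzian \<Gamma>" "dual_period 3 \<Gamma>" "fst \<Gamma> = 12"
proof -
  show "sym_form \<Gamma>" unfolding \<Gamma>_osum by (intro Y_rules)
  show "lorentzian \<Gamma>" unfolding \<Gamma>_osum
    by (intro lorentzian_osum lorentzian_latU pos_def_osum pos_def_latA2 pos_def_latE8 pos_def_rep pos_def_latA1 Y_rules)
  show "dual_period 3 \<Gamma>" unfolding \<Gamma>_osum
    by (intro dual_period_osum dual_period_latA2 dual_period_rep dual_period_1_imp_3[OF dual_period_latU] dual_period_1_imp_3[OF dual_period_latE8] dual_period_1_imp_3[OF dual_period_latA1])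
  show "fst \<Gamma> = 12" by (simp add: \<Gamma>_osum)
qed

lemma bil_\<Gamma>: "bil \<Gamma> x y = x 0 * y 1 + x 1 * y 0 + (2 * x 2 * y 2 - x 2 * y 3 - x 3 * y 2 + 2 * x 3 * y 3)
  + bil latE8 (shift 4 x) (shift 4 y)"
  by (simp add: \<Gamma>_osum bil_osum bil_latU bil_latA2 bil_rank_0 shift_def numeral_eq_Suc)

lemma off_mirrors_\<Gamma>: "special \<Gamma> q \<Longrightarrow> bil \<Gamma> q q = - 12 \<Longrightarrow> off_mirrors \<Gamma> q"
  using off_mirrors_spec[OF no_norm_minus6_latA2 dual_period_latU dual_period_osum[OF dual_period_latE8 dual_period_rep[OF dual_period_latA1]]] \<Gamma>_props(1)
  unfolding \<Gamma>_osum by blast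

text \<open>The walls of a fundamental chamber of the reflection group, found by Vinberg's algorithm; those
  in the first list contain the isotropic vector \<open>(0,-1)\<close> of \<open>U\<close>.\<close>
definition walls0 :: "(nat \<Rightarrow> real) list" where
  "walls0 = map lvec
    [[0,0,0,0, 1,0,0,0,0,0,0,0], [0,0,0,0, 0,1,0,0,0,0,0,0], [0,0,0,0, 0,0,1,0,0,0,0,0],
     [0,0,0,0, 0,0,0,1,0,0,0,0], [0,0,0,0, 0,0,0,0,1,0,0,0], [0,0,0,0, 0,0,0,0,0,1,0,0],
     [0,0,0,0, 0,0,0,0,0,0,1,0], [0,0,0,0, 0,0,0,0,0,0,0,1],
     [0,-1,0,0, -2,-3,-4,-6,-5,-4,-3,-2],
     [0,0,1,0, 0,0,0,0,0,0,0,0], [0,0,-1,1, 0,0,0,0,0,0,0,0], [0,-1,-1,-1, 0,0,0,0,0,0,0,0]]"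

text \<open>The 2- and 6-roots of A2 form a root system of type G2. The walls through the cusp make
  up the affine Coxeter diagrams of E8 and G2, and (1,1) is joined to the two affine nodes.\<close>

definition walls :: "(nat \<Rightarrow> real) list" where
  "walls = lvec [1,1] # walls0"

text \<open>The E8 part is minus the Weyl vector and 30 is the Coxeter number, so all nine walls of
  the affine E8 pair to -1 with it; -31 gives -1 with (1,1) as well. It is thus a lattice point in
  the open chamber.\<close>

definition interior :: "nat \<Rightarrow> real" where
  "interior = lvec [30,-31,-2,-3,-46,-68,-91,-135,-110,-84,-57,-29]"

text \<open>The A2 part is minus three times a fundamental weight, so a third of the vector
  generates discr_3; the norm is -18 + 6, and the product with the cusp (0,-1) is -3.\<close>

definition pstd :: "nat \<Rightarrow> real" where
  "pstd = lvec [3,-3,-1,-2]"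

lemma shift_lvec: "shift n (lvec xs) = lvec (drop n xs)"
  by (rule ext) (auto simp: shift_def lvec_def add.commute less_diff_conv)

lemma wall_root_walls:
  assumes "v \<in> set walls"
  shows "wall_root \<Gamma> v"
proof -
  have lp: "v \<in> lat_pts \<Gamma>"
    using assms unfolding walls_def walls0_def by (auto intro!: lvec_lat_pts simp: \<Gamma>_props(4))
  show ?thesis
  proof (cases "v = lvec [0,0,-1,1,0,0,0,0,0,0,0,0]")
    case True
    have v: "v = cat (fst latU) (\<lambda>i. 0) (cat (fst latA2) (lvec [- 1, 1]) (\<lambda>i. 0))"
      unfolding True by (rule ext) (auto simp: cat_def lvec_def nth_Cons' )
    have "special \<Gamma> v" unfolding v \<Gamma>_osum by (intro special_cat special_zero special_latA2)
    moreover have "bil \<Gamma> v v = 6" by (simp add: True bil_\<Gamma> shift_lvec bil_latE8)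
    moreover have "reverses3 \<Gamma> v" unfolding v \<Gamma>_osum
      by (intro reverses3_osum reverses3_latA2 Y_rules dual_period_latU)
    ultimately show ?thesis using lp by (simp add: wall_root_def roots6_def)
  next
    case False
    then have "bil \<Gamma> v v = 2"
      using assms unfolding walls_def walls0_def
      by (auto simp: bil_\<Gamma> shift_lvec bil_latE8)
    then show ?thesis using lp by (simp add: wall_root_def)
  qed
qed

lemma interior_walls: "v \<in> set walls \<Longrightarrow> bil \<Gamma> interior v < 0"
  unfolding walls_def walls0_def interior_def by (auto simp: bil_\<Gamma> shift_lvec bil_latE8)

lemma interior_props: "interior \<in> lat_pts \<Gamma>" "bil \<Gamma> interior interior < 0"
  "pstd \<in> lat_pts \<Gamma>" "special \<Gamma> pstd" "bil \<Gamma> pstd pstd = - 12" "bil \<Gamma> pstd interior < 0"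
proof -
  show "interior \<in> lat_pts \<Gamma>" "pstd \<in> lat_pts \<Gamma>"
    unfolding interior_def pstd_def by (auto intro!: lvec_lat_pts simp: \<Gamma>_props(4))
  show "bil \<Gamma> interior interior < 0" "bil \<Gamma> pstd pstd = - 12" "bil \<Gamma> pstd interior < 0"
    unfolding interior_def pstd_def by (simp_all add: bil_\<Gamma> shift_lvec bil_latE8)
  have ps: "pstd = cat (fst latU) (lvec [3,-3]) (cat (fst latA2) (lvec [-1,-2]) (\<lambda>i. 0))"
    unfolding pstd_def by (rule ext) (auto simp: cat_def lvec_def nth_Cons')
  have su: "special latU (lvec [3,-3])"
    by (rule specialI) (auto simp: bil_latU diff_divide_distrib intro!: lvec_lat_pts Ints_diff dest: lat_ptsD)
  have sa: "special latA2 (lvec [-1,-2])"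
    by (rule specialI) (auto simp: bil_latA2 diff_divide_distrib intro!: lvec_lat_pts Ints_diff dest: lat_ptsD)
  show "special \<Gamma> pstd" unfolding \<Gamma>_osum ps by (intro special_cat special_zero su sa)
qed

text \<open>The pairing with the highest root of \<open>E\<^sub>8\<close> is the last coordinate.\<close>
lemma E8_alcove:
  fixes n :: "nat \<Rightarrow> real"
  assumes "2 * n 0 - n 2 \<ge> 0" "2 * n 1 - n 3 \<ge> 0" "2 * n 2 - n 0 - n 3 \<ge> 0"
    "2 * n 3 - n 1 - n 2 - n 4 \<ge> 0" "2 * n 4 - n 3 - n 5 \<ge> 0" "2 * n 5 - n 4 - n 6 \<ge> 0"
    "2 * n 6 - n 5 - n 7 \<ge> 0" "2 * n 7 - n 6 \<ge> 0"
  shows "bil latE8 n n \<le> (n 7)\<^sup>2" "n 7 \<ge> 0" "n 7 = 0 \<Longrightarrow> i < 8 \<Longrightarrow> n i = 0"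
    "\<lbrakk>\<And>i. n i \<in> \<int>; n 7 \<le> 1\<rbrakk> \<Longrightarrow> n 7 = 0"
proof -
  define y0 y1 y2 y3 y4 y5 y6 y7 where y_defs: "y0 = 2 * n 0 - n 2" "y1 = 2 * n 1 - n 3"
    "y2 = 2 * n 2 - n 0 - n 3" "y3 = 2 * n 3 - n 1 - n 2 - n 4" "y4 = 2 * n 4 - n 3 - n 5"
    "y5 = 2 * n 5 - n 4 - n 6" "y6 = 2 * n 6 - n 5 - n 7" "y7 = 2 * n 7 - n 6"
  have pos: "y0 \<ge> 0" "y1 \<ge> 0" "y2 \<ge> 0" "y3 \<ge> 0" "y4 \<ge> 0" "y5 \<ge> 0" "y6 \<ge> 0" "y7 \<ge> 0"
    using assms by (simp_all add: y_defs)
  \<comment> \<open>The y_i are the pairings of n with the simple roots, and the coefficients are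
    the marks m_i of the highest root. Comparing rows of the inverse Cartan matrix gives n_i \<le>
    m_i n7, hence n^2 = sum n_i y_i \<le> n7^2.\<close>
  have n7: "n 7 = 2 * y0 + 3 * y1 + 4 * y2 + 6 * y3 + 5 * y4 + 4 * y5 + 3 * y6 + 2 * y7"
    unfolding y_defs by simp
  have le: "n 0 \<le> 2 * n 7" "n 1 \<le> 3 * n 7" "n 2 \<le> 4 * n 7" "n 3 \<le> 6 * n 7" "n 4 \<le> 5 * n 7"
    "n 5 \<le> 4 * n 7" "n 6 \<le> 3 * n 7" "n 7 \<le> 2 * n 7" and nn: "n 7 \<ge> 0"
    and ge: "n 0 \<ge> 0" "n 1 \<ge> 0" "n 2 \<ge> 0" "n 3 \<ge> 0" "n 4 \<ge> 0" "n 5 \<ge> 0" "n 6 \<ge> 0"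
    using assms by linarith+
  show "n 7 \<ge> 0" by (rule nn)
  show "n i = 0" if z: "n 7 = 0" and i: "i < 8"
  proof -
    have "\<forall>i<8. n i = 0" unfolding less_8_iff using le ge z by linarith
    then show ?thesis using i by blast
  qed
  have "bil latE8 n n = n 0 * y0 + n 1 * y1 + n 2 * y2 + n 3 * y3 + n 4 * y4 + n 5 * y5 + n 6 * y6 + n 7 * y7"
    by (simp add: bil_latE8 y_defs)
  also have "\<dots> \<le> 2 * n 7 * y0 + 3 * n 7 * y1 + 4 * n 7 * y2 + 6 * n 7 * y3 + 5 * n 7 * y4 + 4 * n 7 * y5
      + 3 * n 7 * y6 + 2 * n 7 * y7"
    using le pos by (intro add_mono mult_right_mono)
  also have "\<dots> = n 7 * (2 * y0 + 3 * y1 + 4 * y2 + 6 * y3 + 5 * y4 + 4 * y5 + 3 * y6 + 2 * y7)"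
    by (simp add: algebra_simps)
  also have "\<dots> = (n 7)\<^sup>2" unfolding n7[symmetric] by (simp add: power2_eq_square)
  finally show "bil latE8 n n \<le> (n 7)\<^sup>2" .
  show "n 7 = 0" if I: "\<And>i. n i \<in> \<int>" and "n 7 \<le> 1"
  proof -
    \<comment> \<open>All marks of E8 are at least 2, so a sum of at most 1 forces every integral
      y_i to vanish.\<close>
    have z: "y = 0" if "y \<in> \<int>" "y \<ge> 0" "2 * y \<le> 1" for y :: real
      using that by (elim Ints_cases) auto
    have "y0 \<in> \<int>" "y1 \<in> \<int>" "y2 \<in> \<int>" "y3 \<in> \<int>" "y4 \<in> \<int>" "y5 \<in> \<int>" "y6 \<in> \<int>" "y7 \<in> \<int>"
      unfolding y_defs using I by (auto intro!: Ints_diff Ints_mult)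
    then have "y0 = 0" "y1 = 0" "y2 = 0" "y3 = 0" "y4 = 0" "y5 = 0" "y6 = 0" "y7 = 0"
      using pos n7 \<open>n 7 \<le> 1\<close> by (auto intro!: z)
    then show ?thesis using n7 by simp
  qed
qed

text \<open>The finite E8 walls make n = -q dominant and the affine one bounds its pairing with the
  highest root by q0: n lies in q0 times the fundamental alcove. For special q the same applies to
  the lattice vector n/3.\<close>

lemma walls0_cond:
  assumes "\<forall>v\<in>set walls0. bil \<Gamma> q v \<le> 0"
  defines "n \<equiv> \<lambda>i. - shift 4 q i"
  shows "bil latE8 (shift 4 q) (shift 4 q) \<le> (n 7)\<^sup>2" "0 \<le> n 7" "n 7 \<le> q 0"
    "n 7 = 0 \<Longrightarrow> i < 8 \<Longrightarrow> q (i + 4) = 0"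
    "\<lbrakk>\<And>i. q (i + 4) / 3 \<in> \<int>; n 7 \<le> 3\<rbrakk> \<Longrightarrow> n 7 = 0"
    "2 * q 2 \<le> q 3" "q 3 \<le> q 2" "- (q 2 + q 3) \<le> q 0"
proof -
  have w: "2 * n 0 - n 2 \<ge> 0" "2 * n 1 - n 3 \<ge> 0" "2 * n 2 - n 0 - n 3 \<ge> 0"
    "2 * n 3 - n 1 - n 2 - n 4 \<ge> 0" "2 * n 4 - n 3 - n 5 \<ge> 0" "2 * n 5 - n 4 - n 6 \<ge> 0"
    "2 * n 6 - n 5 - n 7 \<ge> 0" "2 * n 7 - n 6 \<ge> 0" "n 7 \<le> q 0"
    "2 * q 2 \<le> q 3" "q 3 \<le> q 2" "- (q 2 + q 3) \<le> q 0"
    using assms(1) unfolding walls0_def n_def by (simp_all add: bil_\<Gamma> shift_lvec bil_latE8)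
  note E = E8_alcove[of n, OF w(1-8)]
  show "0 \<le> n 7" "n 7 \<le> q 0" "2 * q 2 \<le> q 3" "q 3 \<le> q 2" "- (q 2 + q 3) \<le> q 0"
    using E(2) w by auto
  have "bil latE8 n n = bil latE8 (shift 4 q) (shift 4 q)"
    unfolding n_def by (simp add: bil_minus_left bil_minus_right)
  then show "bil latE8 (shift 4 q) (shift 4 q) \<le> (n 7)\<^sup>2" using E(1) by simp
  show "q (i + 4) = 0" if "n 7 = 0" "i < 8" using E(3)[OF that] by (simp add: n_def shift_def)
  show "n 7 = 0" if I: "\<And>i. q (i + 4) / 3 \<in> \<int>" and "n 7 \<le> 3"
  proof -
    let ?m = "\<lambda>i. n i / 3"
    have "?m 7 = 0"
    proof (rule E8_alcove(4)[of ?m])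
      show "?m i \<in> \<int>" for i using Ints_minus[OF I[of i]] by (simp add: n_def shift_def)
    qed (use w that in linarith)+
    then show ?thesis by simp
  qed
qed


lemma special_\<Gamma>_coords:
  assumes "special \<Gamma> q"
  shows "q 0 / 3 \<in> \<int>" "q 1 / 3 \<in> \<int>" "q (i + 4) / 3 \<in> \<int>" "(q 2 + q 3) / 3 \<in> \<int>"
proof -
  note q1 = special_osum[OF assms[unfolded \<Gamma>_osum]]
  note q2 = special_osum[OF q1(2)]
  show "q 0 / 3 \<in> \<int>" using special_dd_1[OF dual_period_latU q1(1), of 0] by (simp add: trunc_def)
  show "q 1 / 3 \<in> \<int>" using special_dd_1[OF dual_period_latU q1(1), of 1] by (simp add: trunc_def)
  have "dual_period 1 (osum latE8 (rep 0 latA1))" by (intro Y_rules)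
  from special_dd_1[OF this q2(2), of i] show "q (i + 4) / 3 \<in> \<int>" by (simp add: shift_def numeral_eq_Suc)
  have u: "unit 2 \<in> lat_pts \<Gamma>" by (rule unit_lat_pts) (simp add: \<Gamma>_props(4))
  have "shift 4 (unit 2) = (\<lambda>i. 0)" by (auto simp: shift_def unit_def)
  then have "bil \<Gamma> q (unit 2) = 2 * q 2 - q 3" by (simp add: bil_\<Gamma>) (simp add: unit_def)
  then have "q 2 - (2 * q 2 - q 3) / 3 \<in> \<int>"
    using specialD(2)[OF assms u] lat_ptsD(1)[OF specialD(1)[OF assms]] by (intro Ints_diff) auto
  then show "(q 2 + q 3) / 3 \<in> \<int>" by (simp add: field_simps)
qed

lemma \<Gamma>_eqI:
  assumes "x \<in> lat_pts \<Gamma>" "y \<in> lat_pts \<Gamma>" "x 0 = y 0" "x 1 = y 1" "x 2 = y 2" "x 3 = y 3"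
    "\<And>i. i < 8 \<Longrightarrow> x (i + 4) = y (i + 4)"
  shows "x = y"
proof (rule rvec_eqI)
  show "x \<in> rvec 12" "y \<in> rvec 12" using assms(1,2) by (auto simp: \<Gamma>_props(4) dest: lat_ptsD)
  fix i :: nat assume i: "i < 12"
  consider "i = 0" | "i = 1" | "i = 2" | "i = 3" | "4 \<le> i" by linarith
  then show "x i = y i"
  proof cases
    case 5
    then show ?thesis using assms(7)[of "i - 4"] i by simp
  qed (use assms in auto)
qed

text \<open>In the closed chamber the only isotropic ray is the cusp \<open>(0,-1)\<close>: the covering radii of
  \<open>E\<^sub>8\<close> and \<open>A\<^sub>2\<close> have squares \<open>1\<close> and \<open>2/3\<close>, with sum below \<open>2\<close>.\<close>
lemma isotropic_in_chamber:
  assumes z: "\<forall>v\<in>set walls. bil \<Gamma> z v \<le> 0" and iso: "bil \<Gamma> z z = 0"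
  shows "z 0 = 0" "z 1 \<le> 0" "z 2 = 0" "z 3 = 0" "i < 8 \<Longrightarrow> z (i + 4) = 0"
proof -
  define n where "n = - shift 4 z 7"
  have "\<forall>v\<in>set walls0. bil \<Gamma> z v \<le> 0" using z by (simp add: walls_def)
  note c = walls0_cond[OF this, folded n_def]
  have "shift 4 (lvec [1, 1]) = (\<lambda>i. 0)" by (auto simp: shift_def lvec_def)
  then have e: "z 0 + z 1 \<le> 0" using z by (simp add: walls_def bil_\<Gamma>)
  have neg: "z 2 \<le> 0" "z 3 \<le> 0" "z 0 \<ge> 0" using c(2,3,6,7) by linarith+
  define A E where "A = 2 * z 2 * z 2 - z 2 * z 3 - z 3 * z 2 + 2 * z 3 * z 3"
    and "E = bil latE8 (shift 4 z) (shift 4 z)"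
  have "(z 2 + z 3)\<^sup>2 \<le> (z 0)\<^sup>2"
    using c(8) neg by (subst abs_le_square_iff[symmetric]) simp
  moreover have "3 * A \<le> 2 * (z 2 + z 3)\<^sup>2"
  proof -
    \<comment> \<open>The difference of the two sides is twice this product, whose factors are
      nonnegative on the chamber.\<close>
    have "(z 3 - 2 * z 2) * (z 2 - 2 * z 3) \<ge> 0"
      using c(6,7) neg by (intro mult_nonneg_nonneg) linarith+
    then show ?thesis unfolding A_def by (simp add: power2_eq_square algebra_simps)
  qed
  moreover have "n\<^sup>2 \<le> (z 0)\<^sup>2" using c(2,3) by (intro power_mono) auto
  moreover have "z 0 * z 1 \<le> - (z 0)\<^sup>2"
    using mult_left_mono[OF e neg(3)] by (simp add: power2_eq_square algebra_simps)
  moreover have "2 * (z 0 * z 1) + A + E = 0" using iso unfolding bil_\<Gamma> A_def E_def by simp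
  moreover have "E \<le> n\<^sup>2" unfolding E_def n_def by (rule c(1)[unfolded n_def])
  ultimately have "3 * (z 0)\<^sup>2 \<le> 2 * (z 0)\<^sup>2" by linarith
  then show z0: "z 0 = 0" by simp
  then show "z 1 \<le> 0" "z 2 = 0" "z 3 = 0" using e c(6-8) by linarith+
  have "n = 0" using c(2,3) z0 by linarith
  then show "z (i + 4) = 0" if "i < 8" using c(4) that by blast
qed

text \<open>For q0 = 3 the alcove bound kills the E8 part. The A2 part has coordinate sum 0 or -3,
  which leaves (0,0) and (-1,-2); the former would give q1 = -2, not divisible by 3.\<close>

lemma pstd_in_chamber:
  assumes q: "\<forall>v\<in>set walls0. bil \<Gamma> q v \<le> 0" and s: "special \<Gamma> q" and n: "bil \<Gamma> q q = - 12" and q0: "q 0 = 3"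
  shows "q = pstd"
proof -
  note c = walls0_cond[OF q]
  note I = special_\<Gamma>_coords[OF s]
  have z: "- shift 4 q 7 = 0" using c(3,5) I(3) q0 by auto
  have q4: "q (i + 4) = 0" if "i < 8" for i using c(4)[OF z that] .
  have "bil latE8 (shift 4 q) (shift 4 q) = bil latE8 (\<lambda>i. 0) (\<lambda>i. 0)"
    by (rule bil_cong) (simp_all add: shift_def q4)
  then have e: "6 * q 1 + (2 * q 2 * q 2 - q 2 * q 3 - q 3 * q 2 + 2 * q 3 * q 3) = - 12"
    using n q0 by (simp add: bil_\<Gamma>)
  obtain a b k m :: int where abk: "q 2 = of_int a" "q 3 = of_int b" "(q 2 + q 3) / 3 = of_int k"
    "q 1 / 3 = of_int m"
    using I(2,4) lat_ptsD(1)[OF specialD(1)[OF s]] Ints_cases by metis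
  have "real_of_int (a + b) = of_int (3 * k)" using abk by simp
  then have ab: "a + b = 3 * k" by (simp only: of_int_eq_iff)
  have "2 * a \<le> b" "b \<le> a" "- 3 \<le> a + b"
    using c(6-8) q0 abk by (simp_all flip: of_int_add add: le_minus_iff minus_le_iff)
  then have "a = 0 \<and> b = 0 \<or> a = - 1 \<and> b = - 2" using ab by presburger
  then have "a = - 1 \<and> b = - 2"
  proof
    assume "a = 0 \<and> b = 0"
    then have "of_int (3 * m) = (of_int (- 2) :: real)" using e abk by simp
    then have "3 * m = - 2" by (simp only: of_int_eq_iff)
    then show ?thesis by presburger
  qed
  then have "q 2 = - 1" "q 3 = - 2" using abk by simp_all
  moreover then have "q 1 = - 3" using e by simp
  ultimately show ?thesis
    using specialD(1)[OF s] interior_props(3) q0 q4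
    by (intro \<Gamma>_eqI) (simp_all add: pstd_def lvec_def)
qed

lemma \<Gamma>_step:
  assumes q: "special \<Gamma> q" "bil \<Gamma> q q = - 12" "bil \<Gamma> q interior < 0" and v: "v \<in> set walls"
  shows "special \<Gamma> (refl \<Gamma> v q)" "bil \<Gamma> (refl \<Gamma> v q) (refl \<Gamma> v q) = - 12"
    "bil \<Gamma> (refl \<Gamma> v q) interior < 0" "coherent \<Gamma> pstd (refl \<Gamma> v q) \<Longrightarrow> coherent \<Gamma> pstd q"
proof -
  note r = wall_root_walls[OF v]
  have v0: "bil \<Gamma> v v \<noteq> 0" using wall_root_norm[OF r] by auto
  show s: "special \<Gamma> (refl \<Gamma> v q)" by (rule refl_spec[OF \<Gamma>_props(1) r q(1)])
  show n: "bil \<Gamma> (refl \<Gamma> v q) (refl \<Gamma> v q) = - 12" using bil_refl[OF \<Gamma>_props(1) v0] q(2) by simp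
  have neg: "bil \<Gamma> q q < 0" using q(2) by simp
  show "bil \<Gamma> (refl \<Gamma> v q) interior < 0"
    by (rule refl_half[OF \<Gamma>_props(2,1) r neg interior_props(2) q(3)])
  have "bil \<Gamma> interior q < 0" using q(3) sym_formD[OF \<Gamma>_props(1), of q interior] by simp
  then have pq: "bil \<Gamma> pstd q < 0"
    using lorentzian_half[OF \<Gamma>_props(2,1) interior_props(2) neg _ _ interior_props(6)] interior_props(5) by simp
  show "coherent \<Gamma> pstd q" if "coherent \<Gamma> pstd (refl \<Gamma> v q)"
    by (rule coherent_refl_step[OF \<Gamma>_props(2,1,3) _ _ _ q(1) pq r that])
      (use off_mirrors_\<Gamma> interior_props q s n in auto)
qed

text \<open>The roots of \<open>walls0\<close> are orthogonal to the cusp (0,-1), that is, their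
  coordinate 0 vanishes. The descent with them keeps q0 = 3 and can only end at
  \<open>pstd\<close>.\<close>

lemma coherent_at_cusp:
  assumes "special \<Gamma> q" "bil \<Gamma> q q = - 12" "bil \<Gamma> q interior < 0" "q 0 = 3"
  shows "coherent \<Gamma> pstd q"
  using assms
proof (induction "nat \<lfloor>- bil \<Gamma> interior q\<rfloor>" arbitrary: q rule: less_induct)
  case less
  show ?case
  proof (cases "\<forall>v\<in>set walls0. bil \<Gamma> q v \<le> 0")
    case True
    then have "q = pstd" using less.prems by (intro pstd_in_chamber)
    then show ?thesis by (simp add: coherent_self)
  next
    case False
    then obtain v where v0: "v \<in> set walls0" and qv: "bil \<Gamma> q v > 0" by auto
    then have v: "v \<in> set walls" by (simp add: walls_def)
    note st = \<Gamma>_step[OF less.prems(1-3) v]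
    have "v 0 = 0" using v0 unfolding walls0_def by auto
    then have "refl \<Gamma> v q 0 = 3" using less.prems(4) by (simp add: refl_def)
    moreover have "bil \<Gamma> interior (refl \<Gamma> v q) < 0"
      using st(3) sym_formD[OF \<Gamma>_props(1), of interior "refl \<Gamma> v q"] by simp
    then have "nat \<lfloor>- bil \<Gamma> interior (refl \<Gamma> v q)\<rfloor> < nat \<lfloor>- bil \<Gamma> interior q\<rfloor>"
      by (intro refl_descent[OF \<Gamma>_props(1) wall_root_walls[OF v] interior_props(1) specialD(1)[OF less.prems(1)]
            interior_walls[OF v] qv])
    ultimately show ?thesis using less.hyps st by blast
  qed
qed

text \<open>The descent is governed by \<open>z\<close>, with \<open>q\<close> reflected along. When
  \<open>z\<close> has reached the closed chamber it is a multiple of the cusp with z1 q0 = -3; as 3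
  divides q0 and z1 \<le> 0, this means z1 = -1 and q0 = 3.\<close>

lemma coherent_\<Gamma>:
  assumes "z \<in> lat_pts \<Gamma>" "bil \<Gamma> z z = 0" "bil \<Gamma> z q = - 3"
    and "special \<Gamma> q" "bil \<Gamma> q q = - 12" "bil \<Gamma> q interior < 0"
  shows "coherent \<Gamma> pstd q"
  using assms
proof (induction "nat \<lfloor>- bil \<Gamma> interior z\<rfloor>" arbitrary: z q rule: less_induct)
  case less
  show ?case
  proof (cases "\<forall>v\<in>set walls. bil \<Gamma> z v \<le> 0")
    case True
    note c = isotropic_in_chamber[OF True less.prems(2)]
    have "bil latE8 (shift 4 z) (shift 4 q) = bil latE8 (\<lambda>i. 0) (shift 4 q)"
      by (rule bil_cong) (simp_all add: shift_def c(5))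
    then have zq: "z 1 * q 0 = - 3" using less.prems(3) c by (simp add: bil_\<Gamma>)
    obtain a b :: int where ab: "z 1 = of_int a" "q 0 / 3 = of_int b"
      using lat_ptsD(1)[OF less.prems(1)] special_\<Gamma>_coords(1)[OF less.prems(4)] Ints_cases by metis
    have "of_int (a * b) = (of_int (- 1) :: real)" using zq ab by (simp add: field_simps)
    then have "a * b = - 1" by (simp only: of_int_eq_iff)
    then have "a = - 1 \<and> b = 1 \<or> a = 1 \<and> b = - 1"
      by (smt (verit) mult_minus_right zmult_eq_1_iff)
    then have "b = 1" using c(2) ab by auto
    then have "q 0 = 3" using ab by simp
    then show ?thesis using coherent_at_cusp less.prems by blast
  next
    case False
    then obtain v where v: "v \<in> set walls" and zv: "bil \<Gamma> z v > 0" by auto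
    note r = wall_root_walls[OF v]
    note st = \<Gamma>_step[OF less.prems(4-6) v]
    let ?z = "refl \<Gamma> v z" and ?q = "refl \<Gamma> v q"
    have v0: "bil \<Gamma> v v \<noteq> 0" using wall_root_norm[OF r] by auto
    have z': "?z \<in> lat_pts \<Gamma>" "bil \<Gamma> ?z ?z = 0" "bil \<Gamma> ?z ?q = - 3"
      using refl_lat_pts[OF \<Gamma>_props(1) r less.prems(1)] bil_refl[OF \<Gamma>_props(1) v0] less.prems by simp_all
    have "bil \<Gamma> ?z interior < 0"
      using lorentzian_half[OF \<Gamma>_props(2,1) _ interior_props(2) st(3), of ?z] z' st(2) by simp
    then have "bil \<Gamma> interior ?z < 0" using sym_formD[OF \<Gamma>_props(1), of interior ?z] by simp
    then have "nat \<lfloor>- bil \<Gamma> interior ?z\<rfloor> < nat \<lfloor>- bil \<Gamma> interior z\<rfloor>"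
      by (intro refl_descent[OF \<Gamma>_props(1) r interior_props(1) less.prems(1) interior_walls[OF v] zv])
    from less.hyps[OF this z' st(1-3)] show ?thesis by (rule st(4))
  qed
qed

subsection \<open>The lattice \<open>-A\<^sub>1 + \<langle>6\<rangle> + A\<^sub>1\<close>\<close>

definition \<Delta> :: lat where "\<Delta> = row0 1"

lemma \<Delta>_osum: "\<Delta> = osum latmA1 (osum lat6 (rep 1 latA1))"
  by (simp add: \<Delta>_def row0_def)

lemma \<Delta>_props: "sym_form \<Delta>" "lorentzian \<Delta>" "dual_period 3 \<Delta>" "fst \<Delta> = 3"
proof -
  show "sym_form \<Delta>" unfolding \<Delta>_osum by (intro Y_rules)
  show "lorentzian \<Delta>" unfolding \<Delta>_osum
    by (intro lorentzian_osum lorentzian_latmA1 pos_def_osum pos_def_lat6 pos_def_rep pos_def_latA1 Y_rules)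
  show "dual_period 3 \<Delta>" unfolding \<Delta>_osum
    by (intro dual_period_osum dual_period_lat6 dual_period_rep dual_period_1_imp_3[OF dual_period_latmA1] dual_period_1_imp_3[OF dual_period_latA1])
  show "fst \<Delta> = 3" by (simp add: \<Delta>_osum)
qed

lemma bil_\<Delta>: "bil \<Delta> x y = - 2 * x 0 * y 0 + 6 * x 1 * y 1 + 2 * x 2 * y 2"
  by (simp add: \<Delta>_osum bil_osum bil_latmA1 bil_lat6 bil_latA1 bil_rank_0 shift_def numeral_eq_Suc)

lemma off_mirrors_\<Delta>: "special \<Delta> q \<Longrightarrow> bil \<Delta> q q = - 12 \<Longrightarrow> off_mirrors \<Delta> q"
  using off_mirrors_spec[OF no_norm_minus6_lat6 dual_period_latmA1 dual_period_rep[OF dual_period_latA1]] \<Delta>_props(1)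
  unfolding \<Delta>_osum by blast

lemma special_\<Delta>_coords:
  assumes "special \<Delta> q"
  shows "q 0 / 3 \<in> \<int>" "q 1 \<in> \<int>" "q 2 / 3 \<in> \<int>"
proof -
  note q1 = special_osum[OF assms[unfolded \<Delta>_osum]]
  note q2 = special_osum[OF q1(2)]
  show "q 0 / 3 \<in> \<int>" using special_dd_1[OF dual_period_latmA1 q1(1), of 0] by (simp add: trunc_def)
  show "q 1 \<in> \<int>" using lat_ptsD(1)[OF specialD(1)[OF assms]] .
  show "q 2 / 3 \<in> \<int>" using special_dd_1[OF dual_period_rep[OF dual_period_latA1] q2(2), of 0] by (simp add: shift_def numeral_eq_Suc)
qed

text \<open>The norms are 6, 2, 4 and 6.\<close>

definition walls\<Delta> :: "(nat \<Rightarrow> real) list" where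
  "walls\<Delta> = map lvec [[0,1,0], [0,0,1], [1,-1,0], [3,-1,-3]]"

lemma wall_root_walls\<Delta>:
  assumes "v \<in> set walls\<Delta>"
  shows "wall_root \<Delta> v"
proof -
  have lp: "v \<in> lat_pts \<Delta>"
    using assms unfolding walls\<Delta>_def by (auto intro!: lvec_lat_pts simp: \<Delta>_props(4))
  consider "v = lvec [0,1,0]" | "v = lvec [0,0,1]" | "v = lvec [1,-1,0]" | "v = lvec [3,-1,-3]"
    using assms unfolding walls\<Delta>_def by auto
  then show ?thesis
  proof cases
    case 1
    have v: "v = cat (fst latmA1) (\<lambda>i. 0) (cat (fst lat6) (lvec [1]) (\<lambda>i. 0))"
      unfolding 1 by (rule ext) (auto simp: cat_def lvec_def nth_Cons')
    have "special \<Delta> v" unfolding v \<Delta>_osum by (intro special_cat special_zero special_lat6)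
    moreover have "bil \<Delta> v v = 6" by (simp add: 1 bil_\<Delta>)
    moreover have "reverses3 \<Delta> v" unfolding v \<Delta>_osum by (intro reverses3_osum reverses3_lat6 Y_rules dual_period_latmA1)
    ultimately show ?thesis using lp by (simp add: wall_root_def roots6_def)
  next
    case 2
    then show ?thesis using lp by (simp add: wall_root_def bil_\<Delta>)
  next
    case 3
    have "bil \<Delta> w v / 2 \<in> \<int>" if "w \<in> lat_pts \<Delta>" for w
    proof -
      have "bil \<Delta> w v / 2 = - w 0 - 3 * w 1" by (simp add: 3 bil_\<Delta>)
      also have "\<dots> \<in> \<int>" using lat_ptsD(1)[OF that] by (intro Ints_diff Ints_mult Ints_minus) simp_all
      finally show ?thesis .
    qed
    then show ?thesis using lp 3 by (simp add: wall_root_def bil_\<Delta>)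
  next
    case 4
    have "special \<Delta> v"
    proof (rule specialI)
      fix w assume w: "w \<in> lat_pts \<Delta>"
      have "bil \<Delta> v w / 3 = - 2 * w 0 - 2 * w 1 - 2 * w 2" by (simp add: 4 bil_\<Delta>)
      also have "\<dots> \<in> \<int>" using lat_ptsD(1)[OF w] by (intro Ints_diff Ints_mult) simp_all
      finally show "bil \<Delta> v w / 3 \<in> \<int>" .
    qed (rule lp)
    moreover have "bil \<Delta> v v = 6" by (simp add: 4 bil_\<Delta>)
    moreover have "reverses3 \<Delta> v"
      unfolding reverses3_def
    proof (intro allI impI)
      fix q assume q: "special \<Delta> q"
      note I = special_\<Delta>_coords[OF q]
      have ql: "q \<in> lat_pts \<Delta>" using q by (rule specialD)
      define r where "r = (\<lambda>i. (2 * q i - bil \<Delta> q v / 3 * v i) / 3)"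
      have r: "r 0 = 8 * (q 0 / 3) + 2 * q 1 + 2 * (3 * (q 2 / 3))" "r 1 = - 2 * (q 0 / 3) - 2 * (q 2 / 3)"
        "r 2 = - 2 * (3 * (q 0 / 3)) - 2 * q 1 - 4 * (q 2 / 3)"
        by (simp_all add: r_def 4 bil_\<Delta> field_simps)
      have r3: "r i = 0" if "i \<ge> 3" for i
        using ql that by (simp add: r_def 4 lat_pts_def rvec_def lvec_def \<Delta>_props(4))
      have "r i \<in> \<int>" for i
      proof -
        consider "i = 0" | "i = 1" | "i = 2" | "i \<ge> 3" by linarith
        then show ?thesis
        proof cases
          case 1
          show ?thesis unfolding 1 r by (intro Ints_add Ints_mult I) simp_all
        next
          case 2
          show ?thesis unfolding 2 r by (intro Ints_diff Ints_mult I) simp_all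
        next
          case 3
          show ?thesis unfolding 3 r by (intro Ints_diff Ints_mult I) simp_all
        qed (simp add: r3)
      qed
      then show "(\<lambda>i. (2 * q i - bil \<Delta> q v / 3 * v i) / 3) \<in> lat_pts \<Delta>"
        using r3 unfolding r_def[symmetric] by (auto simp: lat_pts_def rvec_def \<Delta>_props(4))
    qed
    ultimately show ?thesis using lp by (simp add: wall_root_def roots6_def)
  qed
qed

text \<open>With q = (3x, -y, 3w) the norm condition is 3 x^2 = y^2 + 3 w^2 + 2. Squaring the last
  wall inequality eliminates w and gives y (6x - 4y) \<le> 6; together with y \<le> x this leaves y
  = 0, impossible modulo 3, and y = x = 1.\<close>

lemma \<Delta>_chamber:
  assumes q: "\<forall>v\<in>set walls\<Delta>. bil \<Delta> q v \<le> 0" and s: "special \<Delta> q" and n: "bil \<Delta> q q = - 12"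
  shows "q = lvec [3, - 1, 0]"
proof -
  obtain x b w :: int where x: "q 0 / 3 = of_int x" "q 1 = of_int b" "q 2 / 3 = of_int w"
    using special_\<Delta>_coords[OF s] Ints_cases by metis
  define y where "y = - b"
  have q012: "q 0 = of_int (3 * x)" "q 1 = of_int (- y)" "q 2 = of_int (3 * w)"
    using x by (simp_all add: y_def)
  have "q 1 \<le> 0" "q 2 \<le> 0" "- 2 * q 0 - 6 * q 1 \<le> 0" "- 6 * q 0 - 6 * q 1 - 6 * q 2 \<le> 0"
    using q unfolding walls\<Delta>_def by (simp_all add: bil_\<Delta>)
  then have "real_of_int 0 \<le> of_int y" "real_of_int w \<le> of_int 0" "real_of_int y \<le> of_int x"
    "real_of_int (y - 3 * w) \<le> of_int (3 * x)"
    using q012 by simp_all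
  then have c: "0 \<le> y" "w \<le> 0" "y \<le> x" "y - 3 * w \<le> 3 * x" by (simp_all only: of_int_le_iff)
  have "of_int (- 18 * (x * x) + 6 * (y * y) + 18 * (w * w)) = (of_int (- 12) :: real)"
    using n unfolding bil_\<Delta> q012 by simp
  then have "- 18 * (x * x) + 6 * (y * y) + 18 * (w * w) = - 12" by (simp only: of_int_eq_iff)
  then have e: "3 * (x * x) = y * y + 3 * (w * w) + 2" by linarith
  have "(- 3 * w) * (- 3 * w) \<le> (3 * x - y) * (3 * x - y)" using c by (intro mult_mono) linarith+
  then have k: "y * (6 * x - 4 * y) \<le> 6" using e by (simp add: algebra_simps)
  have "y * (2 * y) \<le> y * (6 * x - 4 * y)" using c by (intro mult_left_mono) linarith+
  then have "y * y \<le> 3" using k by simp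
  then have "y \<le> 1"
    using mult_mono[of 2 y 2 y] by linarith
  moreover have "y \<noteq> 0"
  proof
    assume "y = 0"
    then have "3 * (x * x) = 3 * (w * w) + 2" using e by simp
    then show False by presburger
  qed
  ultimately have y: "y = 1" using c by linarith
  then have x1: "x = 1" using k c by simp
  then have "w * w = 0" using e y by simp
  then have "w = 0" by simp
  then have "q 0 = 3" "q 1 = - 1" "q 2 = 0" using q012 x1 y by simp_all
  moreover have "q \<in> rvec 3" using specialD(1)[OF s] by (auto simp: \<Delta>_props(4) dest: lat_ptsD)
  ultimately show ?thesis
    by (intro rvec_eqI[of _ 3]) (auto simp: lvec_rvec less_Suc_eq numeral_3_eq_3 numeral_2_eq_2)
qed

text \<open>The lattice point (4,-1,-1) lies in the open chamber and measures the height in the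
  descent, which ends at the only special vector of norm -12 in the chamber.\<close>

lemma coherent_\<Delta>:
  assumes "special \<Delta> q" "bil \<Delta> q q = - 12" "bil \<Delta> q (lvec [4,-1,-1]) < 0"
  shows "coherent \<Delta> (lvec [3,-1,0]) q"
  using assms
proof (induction "nat \<lfloor>- bil \<Delta> (lvec [4,-1,-1]) q\<rfloor>" arbitrary: q rule: less_induct)
  case less
  let ?a = "lvec [4,-1,-1]" and ?p = "lvec [3,-1,0]"
  show ?case
  proof (cases "\<forall>v\<in>set walls\<Delta>. bil \<Delta> q v \<le> 0")
    case True
    then have "q = ?p" using less.prems by (intro \<Delta>_chamber)
    then show ?thesis by (simp add: coherent_self)
  next
    case False
    then obtain v where v: "v \<in> set walls\<Delta>" and qv: "bil \<Delta> q v > 0" by auto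
    note r = wall_root_walls\<Delta>[OF v]
    let ?q = "refl \<Delta> v q"
    have v0: "bil \<Delta> v v \<noteq> 0" using wall_root_norm[OF r] by auto
    have s: "special \<Delta> ?q" by (rule refl_spec[OF \<Delta>_props(1) r less.prems(1)])
    have n: "bil \<Delta> ?q ?q = - 12" using bil_refl[OF \<Delta>_props(1) v0] less.prems(2) by simp
    have neg: "bil \<Delta> q q < 0" "bil \<Delta> ?a ?a < 0" "bil \<Delta> ?p ?p = - 12" "bil \<Delta> ?p ?a < 0"
      using less.prems(2) by (simp_all add: bil_\<Delta>)
    have ps: "special \<Delta> ?p"
    proof (rule specialI)
      show "?p \<in> lat_pts \<Delta>" by (auto intro!: lvec_lat_pts simp: \<Delta>_props(4))
      fix w assume w: "w \<in> lat_pts \<Delta>"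
      have "bil \<Delta> ?p w / 3 = - 2 * w 0 - 2 * w 1" by (simp add: bil_\<Delta>)
      also have "\<dots> \<in> \<int>" using lat_ptsD(1)[OF w] by (intro Ints_diff Ints_mult) simp_all
      finally show "bil \<Delta> ?p w / 3 \<in> \<int>" .
    qed
    have h: "bil \<Delta> ?q ?a < 0" by (rule refl_half[OF \<Delta>_props(2,1) r neg(1,2) less.prems(3)])
    then have h': "bil \<Delta> ?a ?q < 0" using sym_formD[OF \<Delta>_props(1), of ?a ?q] by simp
    have "bil \<Delta> ?a v < 0" using v unfolding walls\<Delta>_def by (auto simp: bil_\<Delta>)
    moreover have "?a \<in> lat_pts \<Delta>" by (auto intro!: lvec_lat_pts simp: \<Delta>_props(4))
    ultimately have "nat \<lfloor>- bil \<Delta> ?a ?q\<rfloor> < nat \<lfloor>- bil \<Delta> ?a q\<rfloor>"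
      using h' qv specialD(1)[OF less.prems(1)] by (intro refl_descent[OF \<Delta>_props(1) r])
    then have g: "coherent \<Delta> ?p ?q" by (rule less.hyps[OF _ s n h])
    have "bil \<Delta> ?a q < 0" using less.prems(3) sym_formD[OF \<Delta>_props(1), of ?a q] by simp
    then have pq: "bil \<Delta> ?p q < 0"
      using lorentzian_half[OF \<Delta>_props(2,1) neg(2,1) _ _ neg(4)] neg(3) by simp
    show ?thesis
      by (rule coherent_refl_step[OF \<Delta>_props(2,1,3) _ _ _ less.prems(1) pq r g])
        (use off_mirrors_\<Delta> ps neg(3) less.prems s n in auto)
  qed
qed

subsection \<open>Complements of orthogonal 2-roots\<close>

text \<open>\<open>\<iota>\<close> identifies \<open>L\<close> with the orthogonal complement in \<open>G\<close> of the pairwise orthogonal 2-roots \<open>S\<close>.\<close>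
definition compl_emb :: "lat \<Rightarrow> lat \<Rightarrow> ((nat \<Rightarrow> real) \<Rightarrow> nat \<Rightarrow> real) \<Rightarrow> (nat \<Rightarrow> real) set \<Rightarrow> bool" where
  "compl_emb L G \<iota> S \<longleftrightarrow>
     (\<forall>a x b y. \<iota> (lc a x b y) = lc a (\<iota> x) b (\<iota> y)) \<and>
     (\<forall>x\<in>lat_pts L. \<iota> x \<in> lat_pts G) \<and>
     (\<forall>x y. bil G (\<iota> x) (\<iota> y) = bil L x y) \<and>
     finite S \<and> S \<subseteq> lat_pts G \<and> (\<forall>a\<in>S. bil G a a = 2) \<and> (\<forall>a\<in>S. \<forall>b\<in>S. a \<noteq> b \<longrightarrow> bil G a b = 0) \<and>
     (\<forall>x. \<forall>a\<in>S. bil G (\<iota> x) a = 0) \<and>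
     (\<forall>u\<in>lat_pts G. (\<forall>a\<in>S. bil G u a = 0) \<longrightarrow> (\<exists>x\<in>lat_pts L. \<iota> x = u))"

lemma compl_embD:
  assumes "compl_emb L G \<iota> S"
  shows "\<iota> (lc a x b y) = lc a (\<iota> x) b (\<iota> y)" "x \<in> lat_pts L \<Longrightarrow> \<iota> x \<in> lat_pts G"
    "bil G (\<iota> x) (\<iota> y) = bil L x y" "finite S" "s \<in> S \<Longrightarrow> s \<in> lat_pts G" "s \<in> S \<Longrightarrow> bil G s s = 2"
    "s \<in> S \<Longrightarrow> t \<in> S \<Longrightarrow> s \<noteq> t \<Longrightarrow> bil G s t = 0" "s \<in> S \<Longrightarrow> bil G (\<iota> x) s = 0"
    "u \<in> lat_pts G \<Longrightarrow> (\<And>s. s \<in> S \<Longrightarrow> bil G u s = 0) \<Longrightarrow> \<exists>x\<in>lat_pts L. \<iota> x = u"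
  using assms unfolding compl_emb_def by auto

lemma compl_embI:
  assumes "\<And>a x b y. \<iota> (lc a x b y) = lc a (\<iota> x) b (\<iota> y)" "\<And>x. x \<in> lat_pts L \<Longrightarrow> \<iota> x \<in> lat_pts G"
    "\<And>x y. bil G (\<iota> x) (\<iota> y) = bil L x y" "finite S" "S \<subseteq> lat_pts G"
    "\<forall>a\<in>S. bil G a a = 2" "\<forall>a\<in>S. \<forall>b\<in>S. a \<noteq> b \<longrightarrow> bil G a b = 0"
    "\<And>x. \<forall>a\<in>S. bil G (\<iota> x) a = 0"
    "\<And>u. u \<in> lat_pts G \<Longrightarrow> \<forall>a\<in>S. bil G u a = 0 \<Longrightarrow> \<exists>x\<in>lat_pts L. \<iota> x = u"
  shows "compl_emb L G \<iota> S"
  using assms unfolding compl_emb_def by auto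

lemma compl_emb_id: "compl_emb L L (\<lambda>x. x) {}"
  by (simp add: compl_emb_def)

lemma compl_emb_trans:
  assumes LM: "compl_emb L M \<iota> S" and MG: "compl_emb M G \<kappa> T" and sym: "sym_form G"
  shows "compl_emb L G (\<lambda>x. \<kappa> (\<iota> x)) (T \<union> \<kappa> ` S)"
proof -
  note l = compl_embD[OF LM] and m = compl_embD[OF MG]
  have "bil G a b = 0" if "a \<in> T \<union> \<kappa> ` S" "b \<in> T \<union> \<kappa> ` S" "a \<noteq> b" for a b
    using that
  proof (elim UnE imageE)
    show "bil G a b = 0" if "a \<in> T" "b \<in> T" using m(7) that \<open>a \<noteq> b\<close> .
    show "bil G a b = 0" if "a \<in> T" "b = \<kappa> s" for s
      using m(8)[OF that(1), of s] sym_formD[OF sym, of a b] that(2) by simp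
    show "bil G a b = 0" if "a = \<kappa> s" "b \<in> T" for s using m(8)[OF that(2), of s] that(1) by simp
    show "bil G a b = 0" if "a = \<kappa> s" "s \<in> S" "b = \<kappa> t" "t \<in> S" for s t
      using l(7)[OF that(2,4)] that \<open>a \<noteq> b\<close> m(3)[of s t] by auto
  qed
  moreover have "\<exists>x\<in>lat_pts L. \<kappa> (\<iota> x) = u"
    if u: "u \<in> lat_pts G" "\<forall>a\<in>T \<union> \<kappa> ` S. bil G u a = 0" for u
  proof -
    obtain y where y: "y \<in> lat_pts M" "\<kappa> y = u" using m(9)[OF u(1)] u(2) by auto
    have "bil M y s = 0" if "s \<in> S" for s using u(2) that y(2) m(3)[of y s] by auto
    then obtain x where "x \<in> lat_pts L" "\<iota> x = y" using l(9)[OF y(1)] by blast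
    then show ?thesis using y by blast
  qed
  ultimately show ?thesis
    unfolding compl_emb_def using l(1-6,8) m(1-6,8) by auto
qed

lemma cat_lc: "cat n (lc a x b x') (lc a y b y') = lc a (cat n x y) b (cat n x' y')"
  by (auto simp: cat_def lc_def)

lemma compl_emb_osum:
  assumes 1: "compl_emb L G \<iota> S" and 2: "compl_emb M H \<kappa> T"
  shows "compl_emb (osum L M) (osum G H) (\<lambda>x. cat (fst G) (\<iota> (trunc (fst L) x)) (\<kappa> (shift (fst L) x)))
    ((\<lambda>a. cat (fst G) a (\<lambda>i. 0)) ` S \<union> cat (fst G) (\<lambda>i. 0) ` T)"
proof -
  note l = compl_embD[OF 1] and m = compl_embD[OF 2]
  let ?i = "\<lambda>x. cat (fst G) (\<iota> (trunc (fst L) x)) (\<kappa> (shift (fst L) x))"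
  let ?S = "(\<lambda>a. cat (fst G) a (\<lambda>i. 0)) ` S \<union> cat (fst G) (\<lambda>i. 0) ` T"
  have f1: "?i (lc a x b y) = lc a (?i x) b (?i y)" for a x b y
  proof -
    have "trunc (fst L) (lc a x b y) = lc a (trunc (fst L) x) b (trunc (fst L) y)"
      "shift (fst L) (lc a x b y) = lc a (shift (fst L) x) b (shift (fst L) y)"
      by (auto simp: trunc_def shift_def lc_def)
    then show ?thesis by (simp add: l(1) m(1) cat_lc)
  qed
  have f2: "?i x \<in> lat_pts (osum G H)" if "x \<in> lat_pts (osum L M)" for x
    using trunc_lat_pts[OF that] shift_lat_pts[OF that] by (intro cat_lat_pts l m)
  have f3: "bil (osum G H) (?i x) (?i y) = bil (osum L M) x y" for x y
    unfolding bil_cat l(3) m(3) bil_trunc bil_osum[of L M] ..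
  have f4: "finite ?S" using l(4) m(4) by simp
  have f5: "?S \<subseteq> lat_pts (osum G H)" using l(5) m(5) by (auto intro!: cat_lat_pts zero_lat_pts)
  have f6: "\<forall>a\<in>?S. bil (osum G H) a a = 2" using l(6) m(6) by (auto simp: bil_cat)
  have f7: "\<forall>a\<in>?S. \<forall>b\<in>?S. a \<noteq> b \<longrightarrow> bil (osum G H) a b = 0"
  proof (intro ballI impI)
    fix a b assume "a \<in> ?S" "b \<in> ?S" "a \<noteq> b"
    then show "bil (osum G H) a b = 0"
      by (elim UnE imageE) (auto simp: bil_cat intro: l(7) m(7))
  qed
  have f8: "\<forall>a\<in>?S. bil (osum G H) (?i x) a = 0" for x using l(8) m(8) by (auto simp: bil_cat)
  have f9: "\<exists>x\<in>lat_pts (osum L M). ?i x = u"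
    if u: "u \<in> lat_pts (osum G H)" "\<forall>a\<in>?S. bil (osum G H) u a = 0" for u
  proof -
    have "bil G (trunc (fst G) u) s = 0" if "s \<in> S" for s
    proof -
      have "bil (osum G H) u (cat (fst G) s (\<lambda>i. 0)) = 0" using u(2) that by blast
      then show ?thesis by (simp add: bil_cat_right bil_trunc)
    qed
    then obtain x where x: "x \<in> lat_pts L" "\<iota> x = trunc (fst G) u"
      using l(9)[OF trunc_lat_pts[OF u(1)]] by blast
    have "bil H (shift (fst G) u) t = 0" if "t \<in> T" for t
    proof -
      have "bil (osum G H) u (cat (fst G) (\<lambda>i. 0) t) = 0" using u(2) that by blast
      then show ?thesis by (simp add: bil_cat_right)
    qed
    then obtain y where y: "y \<in> lat_pts M" "\<kappa> y = shift (fst G) u"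
      using m(9)[OF shift_lat_pts[OF u(1)]] by blast
    have "trunc (fst L) (cat (fst L) x y) = x"
      using x(1) by (auto simp: trunc_def cat_def lat_pts_def rvec_def)
    moreover have "cat (fst G) (trunc (fst G) u) (shift (fst G) u) = u"
      by (auto simp: cat_def trunc_def shift_def)
    ultimately have "?i (cat (fst L) x y) = u" using x y by simp
    then show ?thesis using cat_lat_pts[OF x(1) y(1)] by blast
  qed
  show ?thesis by (rule compl_embI[OF f1 f2 f3 f4 f5 f6 f7 f8 f9])
qed

text \<open>Since the removed roots have norm 2, twice the projection of \<open>w\<close> to their
  complement is a lattice vector; the factor 2 is invertible modulo 3.\<close>

lemma compl_emb_spec:
  assumes e: "compl_emb L G \<iota> S" and sym: "sym_form G" and p: "special L p"
  shows "special G (\<iota> p)"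
proof (rule specialI)
  note d = compl_embD[OF e]
  show ip: "\<iota> p \<in> lat_pts G" using specialD(1)[OF p] by (rule d)
  fix w assume w: "w \<in> lat_pts G"
  define s where "s = (\<lambda>i. \<Sum>a\<in>S. bil G w a * a i)"
  define w' where "w' = lc 2 w (- 1) s"
  have s: "s \<in> lat_pts G" unfolding s_def using d(5) bil_Ints[OF w] by (intro lat_pts_sum) auto
  have w': "w' \<in> lat_pts G" unfolding w'_def using w s by (intro lc_lat_pts) auto
  have "bil G s b = 2 * bil G w b" if b: "b \<in> S" for b
  proof -
    have "bil G s b = (\<Sum>a\<in>S. bil G w a * bil G a b)" unfolding s_def by (rule bil_sum_left)
    also have "\<dots> = (\<Sum>a\<in>S. if a = b then 2 * bil G w a else 0)"
      using d(6,7) b by (intro sum.cong) auto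
    also have "\<dots> = 2 * bil G w b" using d(4) b by simp
    finally show ?thesis .
  qed
  then have "bil G w' b = 0" if "b \<in> S" for b using that by (simp add: w'_def bil_lc_left)
  then obtain x where x: "x \<in> lat_pts L" "\<iota> x = w'" using d(9)[OF w'] by blast
  have "bil G s (\<iota> p) = 0"
    unfolding s_def bil_sum_left
  proof (intro sum.neutral ballI)
    fix a assume "a \<in> S"
    then show "bil G w a * bil G a (\<iota> p) = 0" using d(8)[of a p] sym_formD[OF sym, of a "\<iota> p"] by simp
  qed
  then have "bil G (\<iota> p) w' = 2 * bil G (\<iota> p) w"
    using sym_formD[OF sym, of "\<iota> p" s] by (simp add: w'_def bil_lc_right)
  moreover have "bil G (\<iota> p) w' = bil L p x" using d(3)[of p x] x(2) by simp
  moreover obtain k :: int where "bil L p x = 3 * of_int k" using p x(1) by (auto simp: special_def)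
  moreover obtain m :: int where m: "bil G (\<iota> p) w = of_int m" using bil_Ints[OF ip w] Ints_cases by metis
  ultimately have "real_of_int (2 * m) = of_int (3 * k)" by simp
  then have "2 * m = 3 * k" by (simp only: of_int_eq_iff)
  then have "3 dvd m" by presburger
  then show "bil G (\<iota> p) w / 3 \<in> \<int>" using m by (auto elim!: dvdE)
qed

lemma compl_emb_R6:
  assumes e: "compl_emb L G \<iota> S" and sym: "sym_form G"
  shows "\<iota> ` roots6 L = {u \<in> roots6 G. \<forall>a\<in>S. bil G u a = 0}"
proof -
  note d = compl_embD[OF e]
  have "\<iota> u \<in> {u \<in> roots6 G. \<forall>a\<in>S. bil G u a = 0}" if "u \<in> roots6 L" for u
    using that compl_emb_spec[OF e sym] d(3,8) by (auto simp: roots6_def)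
  moreover have "u \<in> \<iota> ` roots6 L" if u: "u \<in> roots6 G" "\<forall>a\<in>S. bil G u a = 0" for u
  proof -
    have us: "special G u" "bil G u u = 6" using u(1) by (auto simp: roots6_def)
    obtain x where x: "x \<in> lat_pts L" "\<iota> x = u" using d(9)[OF specialD(1)[OF us(1)]] u(2) by blast
    have "special L x"
    proof (rule specialI[OF x(1)])
      fix w assume "w \<in> lat_pts L"
      then have "bil G u (\<iota> w) / 3 \<in> \<int>" by (intro specialD(2)[OF us(1)] d(2))
      then show "bil L x w / 3 \<in> \<int>" using d(3)[of x w] x(2) by simp
    qed
    moreover have "bil L x x = 6" using d(3)[of x x] x(2) us(2) by simp
    ultimately show ?thesis using x(2) by (auto simp: roots6_def)
  qed
  ultimately show ?thesis by blast
qed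

lemma compl_emb_inj:
  assumes e: "compl_emb L G \<iota> S" and dual_period: "dual_period 3 L" and "x \<in> lat_pts L" "y \<in> lat_pts L" "\<iota> x = \<iota> y"
  shows "x = y"
proof -
  note d = compl_embD[OF e]
  have "bil L (lc 1 x (- 1) y) w = 0" for w
  proof -
    have "bil L (lc 1 x (- 1) y) w = bil G (\<iota> (lc 1 x (- 1) y)) (\<iota> w)" by (simp add: d(3))
    also have "\<dots> = 0" by (simp add: d(1) assms(5) bil_lc_left)
    finally show ?thesis .
  qed
  then have "lc 1 x (- 1) y i = 0" if "i < fst L" for i using dual_period_nondeg[OF dual_period] that by blast
  then show ?thesis using assms(3,4)
    by (intro rvec_eqI[of _ "fst L"]) (auto simp: lc_def dest: lat_ptsD)
qed

lemma compl_emb_symm_lor: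
  assumes e: "compl_emb L G \<iota> S" and G: "sym_form G" "lorentzian G" and dual_period: "dual_period 3 L"
  shows "sym_form L" "lorentzian L"
proof -
  note d = compl_embD[OF e]
  show "sym_form L" unfolding sym_form_def using d(3) sym_formD[OF G(1)] by metis
  show "lorentzian L"
    unfolding lorentzian_def
  proof (intro allI impI conjI)
    fix x y assume "bil L x x < 0" "bil L x y = 0"
    then have *: "bil G (\<iota> y) (\<iota> y) \<ge> 0 \<and> (bil G (\<iota> y) (\<iota> y) = 0 \<longrightarrow> (\<forall>i<fst G. \<iota> y i = 0))"
      using G(2) d(3) unfolding lorentzian_def by metis
    then show "bil L y y \<ge> 0" by (simp add: d(3))
    fix i assume "bil L y y = 0" and i: "i < fst L"
    then have z: "\<forall>i<fst G. \<iota> y i = 0" using * by (simp add: d(3))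
    have "bil L y w = 0" for w
    proof -
      have "bil L y w = bil G (\<iota> y) (\<iota> w)" by (simp add: d(3))
      also have "\<dots> = bil G (\<lambda>i. 0) (\<iota> w)" using z by (intro bil_cong) auto
      finally show ?thesis by simp
    qed
    then show "y i = 0" using dual_period_nondeg[OF dual_period] i by blast
  qed
qed

text \<open>A 6-root \<open>u\<close> of \<open>G\<close> outside \<open>L\<close> whose mirror separates two points of \<open>L\<close> has a projection to
  \<open>L\<close> of norm \<open>6 - \<Sum>(u\<cdot>a)\<^sup>2/2 > 0\<close> with all \<open>u\<cdot>a\<close> divisible by 3, so exactly one \<open>u\<cdot>a\<close> is nonzero and
  the reflection in that \<open>a\<close> pairs such roots up.\<close>
lemma compl_emb_sep_parity:
  assumes e: "compl_emb L G \<iota> S" and G: "sym_form G" "lorentzian G" and dual_period: "dual_period 3 L"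
    and x: "bil L x x < 0" "bil L y y < 0" "bil L x y < 0" and fin: "finite (separating G (\<iota> x) (\<iota> y))"
  shows "even (card (separating G (\<iota> x) (\<iota> y))) \<longleftrightarrow> even (card (separating L x y))"
proof -
  note d = compl_embD[OF e]
  let ?T = "separating G (\<iota> x) (\<iota> y)"
  define A where "A = {u \<in> ?T. \<forall>a\<in>S. bil G u a = 0}"
  define B where "B = {u \<in> ?T. \<exists>a\<in>S. bil G u a \<noteq> 0}"
  have T: "?T = A \<union> B" "A \<inter> B = {}" by (auto simp: A_def B_def)
  have finAB: "finite A" "finite B" using fin T by auto
  have "A = \<iota> ` separating L x y"
  proof -
    have "A = {u \<in> \<iota> ` roots6 L. bil G (\<iota> x) u > 0 \<and> bil G (\<iota> y) u < 0}"
      unfolding compl_emb_R6[OF e G(1)] A_def separating_def by auto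
    also have "\<dots> = \<iota> ` separating L x y" unfolding separating_def by (auto simp: d(3))
    finally show ?thesis .
  qed
  moreover have "inj_on \<iota> (separating L x y)"
    using compl_emb_inj[OF e dual_period] by (auto simp: inj_on_def separating_def roots6_def dest!: specialD(1))
  ultimately have cA: "card A = card (separating L x y)" by (simp add: card_image)
  have uniq: "bil G u b = 0" if u: "u \<in> ?T" and a: "a \<in> S" "bil G u a \<noteq> 0" and b: "b \<in> S" "b \<noteq> a" for u a b
  proof (rule ccontr)
    assume nb: "bil G u b \<noteq> 0"
    have us: "special G u" "bil G u u = 6" "bil G (\<iota> x) u > 0" "bil G (\<iota> y) u < 0"
      using u by (auto simp: separating_def roots6_def)
    \<comment> \<open>Half the pairing is the projection coefficient for a root of norm 2, so
      \<open>v\<close> is the projection of \<open>u\<close> to the complement of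
      \<open>S\<close>.\<close>
    define s where "s = (\<lambda>i. \<Sum>a\<in>S. (- bil G u a / 2) * a i)"
    define v where "v = lc 1 u 1 s"
    have sa: "bil G s c = - bil G u c" if c: "c \<in> S" for c
    proof -
      have "bil G s c = (\<Sum>a\<in>S. (- bil G u a / 2) * bil G a c)" unfolding s_def by (rule bil_sum_left)
      also have "\<dots> = (\<Sum>a\<in>S. if a = c then - bil G u a else 0)"
        using d(6,7) c by (intro sum.cong) auto
      also have "\<dots> = - bil G u c" using d(4) c by simp
      finally show ?thesis .
    qed
    have sw: "bil G s w = (\<Sum>a\<in>S. (- bil G u a / 2) * bil G a w)" for w
      unfolding s_def by (rule bil_sum_left)
    have s\<iota>: "bil G s (\<iota> w) = 0" for w
      unfolding sw
    proof (intro sum.neutral ballI)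
      fix a assume "a \<in> S"
      then show "(- bil G u a / 2) * bil G a (\<iota> w) = 0" using d(8)[of a w] sym_formD[OF G(1), of a "\<iota> w"] by simp
    qed
    have v\<iota>: "bil G v (\<iota> w) = bil G (\<iota> w) u" for w
      using s\<iota>[of w] sym_formD[OF G(1), of u "\<iota> w"] by (simp add: v_def bil_lc_left)
    have su: "bil G s u = - (\<Sum>a\<in>S. (bil G u a)\<^sup>2) / 2"
    proof -
      have "(- bil G u a / 2) * bil G a u = - ((bil G u a)\<^sup>2 / 2)" for a
        using sym_formD[OF G(1), of a u] by (simp add: power2_eq_square)
      then have "(\<Sum>a\<in>S. (- bil G u a / 2) * bil G a u) = (\<Sum>a\<in>S. - ((bil G u a)\<^sup>2 / 2))"
        by (intro sum.cong HOL.refl)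
      then have "bil G s u = (\<Sum>a\<in>S. - ((bil G u a)\<^sup>2 / 2))" by (rule trans[OF sw])
      then show ?thesis by (simp add: sum_negf sum_divide_distrib)
    qed
    have ss: "bil G s s = (\<Sum>a\<in>S. (bil G u a)\<^sup>2) / 2"
    proof -
      have "bil G s s = (\<Sum>a\<in>S. (- bil G u a / 2) * bil G s a)"
      proof -
        have "(- bil G u a / 2) * bil G a s = (- bil G u a / 2) * bil G s a" for a
          using sym_formD[OF G(1), of a s] by simp
        then have "(\<Sum>a\<in>S. (- bil G u a / 2) * bil G a s) = (\<Sum>a\<in>S. (- bil G u a / 2) * bil G s a)"
          by (intro sum.cong HOL.refl)
        then show ?thesis by (rule trans[OF sw])
      qed
      also have "\<dots> = (\<Sum>a\<in>S. (bil G u a)\<^sup>2 / 2)"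
        by (intro sum.cong) (auto simp: sa power2_eq_square)
      finally show ?thesis by (simp add: sum_divide_distrib)
    qed
    have vv: "bil G v v = 6 - (\<Sum>a\<in>S. (bil G u a)\<^sup>2) / 2"
      using us(2) su ss sym_formD[OF G(1), of u s] by (simp add: v_def bil_lc_left bil_lc_right)
    \<comment> \<open>If \<open>v\<close> were isotropic or negative, it would have the same sign on
      a whole half-cone, but it separates \<open>x\<close> from \<open>y\<close>.\<close>
    have "bil G v v > 0"
    proof (rule ccontr)
      assume "\<not> bil G v v > 0"
      then have "bil G v (\<iota> x) < 0"
        using lorentzian_half[OF G(2,1), of "\<iota> y" "\<iota> x" v] x us(3,4) v\<iota> sym_formD[OF G(1), of "\<iota> y" "\<iota> x"]
        by (simp add: d(3))
      then show False using v\<iota>[of x] us(3) by simp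
    qed
    \<comment> \<open>Every nonzero pairing is a multiple of 3 and lowers the norm 6 by at least
      9/2; two of them would make it negative.\<close>
    moreover have nine: "(bil G u c)\<^sup>2 \<ge> 9" if c: "c \<in> S" "bil G u c \<noteq> 0" for c
    proof -
      obtain k :: int where k: "bil G u c = 3 * of_int k" using us(1) d(5)[OF c(1)] by (auto simp: special_def)
      then have "k \<noteq> 0" using c(2) by auto
      then have "k\<^sup>2 \<ge> 1" by (simp add: int_one_le_iff_zero_less)
      then have "real_of_int (k\<^sup>2) \<ge> 1" by linarith
      then show ?thesis by (simp add: k power_mult_distrib)
    qed
    moreover have "(\<Sum>a\<in>{a, b}. (bil G u a)\<^sup>2) \<le> (\<Sum>a\<in>S. (bil G u a)\<^sup>2)"
      using a b d(4) by (intro sum_mono2) auto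
    then have "(bil G u a)\<^sup>2 + (bil G u b)\<^sup>2 \<le> (\<Sum>a\<in>S. (bil G u a)\<^sup>2)" using b(2) by (simp add: add.commute)
    ultimately show False using nine[OF a] nine[OF b(1) nb] vv by linarith
  qed
  define sel where "sel u = (SOME a. a \<in> S \<and> bil G u a \<noteq> 0)" for u
  have sel: "sel u \<in> S \<and> bil G u (sel u) \<noteq> 0" if "u \<in> B" for u
  proof -
    have "\<exists>a. a \<in> S \<and> bil G u a \<noteq> 0" using that by (auto simp: B_def)
    then show ?thesis unfolding sel_def by (rule someI_ex)
  qed
  have seleq: "sel u = a" if "u \<in> B" "a \<in> S" "bil G u a \<noteq> 0" for u a
    using uniq[of u a "sel u"] sel[OF that(1)] that by (auto simp: B_def)
  define f where "f u = refl G (sel u) u" for u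
  have wall_root: "wall_root G a" if "a \<in> S" for a using that d(5,6) by (simp add: wall_root_def)
  have fa: "bil G (f u) (sel u) = - bil G u (sel u)" if "u \<in> B" for u
    unfolding f_def using sel[OF that] d(6) by (intro bil_refl_self) simp
  have fB: "f u \<in> B" if u: "u \<in> B" for u
  proof -
    have a: "sel u \<in> S" "bil G u (sel u) \<noteq> 0" using sel[OF u] by auto
    have uR: "u \<in> roots6 G" "bil G (\<iota> x) u > 0" "bil G (\<iota> y) u < 0" using u by (auto simp: B_def separating_def)
    have "bil G (\<iota> w) (f u) = bil G (\<iota> w) u" for w
      using d(8)[OF a(1)] by (simp add: f_def refl_lc bil_lc_right)
    then have "f u \<in> ?T" using uR refl_R6[OF G(1) wall_root[OF a(1)] uR(1)] by (simp add: separating_def f_def)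
    then show ?thesis using a fa[OF u] by (auto simp: B_def intro!: bexI[of _ "sel u"])
  qed
  have "even (card B)"
  proof (rule even_card_involution[of _ f])
    show "f u \<in> B" if "u \<in> B" for u by (rule fB[OF that])
    show "f u \<noteq> u" if "u \<in> B" for u using fa[OF that] sel[OF that] by auto
    show "f (f u) = u" if u: "u \<in> B" for u
    proof -
      have "sel (f u) = sel u" using sel[OF u] fa[OF u] by (intro seleq[OF fB[OF u]]) auto
      then show ?thesis using sel[OF u] d(6) by (simp add: f_def refl_refl)
    qed
  qed (rule finAB)
  moreover have "card ?T = card A + card B" unfolding T(1) using finAB T(2) by (rule card_Un_disjoint)
  ultimately show ?thesis using cA by simp
qed

subsection \<open>Chirality\<close>

lemma act_lc: "act n A (lc a x b y) = lc a (act n A x) b (act n A y)"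
  by (auto simp: act_def lc_def sum.distrib sum_distrib_left algebra_simps)

text \<open>\<open>is_aut\<close> speaks of lattice points only; the points of cells are real
  vectors.\<close>

lemma act_iso:
  assumes aut: "is_aut L A" and sym: "sym_form L" and x: "x \<in> rvec (fst L)" and y: "y \<in> rvec (fst L)"
  shows "bil L (act (fst L) A x) (act (fst L) A y) = bil L x y"
proof -
  let ?n = "fst L" and ?\<phi> = "act (fst L) A"
  have u: "bil L (?\<phi> (unit i)) (?\<phi> (unit j)) = bil L (unit i) (unit j)" if "i < ?n" "j < ?n" for i j
    using aut that by (simp add: is_aut_def unit_lat_pts)
  have ex: "?\<phi> z = (\<lambda>i. \<Sum>j<?n. z j * ?\<phi> (unit j) i)" if "z \<in> rvec ?n" for z
    by (subst rvec_expand[OF that]) (rule linear_expand[OF act_lc])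
  have "bil L (?\<phi> x) (?\<phi> y) = (\<Sum>i<?n. x i * bil L (?\<phi> y) (?\<phi> (unit i)))"
    by (subst ex[OF x]) (simp only: bil_sum_left sym_formD[OF sym, of "?\<phi> (unit _)" "?\<phi> y"])
  also have "\<dots> = (\<Sum>i<?n. x i * (\<Sum>j<?n. y j * bil L (?\<phi> (unit j)) (?\<phi> (unit i))))"
    by (subst ex[OF y]) (simp only: bil_sum_left)
  also have "\<dots> = (\<Sum>i<?n. x i * (\<Sum>j<?n. y j * bil L (unit j) (unit i)))"
    by (intro sum.cong HOL.refl) (simp add: u)
  also have "\<dots> = (\<Sum>i<?n. x i * bil L y (unit i))"
    by (subst (2) rvec_expand[OF y]) (simp only: bil_sum_left)
  also have "\<dots> = bil L x y"
    by (subst (2) rvec_expand[OF x]) (simp only: bil_sum_left sym_formD[OF sym, of "unit _" y])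
  finally show ?thesis .
qed

lemma aut_spec:
  assumes aut: "is_aut L A" and p: "special L p"
  shows "special L (act (fst L) A p)"
proof (rule specialI)
  have bij: "bij_betw (act (fst L) A) (lat_pts L) (lat_pts L)" using aut by (simp add: is_aut_def)
  show "act (fst L) A p \<in> lat_pts L" using bij specialD(1)[OF p] by (auto simp: bij_betw_def)
  fix w assume "w \<in> lat_pts L"
  then obtain w' where w': "w' \<in> lat_pts L" "w = act (fst L) A w'" using bij by (auto simp: bij_betw_def)
  then have "bil L (act (fst L) A p) w = bil L p w'" using aut specialD(1)[OF p] by (simp add: is_aut_def)
  then show "bil L (act (fst L) A p) w / 3 \<in> \<int>" using specialD(2)[OF p w'(1)] by simp
qed

lemma aut_sep_card:
  assumes aut: "is_aut L A" and sym: "sym_form L" and x: "x \<in> rvec (fst L)" and y: "y \<in> rvec (fst L)"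
  shows "card (separating L (act (fst L) A x) (act (fst L) A y)) = card (separating L x y)"
proof -
  let ?\<phi> = "act (fst L) A"
  have bij: "bij_betw ?\<phi> (lat_pts L) (lat_pts L)" using aut by (simp add: is_aut_def)
  have iso: "bil L (?\<phi> z) (?\<phi> u) = bil L z u" if "z \<in> rvec (fst L)" "u \<in> lat_pts L" for z u
    using act_iso[OF aut sym that(1) lat_ptsD(2)[OF that(2)]] .
  have R: "?\<phi> u \<in> roots6 L \<longleftrightarrow> u \<in> roots6 L" if u: "u \<in> lat_pts L" for u
  proof
    assume "u \<in> roots6 L"
    then show "?\<phi> u \<in> roots6 L" using aut_spec[OF aut] iso[OF lat_ptsD(2)[OF u] u] by (simp add: roots6_def)
  next
    assume a: "?\<phi> u \<in> roots6 L"
    have "special L u"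
    proof (rule specialI[OF u])
      fix w assume w: "w \<in> lat_pts L"
      then have "bil L (?\<phi> u) (?\<phi> w) / 3 \<in> \<int>"
        using a bij by (intro specialD(2)) (auto simp: roots6_def bij_betw_def)
      then show "bil L u w / 3 \<in> \<int>" using iso[OF lat_ptsD(2)[OF u] w] by simp
    qed
    then show "u \<in> roots6 L" using a iso[OF lat_ptsD(2)[OF u] u] by (simp add: roots6_def)
  qed
  have sub: "separating L a b \<subseteq> lat_pts L" for a b by (auto simp: separating_def roots6_def dest: specialD)
  have "separating L (?\<phi> x) (?\<phi> y) = ?\<phi> ` separating L x y"
  proof
    show "?\<phi> ` separating L x y \<subseteq> separating L (?\<phi> x) (?\<phi> y)"
      using R iso x y sub[of x y] by (auto simp: separating_def)
    show "separating L (?\<phi> x) (?\<phi> y) \<subseteq> ?\<phi> ` separating L x y"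
    proof
      fix v assume v: "v \<in> separating L (?\<phi> x) (?\<phi> y)"
      then have "v \<in> lat_pts L" using sub by blast
      then obtain u where u: "u \<in> lat_pts L" "v = ?\<phi> u" using bij by (auto simp: bij_betw_def)
      then have "u \<in> separating L x y" using v R iso x y by (auto simp: separating_def)
      then show "v \<in> ?\<phi> ` separating L x y" using u by blast
    qed
  qed
  moreover have "inj_on ?\<phi> (separating L x y)"
    using bij sub[of x y] by (auto simp: bij_betw_def intro: inj_on_subset)
  ultimately show ?thesis by (simp add: card_image)
qed

lemma same_sign_on_connected:
  fixes g :: "(nat \<Rightarrow> real) \<Rightarrow> real"
  assumes "connected K" "continuous_on K g" "\<And>z. z \<in> K \<Longrightarrow> g z \<noteq> 0" "x \<in> K" "y \<in> K" "g x > 0"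
  shows "g y > 0"
proof (rule ccontr)
  assume "\<not> g y > 0"
  have "connected (g ` K)" using assms by (intro connected_continuous_image)
  then have "0 \<in> g ` K"
    using assms(4-6) \<open>\<not> g y > 0\<close> connectedD_interval[of "g ` K" "g y" "g x" 0] by auto
  then show False using assms(3) by auto
qed

lemma continuous_bil_left: "continuous_on K (\<lambda>x. bil L x u)"
  unfolding bil_def
  by (intro continuous_intros continuous_on_subset[OF continuous_on_product_coordinates subset_UNIV])

text \<open>If \<open>A\<close> preserves a cell, an even number of 6-mirrors separate \<open>p\<close> and \<open>A p\<close>; being
  \<open>\<int>/3\<close>-reversing, \<open>A\<close> also takes \<open>p/3\<close> to the opposite class in the discriminant group.\<close>
lemma chiral_of_emb:
  assumes e: "compl_emb L G \<iota> S" and G: "sym_form G" "lorentzian G" "dual_period 3 G" and dual_period: "dual_period 3 L"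
    and p: "special L p" "bil L p p = - 12"
    and offG: "\<And>q. special G q \<Longrightarrow> bil G q q = - 12 \<Longrightarrow> off_mirrors G q"
    and P: "special G P" "bil G P P = - 12" "bil G P (\<iota> p) < 0" "coherent G P (\<iota> p)"
    and gd: "\<And>A. is_aut L A \<Longrightarrow> bil G P (\<iota> (act (fst L) A p)) < 0 \<Longrightarrow> coherent G P (\<iota> (act (fst L) A p))"
  shows "\<not> achiral L"
proof
  assume "achiral L"
  then obtain A K where aut: "is_aut L A" and rev: "z3_reversing L A" and K: "K \<in> cell_lifts L"
    and AK: "act (fst L) A ` K = K" unfolding achiral_def by blast
  note d = compl_embD[OF e]
  note L = compl_emb_symm_lor[OF e G(1,2) dual_period]
  let ?\<phi> = "act (fst L) A"
  obtain x where x: "x \<in> neg_cone L - mirrors L" and Kx: "K = connected_component_set (neg_cone L - mirrors L) x"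
    using K unfolding cell_lifts_def by blast
  have xK: "x \<in> K" using x by (simp add: Kx)
  have conn: "connected K" by (simp add: Kx)
  have Ksub: "K \<subseteq> neg_cone L - mirrors L" unfolding Kx by (rule connected_component_subset)
  have Kneg: "bil L z z < 0" "z \<in> rvec (fst L)" if "z \<in> K" for z
    using Ksub that by (auto simp: neg_cone_def)
  have Koff: "bil L z u \<noteq> 0" if z: "z \<in> K" and u: "u \<in> roots6 L" for z u
  proof
    assume z0: "bil L z u = 0"
    have us: "special L u" "bil L u u = 6" using u by (auto simp: roots6_def)
    have "u \<in> refl_vecs L" using us by (auto simp: refl_vecs_def special_def)
    then have w: "refl L u \<circ> id \<in> weyl L" by (intro weyl.intros)
    have "{x \<in> rvec (fst L). bil L x u = 0} \<in> {{x \<in> rvec (fst L). bil L x a = 0} | a.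
        a \<in> rvec (fst L) \<and> bil L a a \<noteq> 0 \<and> (\<exists>w\<in>weyl L. \<forall>x\<in>rvec (fst L). w x = refl L a x)}"
      using us lat_ptsD(2)[OF specialD(1)[OF us(1)]] w
      by (intro CollectI exI[of _ u] conjI HOL.refl bexI[of _ "refl L u \<circ> id"]) auto
    then have "z \<in> mirrors L" unfolding mirrors_def using z0 Kneg(2)[OF z] by blast
    then show False using Ksub z by blast
  qed
  define y where "y = ?\<phi> x"
  have yK: "y \<in> K" using AK xK unfolding y_def by blast
  have sepxy: "separating L a b = {}" if ab: "a \<in> K" "b \<in> K" for a b
  proof -
    have "bil L b u > 0" if "u \<in> roots6 L" "bil L a u > 0" for u
      using same_sign_on_connected[OF conn continuous_bil_left _ ab that(2)] Koff that(1) by blast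
    then show ?thesis by (force simp: separating_def)
  qed
  have pr: "p \<in> rvec (fst L)" using specialD(1)[OF p(1)] by (rule lat_ptsD)
  have nzp: "bil L z p \<noteq> 0" if "z \<in> K" for z
    using L(2) Kneg(1)[OF that] p(2) unfolding lorentzian_def by force
  have xyp: "bil L x p > 0 \<longleftrightarrow> bil L y p > 0"
    using same_sign_on_connected[OF conn continuous_bil_left] nzp xK yK by blast
  \<comment> \<open>The cell may lie in the half-cone opposite to \<open>p\<close>; a common sign
    moves \<open>x\<close> and its image to the half of \<open>p\<close>.\<close>
  define s :: real where "s = (if bil L x p > 0 then - 1 else 1)"
  define x' where "x' = (\<lambda>i. s * x i)"
  define y' where "y' = (\<lambda>i. s * y i)"
  have s: "s * s = 1" "s = 1 \<or> s = - 1" by (auto simp: s_def)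
  have x'p: "bil L x' p < 0" "bil L y' p < 0"
    using nzp[OF xK] nzp[OF yK] xyp by (auto simp: x'_def y'_def bil_scale_left s_def)
  have sq: "bil L (\<lambda>i. s * z i) (\<lambda>i. s * z i) = bil L z z" for z
    using s(1) by (simp add: bil_scale_left bil_scale_right flip: mult.assoc)
  have neg: "bil L x' x' < 0" "bil L y' y' < 0"
    using Kneg xK yK by (simp_all add: x'_def y'_def sq)
  have x'r: "x' \<in> rvec (fst L)" using Kneg(2)[OF xK] by (auto simp: x'_def rvec_def)
  have y': "y' = ?\<phi> x'"
    unfolding y'_def y_def x'_def by (auto simp: act_def sum_distrib_left algebra_simps)
  have off_mirrors: "off_mirrors L x'" "off_mirrors L y'"
    using neg Koff[OF xK] Koff[OF yK] s(2) by (auto simp: off_mirrors_def x'_def y'_def bil_scale_left)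
  have separating': "separating L x' y' = {}"
    using s(2)
  proof
    assume "s = 1"
    then show ?thesis using sepxy[OF xK yK] by (simp add: x'_def y'_def)
  next
    assume "s = - 1"
    then have "separating L x' y' = separating L y x" by (auto simp: x'_def y'_def bil_minus_left separating_def)
    then show ?thesis using sepxy[OF yK xK] by simp
  qed
  define q where "q = ?\<phi> p"
  have q: "special L q" "bil L q q = - 12"
    unfolding q_def using aut_spec[OF aut p(1)] act_iso[OF aut L(1) pr pr] p(2) by auto
  have qr: "q \<in> rvec (fst L)" using specialD(1)[OF q(1)] by (rule lat_ptsD)
  have y'q: "bil L y' q < 0" using act_iso[OF aut L(1) x'r pr] x'p(1) by (simp add: y' q_def)
  have pneg: "bil L p p < 0" "bil L q q < 0" using p(2) q(2) by auto
  have qy': "bil L q y' < 0" using y'q sym_formD[OF L(1), of q y'] by simp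
  have qp: "bil L q p < 0" by (rule lorentzian_half[OF L(2,1) neg(2) pneg(1) x'p(2) less_imp_le[OF pneg(2)] qy'])
  then have pq: "bil L p q < 0" using sym_formD[OF L(1), of q p] by simp
  have px': "bil L p x' < 0" "bil L p y' < 0"
    using x'p sym_formD[OF L(1), of p x'] sym_formD[OF L(1), of p y'] by simp_all
  have x'q: "bil L x' q < 0" by (rule lorentzian_half[OF L(2,1) pneg pq less_imp_le[OF neg(1)] x'p(1)])
  have qx': "bil L q x' < 0" using x'q sym_formD[OF L(1), of q x'] by simp
  have x'y': "bil L x' y' < 0"
    by (rule lorentzian_half[OF L(2,1) pneg(1) neg(2) px'(2) less_imp_le[OF neg(1)] x'p(1)])
  note fin = finite_sep[OF L(2,1) dual_period]
  have offp: "off_mirrors L z" if z: "special L z" "bil L z z = - 12" for z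
  proof -
    have o: "off_mirrors G (\<iota> z)" using compl_emb_spec[OF e G(1) z(1)] z(2) d(3) by (intro offG) auto
    have "bil L z u \<noteq> 0" if "u \<in> roots6 L" for u
    proof -
      have "\<iota> u \<in> roots6 G" using compl_emb_R6[OF e G(1)] that by blast
      then show ?thesis using o d(3)[of z u] by (auto simp: off_mirrors_def)
    qed
    then show ?thesis using z(2) by (simp add: off_mirrors_def)
  qed
  \<comment> \<open>No 6-mirror lies between x' and y' = A x', and A maps the mirrors between x' and
    p to those between y' and q. Hence the legs from x' to p and from x' to q have equal
    parity.\<close>
  have "even (card (separating L x' q)) \<longleftrightarrow> even (card (separating L y' q))"
    using separating_parity_add[OF off_mirrors(1,2) offp[OF q]] fin neg pneg x'y' y'q x'q separating' by simp
  also have "\<dots> \<longleftrightarrow> even (card (separating L p x'))"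
    using aut_sep_card[OF aut L(1) x'r pr] separating_sym_card[of L p x'] by (simp add: y' q_def)
  finally have evL: "even (card (separating L p q))"
    using separating_parity_add[OF offp[OF p] off_mirrors(1) offp[OF q]] fin neg pneg px' x'q pq by blast

  let ?p = "\<iota> p" and ?q = "\<iota> q"
  have sG: "special G ?p" "special G ?q" "bil G ?p ?p = - 12" "bil G ?q ?q = - 12" "bil G ?p ?q < 0"
    using compl_emb_spec[OF e G(1)] p q pq d(3) by auto
  note finG = finite_sep[OF G(2,1,3)]
  have nG: "bil G P P < 0" "bil G ?p ?p < 0" "bil G ?q ?q < 0" using P(2) sG by auto
  have evG: "even (card (separating G ?p ?q))"
    using compl_emb_sep_parity[OF e G(1,2) dual_period pneg pq finG] sG nG evL by simp
  have "bil G P ?q < 0"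
    by (rule lorentzian_half[OF G(2,1) nG(2,3) sG(5) less_imp_le[OF nG(1)] P(3)])
  then have gq: "coherent G P ?q" and Pq: "bil G P ?q < 0" using gd[OF aut] by (simp_all add: q_def)
  have pP: "bil G ?p P < 0" using P(3) sym_formD[OF G(1), of ?p P] by simp
  have "even (card (separating G ?p ?q)) \<longleftrightarrow> (even (card (separating G ?p P)) \<longleftrightarrow> even (card (separating G P ?q)))"
    using separating_parity_add[of G ?p P ?q] offG sG P finG nG pP Pq by auto
  then have par: "even (card (separating G P ?p)) \<longleftrightarrow> even (card (separating G P ?q))"
    using evG separating_sym_card[of G ?p P] by simp
  \<comment> \<open>Both vectors are compared with the common base point \<open>P\<close>; equal
    parity puts them into the same class up to the same sign.\<close>
  have diff: "(\<lambda>i. (?q i - ?p i) / 3) \<in> lat_pts G"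
  proof (cases "even (card (separating G P ?p))")
    case True
    then have a: "(\<lambda>i. (?p i - P i) / 3) \<in> lat_pts G" "(\<lambda>i. (?q i - P i) / 3) \<in> lat_pts G"
      using P(4) gq par by (auto simp: coherent_def)
    have "(\<lambda>i. (?q i - ?p i) / 3) = lc 1 (\<lambda>i. (?q i - P i) / 3) (- 1) (\<lambda>i. (?p i - P i) / 3)"
      by (auto simp: lc_def field_simps)
    then show ?thesis using a by (simp add: lc_lat_pts)
  next
    case False
    then have a: "(\<lambda>i. (?p i + P i) / 3) \<in> lat_pts G" "(\<lambda>i. (?q i + P i) / 3) \<in> lat_pts G"
      using P(4) gq par by (auto simp: coherent_def)
    have "(\<lambda>i. (?q i - ?p i) / 3) = lc 1 (\<lambda>i. (?q i + P i) / 3) (- 1) (\<lambda>i. (?p i + P i) / 3)"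
      by (auto simp: lc_def field_simps)
    then show ?thesis using a by (simp add: lc_lat_pts)
  qed
  have "(\<lambda>i. p i / 3) \<in> three_primary L"
  proof -
    have "(\<lambda>i. p i / 3) \<in> rvec (fst L)" using pr by (auto simp: rvec_def)
    moreover have "bil L (\<lambda>i. p i / 3) v \<in> \<int>" if "v \<in> lat_pts L" for v
    proof -
      have "bil L (\<lambda>i. p i / 3) v = bil L p v / 3" using bil_scale_left[of L "1 / 3" p v] by simp
      then show ?thesis using specialD(2)[OF p(1) that] by metis
    qed
    moreover have "(\<lambda>i. 3 ^ 1 * (p i / 3)) \<in> lat_pts L" using specialD(1)[OF p(1)] by simp
    ultimately show ?thesis unfolding three_primary_def dual_pts_def by blast
  qed
  then have "(\<lambda>i. ?\<phi> (\<lambda>i. p i / 3) i + p i / 3) \<in> lat_pts L" using rev unfolding z3_reversing_def by blast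
  moreover have "?\<phi> (\<lambda>i. p i / 3) i = q i / 3" for i
  proof -
    have "(\<lambda>i. p i / 3) = lc (1 / 3) p 0 p" by (auto simp: lc_def)
    then have "?\<phi> (\<lambda>i. p i / 3) = lc (1 / 3) q 0 q" by (simp only: act_lc q_def)
    then show ?thesis by (simp add: lc_def)
  qed
  ultimately have "(\<lambda>i. q i / 3 + p i / 3) \<in> lat_pts L" by simp
  moreover have "(\<lambda>i. q i / 3 + p i / 3) = lc (1 / 3) q (1 / 3) p" by (auto simp: lc_def)
  ultimately have "lc (1 / 3) ?q (1 / 3) ?p \<in> lat_pts G" using d(2) d(1) by metis
  moreover have "(\<lambda>i. 2 / 3 * ?p i) = lc 1 (lc (1 / 3) ?q (1 / 3) ?p) (- 1) (\<lambda>i. (?q i - ?p i) / 3)"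
    by (auto simp: lc_def field_simps)
  ultimately have r: "(\<lambda>i. 2 / 3 * ?p i) \<in> lat_pts G" using diff by (simp add: lc_lat_pts)
  have "bil G (\<lambda>i. 2 / 3 * ?p i) (\<lambda>i. 2 / 3 * ?p i) = - 16 / 3"
    unfolding bil_scale_left bil_scale_right sG(3) by simp
  then have "(- 16 / 3 :: real) \<in> \<int>" using bil_Ints[OF r r] by simp
  then obtain k :: int where "(- 16 / 3 :: real) = of_int k" by (elim Ints_cases)
  then have "real_of_int (- 16) = of_int (3 * k)" by simp
  then have "- 16 = 3 * k" by (simp only: of_int_eq_iff)
  then show False by presburger
qed


text \<open>An automorphism carries the pair (z,p) to another pair of the same kind, so both ends
  are coherent with \<open>pstd\<close>. If p embeds into the wrong half-cone, the pair is replaced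
  by its negative.\<close>

lemma chiral_of_emb_\<Gamma>:
  assumes e: "compl_emb L \<Gamma> \<iota> S" and dual_period: "dual_period 3 L" and p: "special L p" "bil L p p = - 12"
    and z: "z \<in> lat_pts L" "bil L z z = 0" "bil L z p = - 3"
  shows "\<not> achiral L"
proof -
  note d = compl_embD[OF e]
  have main: "\<not> achiral L" if p: "special L p" "bil L p p = - 12"
    and z: "z \<in> lat_pts L" "bil L z z = 0" "bil L z p = - 3" and pp: "bil \<Gamma> pstd (\<iota> p) < 0" for p z
  proof -
    have gd: "coherent \<Gamma> pstd (\<iota> q)"
      if q: "special L q" "bil L q q = - 12" "bil \<Gamma> pstd (\<iota> q) < 0"
        and y: "y \<in> lat_pts L" "bil L y y = 0" "bil L y q = - 3" for q y
    proof (rule coherent_\<Gamma>[of "\<iota> y"])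
      show sq: "special \<Gamma> (\<iota> q)" by (rule compl_emb_spec[OF e \<Gamma>_props(1) q(1)])
      show nq: "bil \<Gamma> (\<iota> q) (\<iota> q) = - 12" using d(3) q(2) by simp
      have "bil \<Gamma> (\<iota> q) pstd < 0" using q(3) sym_formD[OF \<Gamma>_props(1), of "\<iota> q" pstd] by simp
      then show "bil \<Gamma> (\<iota> q) interior < 0"
        using lorentzian_half[OF \<Gamma>_props(2,1) _ interior_props(2,6), of "\<iota> q"] interior_props(5) nq by simp
    qed (use y d(2,3) in auto)
    show ?thesis
    proof (rule chiral_of_emb[OF e \<Gamma>_props(1-3) dual_period p off_mirrors_\<Gamma> interior_props(4,5) pp])
      show "coherent \<Gamma> pstd (\<iota> p)" by (rule gd[OF p pp z])
      fix A assume aut: "is_aut L A" and a: "bil \<Gamma> pstd (\<iota> (act (fst L) A p)) < 0"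
      let ?\<phi> = "act (fst L) A"
      have iso: "bil L (?\<phi> x) (?\<phi> y) = bil L x y" if "x \<in> lat_pts L" "y \<in> lat_pts L" for x y
        using aut that by (simp add: is_aut_def)
      have "?\<phi> z \<in> lat_pts L" using aut z(1) by (auto simp: is_aut_def bij_betw_def)
      then show "coherent \<Gamma> pstd (\<iota> (?\<phi> p))"
        using aut_spec[OF aut p(1)] iso specialD(1)[OF p(1)] p(2) z a by (intro gd[of _ "?\<phi> z"]) auto
    qed
  qed
  have neg: "\<iota> (\<lambda>i. - x i) = (\<lambda>i. - \<iota> x i)" for x
  proof -
    have "(\<lambda>i. - x i) = lc (- 1) x 0 x" by (auto simp: lc_def)
    then show ?thesis using d(1)[of "- 1" x 0 x] by (simp add: lc_def)
  qed
  have "bil \<Gamma> pstd (\<iota> p) \<noteq> 0"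
    using \<Gamma>_props(2) interior_props(5) d(3)[of p p] p(2) unfolding lorentzian_def by force
  then consider "bil \<Gamma> pstd (\<iota> p) < 0" | "bil \<Gamma> pstd (\<iota> (\<lambda>i. - p i)) < 0"
    unfolding neg bil_minus_right by linarith
  then show ?thesis
  proof cases
    case 1
    then show ?thesis using main[OF p z] by blast
  next
    case 2
    have "special L (\<lambda>i. - p i)"
    proof (rule specialI)
      show "(\<lambda>i. - p i) \<in> lat_pts L" using specialD(1)[OF p(1)] by (auto simp: lat_pts_def rvec_def)
      fix w assume "w \<in> lat_pts L"
      then have "- (bil L p w / 3) \<in> \<int>" using specialD(2)[OF p(1)] by (intro Ints_minus)
      then show "bil L (\<lambda>i. - p i) w / 3 \<in> \<int>" by (simp add: bil_minus_left)
    qed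
    moreover have "(\<lambda>i. - z i) \<in> lat_pts L" using z(1) by (auto simp: lat_pts_def rvec_def)
    ultimately show ?thesis
      using main[of "\<lambda>i. - p i" "\<lambda>i. - z i"] 2 p(2) z(2,3) by (simp add: bil_minus_left bil_minus_right)
  qed
qed

section \<open>Chiral lattices as complements of orthogonal 2-roots\<close>

lemma compl_emb_mA1_U: "compl_emb latmA1 latU (\<lambda>x. lvec [x 0, - x 0]) {lvec [1, 1]}"
proof -
  have "\<exists>x\<in>lat_pts latmA1. lvec [x 0, - x 0] = u" if u: "u \<in> lat_pts latU" "bil latU u (lvec [1, 1]) = 0" for u
  proof (rule bexI[of _ "lvec [u 0]"])
    have "u 1 = - u 0" using u(2) by (simp add: bil_latU add_eq_0_iff)
    moreover have "u \<in> rvec 2" using lat_ptsD(2)[OF u(1)] by simp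
    ultimately show "lvec [lvec [u 0] 0, - lvec [u 0] 0] = u"
      by (intro rvec_eqI[of _ 2]) (auto simp: lvec_rvec less_2_cases_iff)
    show "lvec [u 0] \<in> lat_pts latmA1" using lat_ptsD(1)[OF u(1)] by (intro lvec_lat_pts) auto
  qed
  moreover have "lvec [lc a x b y 0, - lc a x b y 0] = lc a (lvec [x 0, - x 0]) b (lvec [y 0, - y 0])" for a x b y
    by (rule ext) (auto simp: lvec_def lc_def nth_Cons')
  moreover have "lvec [x 0, - x 0] \<in> lat_pts latU" if "x \<in> lat_pts latmA1" for x
    using lat_ptsD(1)[OF that] by (intro lvec_lat_pts) (auto simp: Ints_mult)
  ultimately show ?thesis
    unfolding compl_emb_def by (auto simp: bil_latU bil_latmA1 intro!: lvec_lat_pts )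
qed

lemma compl_emb_6_A2: "compl_emb lat6 latA2 (\<lambda>x. lvec [x 0, 2 * x 0]) {lvec [1, 0]}"
proof -
  have "\<exists>x\<in>lat_pts lat6. lvec [x 0, 2 * x 0] = u" if u: "u \<in> lat_pts latA2" "bil latA2 u (lvec [1, 0]) = 0" for u
  proof (rule bexI[of _ "lvec [u 0]"])
    have "u 1 = 2 * u 0" using u(2) by (simp add: bil_latA2)
    moreover have "u \<in> rvec 2" using lat_ptsD(2)[OF u(1)] by simp
    ultimately show "lvec [lvec [u 0] 0, 2 * lvec [u 0] 0] = u"
      by (intro rvec_eqI[of _ 2]) (auto simp: lvec_rvec less_2_cases_iff)
    show "lvec [u 0] \<in> lat_pts lat6" using lat_ptsD(1)[OF u(1)] by (intro lvec_lat_pts) auto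
  qed
  moreover have "lvec [lc a x b y 0, 2 * lc a x b y 0] = lc a (lvec [x 0, 2 * x 0]) b (lvec [y 0, 2 * y 0])" for a x b y
    by (rule ext) (auto simp: lvec_def lc_def nth_Cons')
  moreover have "lvec [x 0, 2 * x 0] \<in> lat_pts latA2" if "x \<in> lat_pts lat6" for x
    using lat_ptsD(1)[OF that] by (intro lvec_lat_pts) (auto simp: Ints_mult)
  ultimately show ?thesis
    unfolding compl_emb_def by (auto simp: bil_latA2 bil_lat6 intro!: lvec_lat_pts Ints_mult )
qed

lemma lvec_lc:
  "length xs = length ys \<Longrightarrow> lc a (lvec xs) b (lvec ys) = lvec (map2 (\<lambda>x y. a * x + b * y) xs ys)"
  by (rule ext) (auto simp: lc_def lvec_def)

lemma lvec_eqI_8: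
  assumes "u \<in> lat_pts latE8" "length xs = 8" "\<forall>i<8. xs ! i = u i"
  shows "lvec xs = u"
proof (rule rvec_eqI[of _ 8])
  show "lvec xs \<in> rvec 8" using assms(2) by (simp add: lvec_rvec)
  show "u \<in> rvec 8" using lat_ptsD(2)[OF assms(1)] by simp
qed (use assms in \<open>simp add: lvec_def\<close>)

text \<open>The removed roots form a cascade of highest roots: of E8, then of its complement E7,
  then of the complement D6 of the second. What remains is the A1 of node 6 and the D4 with centre
  at node 3.\<close>

lemma compl_emb_D4_A1_E8: "compl_emb (osum latD4 (rep 1 latA1)) latE8
  (\<lambda>x. lvec [0, x 0, x 2, x 1, x 3, 0, x 4, 0])
  {lvec [2,3,4,6,5,4,3,2], lvec [2,2,3,4,3,2,1,0], lvec [0,1,1,2,2,2,1,0]}"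
proof -
  let ?L = "osum latD4 (rep 1 latA1)"
  have b: "bil ?L x y = bil latD4 x y + 2 * x 4 * y 4" for x y
    by (simp add: bil_osum bil_latA1 bil_rank_0 shift_def)
  have "\<exists>x\<in>lat_pts ?L. lvec [0, x 0, x 2, x 1, x 3, 0, x 4, 0] = u"
    if u: "u \<in> lat_pts latE8" "bil latE8 u (lvec [2,3,4,6,5,4,3,2]) = 0"
      "bil latE8 u (lvec [2,2,3,4,3,2,1,0]) = 0" "bil latE8 u (lvec [0,1,1,2,2,2,1,0]) = 0" for u
  proof (rule bexI[of _ "lvec [u 1, u 3, u 2, u 4, u 6]"])
    have "u 7 = 0" "u 0 = 0" "u 5 = 0" using u(2-4) by (simp_all add: bil_latE8)
    then show "lvec [0, lvec [u 1, u 3, u 2, u 4, u 6] 0, lvec [u 1, u 3, u 2, u 4, u 6] 2,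
        lvec [u 1, u 3, u 2, u 4, u 6] 1, lvec [u 1, u 3, u 2, u 4, u 6] 3, 0,
        lvec [u 1, u 3, u 2, u 4, u 6] 4, 0] = u"
      by (intro lvec_eqI_8[OF u(1)]) (simp_all add: less_8_iff)
    show "lvec [u 1, u 3, u 2, u 4, u 6] \<in> lat_pts ?L"
      using lat_ptsD(1)[OF u(1)] by (intro lvec_lat_pts) auto
  qed
  moreover have "lvec [0, lc a x b y 0, lc a x b y 2, lc a x b y 1, lc a x b y 3, 0, lc a x b y 4, 0] = lc a (lvec [0, x 0, x 2, x 1, x 3, 0, x 4, 0]) b (lvec [0, y 0, y 2, y 1, y 3, 0, y 4, 0])" for a x b y
    by (simp add: lvec_lc) (simp add: lc_def)
  moreover have "bil latE8 (lvec [0, x 0, x 2, x 1, x 3, 0, x 4, 0]) (lvec [0, y 0, y 2, y 1, y 3, 0, y 4, 0]) = bil ?L x y" for x y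
    unfolding b by (simp add: bil_latE8 bil_latD4 algebra_simps)
  moreover have "lvec [0, x 0, x 2, x 1, x 3, 0, x 4, 0] \<in> lat_pts latE8" if "x \<in> lat_pts ?L" for x
    using lat_ptsD(1)[OF that] by (intro lvec_lat_pts) (auto simp: Ints_mult)
  ultimately show ?thesis
    unfolding compl_emb_def
    by (auto simp: bil_latE8 intro!: lvec_lat_pts )
qed

lemma bil_rep_4: "bil (rep 4 latA1) x y = 2 * (x 0 * y 0 + x 1 * y 1 + x 2 * y 2 + x 3 * y 3)"
  by (simp add: numeral_eq_Suc bil_osum bil_latA1 bil_rank_0 shift_def)

text \<open>One more step of the cascade: the highest root of the remaining D4 leaves its three
  outer nodes, and node 6 is the fourth A1.\<close>

lemma compl_emb_4A1_E8: "compl_emb (rep 4 latA1) latE8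
  (\<lambda>x. lvec [0, x 0, x 1, 0, x 2, 0, x 3, 0])
  {lvec [2,3,4,6,5,4,3,2], lvec [2,2,3,4,3,2,1,0], lvec [0,1,1,2,2,2,1,0], lvec [0,1,1,2,1,0,0,0]}"
proof -
  let ?L = "rep 4 latA1"
  have "\<exists>x\<in>lat_pts ?L. lvec [0, x 0, x 1, 0, x 2, 0, x 3, 0] = u"
    if u: "u \<in> lat_pts latE8" "bil latE8 u (lvec [2,3,4,6,5,4,3,2]) = 0"
      "bil latE8 u (lvec [2,2,3,4,3,2,1,0]) = 0" "bil latE8 u (lvec [0,1,1,2,2,2,1,0]) = 0"
      "bil latE8 u (lvec [0,1,1,2,1,0,0,0]) = 0" for u
  proof (rule bexI[of _ "lvec [u 1, u 2, u 4, u 6]"])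
    have "u 7 = 0" "u 0 = 0" "u 5 = 0" "u 3 = 0" using u(2-5) by (simp_all add: bil_latE8)
    then show "lvec [0, lvec [u 1, u 2, u 4, u 6] 0, lvec [u 1, u 2, u 4, u 6] 1, 0,
        lvec [u 1, u 2, u 4, u 6] 2, 0, lvec [u 1, u 2, u 4, u 6] 3, 0] = u"
      by (intro lvec_eqI_8[OF u(1)]) (simp_all add: less_8_iff)
    show "lvec [u 1, u 2, u 4, u 6] \<in> lat_pts ?L"
      using lat_ptsD(1)[OF u(1)] by (intro lvec_lat_pts) auto
  qed
  moreover have "lvec [0, lc a x b y 0, lc a x b y 1, 0, lc a x b y 2, 0, lc a x b y 3, 0] = lc a (lvec [0, x 0, x 1, 0, x 2, 0, x 3, 0]) b (lvec [0, y 0, y 1, 0, y 2, 0, y 3, 0])" for a x b y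
    by (simp add: lvec_lc) (simp add: lc_def)
  moreover have "bil latE8 (lvec [0, x 0, x 1, 0, x 2, 0, x 3, 0]) (lvec [0, y 0, y 1, 0, y 2, 0, y 3, 0]) = bil ?L x y" for x y
    by (simp add: bil_rep_4 bil_latE8 algebra_simps)
  moreover have "lvec [0, x 0, x 1, 0, x 2, 0, x 3, 0] \<in> lat_pts latE8" if "x \<in> lat_pts ?L" for x
    using lat_ptsD(1)[OF that] by (intro lvec_lat_pts) (auto simp: Ints_mult)
  ultimately show ?thesis
    unfolding compl_emb_def
    by (auto simp: bil_latE8 intro!: lvec_lat_pts )
qed

lemma compl_emb_osum_A1: "compl_emb Y (osum latA1 Y) (cat 1 (\<lambda>i. 0)) {cat 1 (lvec [1]) (\<lambda>i. 0)}"
proof -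
  have b: "bil (osum latA1 Y) (cat 1 x y) (cat 1 x' y') = 2 * x 0 * x' 0 + bil Y y y'" for x y x' y'
    using bil_cat[of latA1 Y x y x' y'] by (simp add: bil_latA1)
  have lp: "cat 1 x y \<in> lat_pts (osum latA1 Y)" if "x \<in> lat_pts latA1" "y \<in> lat_pts Y" for x y
    using cat_lat_pts[OF that] by simp
  have "\<exists>x\<in>lat_pts Y. cat 1 (\<lambda>i. 0) x = u"
    if u: "u \<in> lat_pts (osum latA1 Y)" "bil (osum latA1 Y) u (cat 1 (lvec [1]) (\<lambda>i. 0)) = 0" for u
  proof (rule bexI[of _ "shift 1 u"])
    show "shift 1 u \<in> lat_pts Y" using shift_lat_pts[OF u(1)] by simp
    have "u 0 = 0" using u(2) bil_cat_right[of latA1 Y u "lvec [1]" "\<lambda>i. 0"] by (simp add: bil_latA1)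
    then show "cat 1 (\<lambda>i. 0) (shift 1 u) = u" by (auto simp: cat_def shift_def)
  qed
  moreover have "lvec [1] \<in> lat_pts latA1" by (intro lvec_lat_pts) auto
  moreover have "cat 1 (\<lambda>i. 0) (lc a x b y) = lc a (cat 1 (\<lambda>i. 0) x) b (cat 1 (\<lambda>i. 0) y)" for a x b y
    by (auto simp: cat_def lc_def)
  ultimately show ?thesis
    unfolding compl_emb_def using b lp zero_lat_pts by auto
qed

lemma compl_emb_rep_rep: "s \<le> t \<Longrightarrow> \<exists>\<iota> S. compl_emb (rep s latA1) (rep t latA1) \<iota> S"
proof (induction t)
  case 0
  then show ?case using compl_emb_id[of "rep 0 latA1"] by auto
next
  case (Suc t)
  show ?case
  proof (cases "s = Suc t")
    case True
    then show ?thesis using compl_emb_id by blast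
  next
    case False
    then obtain \<iota> S where "compl_emb (rep s latA1) (rep t latA1) \<iota> S" using Suc by auto
    from compl_emb_trans[OF this compl_emb_osum_A1] show ?thesis
      using sym_form_rep[OF sym_form_summands(1), of "Suc t"] by auto
  qed
qed

lemma compl_emb_rep_E8: "t \<le> 4 \<Longrightarrow> \<exists>\<iota> S. compl_emb (rep t latA1) latE8 \<iota> S"
  using compl_emb_rep_rep[of t 4] compl_emb_trans[OF _ compl_emb_4A1_E8 sym_form_summands(7)] by blast

lemma osum_E8_rep_0: "osum latE8 (rep 0 L) = latE8"
  by (auto simp: osum_def latE8_def lat_of_def intro!: ext)

lemma compl_emb_osum3:
  assumes "\<exists>\<iota> S. compl_emb X U \<iota> S" "\<exists>\<iota> S. compl_emb T V \<iota> S" "\<exists>\<iota> S. compl_emb Y W \<iota> S"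
  shows "\<exists>\<iota> S. compl_emb (osum X (osum T Y)) (osum U (osum V W)) \<iota> S"
  using assms by (elim exE) (intro exI, rule compl_emb_osum, assumption, rule compl_emb_osum)

lemma \<Gamma>_osum_E8: "\<Gamma> = osum latU (osum latA2 latE8)"
  by (simp only: \<Gamma>_osum osum_E8_rep_0)

section \<open>Chirality below the threshold\<close>

lemma special_multiple:
  assumes "x \<in> lat_pts L"
  shows "special L (\<lambda>i. 3 * x i)"
proof (rule specialI)
  show "(\<lambda>i. 3 * x i) \<in> lat_pts L" using assms by (intro lat_pts_scale) auto
  show "bil L (\<lambda>i. 3 * x i) w / 3 \<in> \<int>" if "w \<in> lat_pts L" for w
    using bil_Ints[OF assms that] by (simp add: bil_scale_left)
qed

lemma chiral_mA1_A2:
  assumes "\<exists>\<iota> S. compl_emb Y latE8 \<iota> S" "dual_period 1 Y"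
  shows "\<not> achiral (osum latmA1 (osum latA2 Y))" (is "\<not> achiral ?L")
proof -
  obtain \<iota> S where e: "compl_emb ?L \<Gamma> \<iota> S"
    using compl_emb_osum3[OF _ _ assms(1)] compl_emb_mA1_U compl_emb_id unfolding \<Gamma>_osum_E8 by blast
  have dual_period: "dual_period 3 ?L" using dual_period_1_imp_3[OF dual_period_latmA1] dual_period_latA2 dual_period_1_imp_3[OF assms(2)] by (intro dual_period_osum)
  let ?p = "cat (fst latmA1) (\<lambda>i. 3 * lvec [1] i) (cat (fst latA2) (lvec [1, 2]) (\<lambda>i. 0))"
  let ?z = "cat (fst latmA1) (lvec [1]) (cat (fst latA2) (lvec [0, 1]) (\<lambda>i. 0))"
  have "special latA2 (lvec [1, 2])"
    by (rule specialI) (auto simp: bil_latA2 intro!: lvec_lat_pts dest: lat_ptsD)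
  then have "special ?L ?p" by (intro special_cat special_multiple special_zero lvec_lat_pts) auto
  moreover have "?z \<in> lat_pts ?L" by (intro cat_lat_pts lvec_lat_pts zero_lat_pts) auto
  moreover have "bil ?L ?p ?p = - 12" "bil ?L ?z ?z = 0" "bil ?L ?z ?p = - 3"
    unfolding bil_cat by (simp_all add: bil_latmA1 bil_latA2)
  ultimately show ?thesis using chiral_of_emb_\<Gamma>[OF e dual_period] by blast
qed

lemma chiral_U_A2:
  assumes "\<exists>\<iota> S. compl_emb Y latE8 \<iota> S" "dual_period 1 Y"
  shows "\<not> achiral (osum latU (osum latA2 Y))" (is "\<not> achiral ?L")
proof -
  obtain \<iota> S where e: "compl_emb ?L \<Gamma> \<iota> S"
    using compl_emb_osum3[OF _ _ assms(1)] compl_emb_id unfolding \<Gamma>_osum_E8 by blast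
  have dual_period: "dual_period 3 ?L" using dual_period_1_imp_3[OF dual_period_latU] dual_period_latA2 dual_period_1_imp_3[OF assms(2)] by (intro dual_period_osum)
  let ?p = "cat (fst latU) (\<lambda>i. 3 * lvec [1, - 1] i) (cat (fst latA2) (lvec [- 1, - 2]) (\<lambda>i. 0))"
  let ?z = "cat (fst latU) (lvec [0, - 1]) (\<lambda>i. 0)"
  have "special latA2 (lvec [- 1, - 2])"
    by (rule specialI) (auto simp: bil_latA2 intro!: lvec_lat_pts dest: lat_ptsD)
  then have "special ?L ?p" by (intro special_cat special_multiple special_zero lvec_lat_pts) auto
  moreover have "?z \<in> lat_pts ?L" by (intro cat_lat_pts lvec_lat_pts zero_lat_pts) auto
  moreover have "bil ?L ?p ?p = - 12" "bil ?L ?z ?z = 0" "bil ?L ?z ?p = - 3"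
    unfolding bil_cat by (simp_all add: bil_latU bil_latA2)
  ultimately show ?thesis using chiral_of_emb_\<Gamma>[OF e dual_period] by blast
qed

lemma chiral_mA1_6_E8: "\<not> achiral (osum latmA1 (osum lat6 latE8))" (is "\<not> achiral ?L")
proof -
  obtain \<iota> S where e: "compl_emb ?L \<Gamma> \<iota> S"
    using compl_emb_osum3[of latmA1 latU lat6 latA2 latE8 latE8] compl_emb_mA1_U compl_emb_6_A2 compl_emb_id
    unfolding \<Gamma>_osum_E8 by blast
  have dual_period: "dual_period 3 ?L" by (intro dual_period_osum dual_period_lat6 dual_period_1_imp_3[OF dual_period_latmA1] dual_period_1_imp_3[OF dual_period_latE8])
  \<comment> \<open>With z = e + r for an E8 root r and p = 3c e - h + 3y the conditions read y^2 =
    2 c^2 - 2 and r.y = 2c - 1; they are solved by c = 2 and y of norm 6 with r.y = 3.\<close>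
  let ?p = "cat (fst latmA1) (\<lambda>i. 3 * lvec [2] i) (cat (fst lat6) (lvec [- 1]) (\<lambda>i. 3 * lvec [2, 0, 1] i))"
  let ?z = "cat (fst latmA1) (lvec [1]) (cat (fst lat6) (\<lambda>i. 0) (lvec [1]))"
  have "special lat6 (lvec [- 1])"
    by (rule specialI) (auto simp: bil_lat6 intro!: lvec_lat_pts Ints_mult dest: lat_ptsD)
  then have "special ?L ?p" by (intro special_cat special_multiple special_zero lvec_lat_pts) auto
  moreover have "?z \<in> lat_pts ?L" by (intro cat_lat_pts lvec_lat_pts zero_lat_pts) auto
  moreover have "bil ?L ?p ?p = - 12" "bil ?L ?z ?z = 0" "bil ?L ?z ?p = - 3"
    unfolding bil_cat by (simp_all add: bil_latmA1 bil_lat6 bil_latE8)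
  ultimately show ?thesis using chiral_of_emb_\<Gamma>[OF e dual_period] by blast
qed

lemma chiral_row0:
  assumes "t \<le> 1"
  shows "\<not> achiral (row0 t)"
proof -
  let ?L = "osum latmA1 (osum lat6 (rep t latA1))"
  obtain \<iota> S where e: "compl_emb ?L \<Delta> \<iota> S"
    using compl_emb_osum3[OF _ _ compl_emb_rep_rep[OF assms]] compl_emb_id unfolding \<Delta>_osum by blast
  note d = compl_embD[OF e]
  have dual_period: "dual_period 3 ?L"
    using dual_period_1_imp_3[OF dual_period_latmA1] dual_period_lat6 dual_period_1_imp_3[OF dual_period_rep[OF dual_period_latA1]] by (intro dual_period_osum)
  let ?P = "lvec [3, - 1, 0]" and ?a = "lvec [4, - 1, - 1]"
  have P: "special \<Delta> ?P" "bil \<Delta> ?P ?P = - 12" "bil \<Delta> ?P ?a < 0" "bil \<Delta> ?a ?a < 0"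
  proof -
    show "special \<Delta> ?P"
    proof (rule specialI)
      show "?P \<in> lat_pts \<Delta>" by (auto intro!: lvec_lat_pts simp: \<Delta>_props(4))
      fix w assume w: "w \<in> lat_pts \<Delta>"
      have "bil \<Delta> ?P w / 3 = - 2 * w 0 - 2 * w 1" by (simp add: bil_\<Delta>)
      also have "\<dots> \<in> \<int>" using lat_ptsD(1)[OF w] by (intro Ints_diff Ints_mult) simp_all
      finally show "bil \<Delta> ?P w / 3 \<in> \<int>" .
    qed
  qed (simp_all add: bil_\<Delta>)
  have gd: "coherent \<Delta> ?P (\<iota> q)" if q: "special ?L q" "bil ?L q q = - 12" "bil \<Delta> ?P (\<iota> q) < 0" for q
  proof (rule coherent_\<Delta>)
    show sq: "special \<Delta> (\<iota> q)" by (rule compl_emb_spec[OF e \<Delta>_props(1) q(1)])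
    show nq: "bil \<Delta> (\<iota> q) (\<iota> q) = - 12" using d(3) q(2) by simp
    have "bil \<Delta> (\<iota> q) ?P < 0" using q(3) sym_formD[OF \<Delta>_props(1), of "\<iota> q" ?P] by simp
    then show "bil \<Delta> (\<iota> q) ?a < 0"
      using lorentzian_half[OF \<Delta>_props(2,1) _ P(4,3), of "\<iota> q"] P(2) nq by simp
  qed
  have main: "\<not> achiral ?L" if p: "special ?L p" "bil ?L p p = - 12" and pp: "bil \<Delta> ?P (\<iota> p) < 0" for p
  proof (rule chiral_of_emb[OF e \<Delta>_props(1-3) dual_period p off_mirrors_\<Delta> P(1,2) pp])
    show "coherent \<Delta> ?P (\<iota> p)" by (rule gd[OF p pp])
    fix A assume aut: "is_aut ?L A" and a: "bil \<Delta> ?P (\<iota> (act (fst ?L) A p)) < 0"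
    have "bil ?L (act (fst ?L) A p) (act (fst ?L) A p) = - 12"
      using aut specialD(1)[OF p(1)] p(2) by (simp add: is_aut_def)
    then show "coherent \<Delta> ?P (\<iota> (act (fst ?L) A p))" using aut_spec[OF aut p(1)] a by (intro gd)
  qed
  have ex: "special ?L (cat (fst latmA1) (\<lambda>i. 3 * lvec [c] i) (cat (fst lat6) (lvec [b]) (\<lambda>i. 0)))"
    if "c \<in> \<int>" "b \<in> \<int>" for b c :: real
  proof -
    have "special lat6 (lvec [b])"
      using that by (intro specialI) (auto simp: bil_lat6 intro!: lvec_lat_pts Ints_mult dest: lat_ptsD)
    then show ?thesis using that by (intro special_cat special_multiple special_zero lvec_lat_pts) auto
  qed
  \<comment> \<open>Both signs are prepared, since exactly one of the two vectors embeds into the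
    half-cone of \<open>?P\<close>.\<close>
  let ?p = "\<lambda>c. cat (fst latmA1) (\<lambda>i. 3 * lvec [c] i) (cat (fst lat6) (lvec [c]) (\<lambda>i. 0))"
  have n: "bil ?L (?p 1) (?p 1) = - 12" "bil ?L (?p (- 1)) (?p (- 1)) = - 12"
    unfolding bil_cat by (simp_all add: bil_latmA1 bil_lat6)
  have "?p (- 1) = lc (- 1) (?p 1) 0 (?p 1)" by (rule ext) (auto simp: cat_def lc_def lvec_def)
  then have "bil \<Delta> ?P (\<iota> (?p (- 1))) = - bil \<Delta> ?P (\<iota> (?p 1))" by (simp add: d(1) bil_lc_right)
  moreover have "bil \<Delta> ?P (\<iota> (?p 1)) \<noteq> 0"
    using \<Delta>_props(2) P(2) d(3)[of "?p 1" "?p 1"] n(1) unfolding lorentzian_def by force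
  ultimately have "bil \<Delta> ?P (\<iota> (?p 1)) < 0 \<or> bil \<Delta> ?P (\<iota> (?p (- 1))) < 0" by linarith
  then have "\<not> achiral ?L" using main[OF ex n(1)] main[OF ex n(2)] by auto
  then show ?thesis by (simp add: row0_def)
qed

theorem theorem4p2:
  shows "(\<forall>t::nat. t \<le> 9 \<longrightarrow> (achiral (row0 t) \<longleftrightarrow> 2 \<le> t)) \<and>
    (\<forall>t::nat. t \<le> 9 \<longrightarrow> (achiral (row2 t) \<longleftrightarrow> 14 \<le> rk (row2 t) + (t + 1))) \<and>
    (\<forall>t::nat. 1 \<le> t \<and> t \<le> 9 \<longrightarrow> (achiral (row4 t) \<longleftrightarrow> 14 \<le> rk (row4 t) + t)) \<and>
    (\<forall>t::nat. 1 \<le> t \<and> t \<le> 6 \<longrightarrow> (achiral (row6 t) \<longleftrightarrow> 14 \<le> rk (row6 t) + (t + 2))) \<and>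
    (\<forall>t::nat. t \<le> 5 \<longrightarrow> (achiral (row8 t) \<longleftrightarrow> 14 \<le> rk (row8 t) + (t + 2))) \<and>
    (\<forall>t::nat. t \<le> 5 \<longrightarrow> (achiral (row10 t) \<longleftrightarrow> 14 \<le> rk (row10 t) + (t + 1))) \<and>
    (\<forall>t::nat. 1 \<le> t \<and> t \<le> 5 \<longrightarrow> (achiral (row12 t) \<longleftrightarrow> 14 \<le> rk (row12 t) + t)) \<and>
    (\<forall>t::nat. 1 \<le> t \<and> t \<le> 2 \<longrightarrow> achiral (row14 t)) \<and>
    (\<forall>t::nat. t \<le> 1 \<longrightarrow> achiral (row16 t)) \<and>
    (\<forall>t::nat. t \<le> 1 \<longrightarrow> achiral (row18 t)) \<and>
    achiral (row20 1)"
proof -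
  \<comment> \<open>With these ranks the condition on rho + d becomes t \<ge> 5, 5, 2, 1, 1, 1 in
    the six rows.\<close>
  have rk: "rk (row2 t) = 3 + t" "rk (row4 t) = 4 + t" "rk (row6 t) = 8 + t" "rk (row8 t) = 10 + t"
    "rk (row10 t) = 11 + t" "rk (row12 t) = 12 + t" for t
    by (simp_all add: rk_def row2_def row4_def row6_def row8_def row10_def row12_def)
  have 0: "achiral (row0 t) \<longleftrightarrow> 2 \<le> t" for t
    using achiral_row0[of t] chiral_row0[of t] by (cases "2 \<le> t") auto
  have 2: "achiral (row2 t) \<longleftrightarrow> 14 \<le> rk (row2 t) + (t + 1)" for t
  proof (cases "5 \<le> t")
    case False
    then have "\<not> achiral (row2 t)"
      unfolding row2_def by (intro chiral_mA1_A2 compl_emb_rep_E8 dual_period_rep dual_period_latA1) simp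
    then show ?thesis using False by (simp add: rk)
  qed (simp add: achiral_rows rk)
  have 4: "achiral (row4 t) \<longleftrightarrow> 14 \<le> rk (row4 t) + t" for t
  proof (cases "5 \<le> t")
    case False
    then have "\<not> achiral (row4 t)"
      unfolding row4_def by (intro chiral_U_A2 compl_emb_rep_E8 dual_period_rep dual_period_latA1) simp
    then show ?thesis using False by (simp add: rk)
  qed (simp add: achiral_rows rk)
  have 6: "achiral (row6 t) \<longleftrightarrow> 14 \<le> rk (row6 t) + (t + 2)" if "1 \<le> t" for t
  proof (cases "2 \<le> t")
    case False
    then have t: "t = 1" using that by simp
    have "\<not> achiral (row6 t)"
      unfolding row6_def t using compl_emb_D4_A1_E8 by (intro chiral_U_A2 Y_rules) blast
    then show ?thesis using t by (simp add: rk)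
  qed (simp add: achiral_rows rk)
  have 8: "achiral (row8 t) \<longleftrightarrow> 14 \<le> rk (row8 t) + (t + 2)" for t
  proof (cases "1 \<le> t")
    case False
    then have t: "t = 0" by simp
    have "\<not> achiral (row8 t)" unfolding row8_def t osum_E8_rep_0 by (rule chiral_mA1_6_E8)
    then show ?thesis using t by (simp add: rk)
  qed (simp add: achiral_rows rk)
  have 10: "achiral (row10 t) \<longleftrightarrow> 14 \<le> rk (row10 t) + (t + 1)" for t
  proof (cases "1 \<le> t")
    case False
    then have t: "t = 0" by simp
    have "\<not> achiral (row10 t)"
      unfolding row10_def t osum_E8_rep_0 using compl_emb_id by (intro chiral_mA1_A2 dual_period_latE8) blast
    then show ?thesis using t by (simp add: rk)
  qed (simp add: achiral_rows rk)
  \<comment> \<open>This row starts at t = 1, where the threshold is already reached, so both sides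
    hold throughout.\<close>
  have 12: "achiral (row12 t) \<longleftrightarrow> 14 \<le> rk (row12 t) + t" if "1 \<le> t" for t
    using that by (simp add: achiral_rows rk)
  show ?thesis using 0 2 4 6 8 10 12 achiral_rows(7-10) by blast
qed

end
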